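(* (Privacy) For any $\varepsilon_n>0$, $\delta_n\in[0,1]$ and $C>0$, the algorithm $\mathcal{A}_{\rm low}$ (run with privacy parameter $\varepsilon_n$, constant $C$, and any $(\varepsilon_n/2,\delta_n)$-DP mean estimator $\mathcal{M}$) is $(\varepsilon_n,\delta_n)$-DP. (Accuracy) There is a constant $c>0$ such that for all $\zeta>0$, $C>0$, $\varepsilon_n>0$ and $\delta_n\in[0,1]$, there exist an initial $(\varepsilon_n/2,\delta_n)$-DP mean estimator $\mathcal{M}_{\zeta,C}$ and constants $N\in\mathbb{N}$, $k\ge0$, $C'>0$, $D>0$ such that for all measures $\mu$ on $\mathbb{R}$ (with associated exponential family $\{P_\theta\}_{\theta\in\Phi}$) and all $\theta_0\in\Phi$: if - $\varepsilon_n\ge\frac{k}{\sqrt n}$, - $\dfrac{\mathbb{E}_{\theta_0}\big((x-\mathbb{E}_{\theta_0}(x))^4\big)}{A''(\theta_0)^2}\le\zeta$, - $\kappa(\theta_0)\ge\dfrac1C\cdot\dfrac{1}{\sqrt{A''(\theta_0)}}$, then for all $n\in\mathbb{N}$ such that $$n\ge\max\left\{N,\ \frac{c\,\zeta^2\ln(1/\delta_n)}{\varepsilon_n},\ \frac{2\ln\left(\frac{1}{(DA''(\theta_0))^2}\right)}{(DA''(\theta_0))^2}\right\}$$ we have $$\mathfrak{R}_n(\theta_0,\mathcal{A}_{{\rm low},C,\zeta})\le C'\,\omega_n(P_{\theta_0},\mathcal{F}^{\rm test}_{\varepsilon_n}),$$ where $\mathcal{A}_{{\rm low},C,\zeta}$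 is $\mathcal{A}_{\rm low}$ with initial mean estimator $\mathcal{M}_{\zeta,C}$.
   Context: Exponential family: for a measure $\mu$ on $\mathbb{R}$, $A(\theta)=\ln\int e^{\theta x}d\mu(x)$, $\Phi=\{\theta: A(\theta)<\infty\}$, and for $\theta\in\Phi$, $P_\theta$ has density $p_\theta(x)=e^{\theta x-A(\theta)}$ relative to $\mu$. Then $\mathbb{E}_\theta[x]=A'(\theta)$, $\mathrm{var}_\theta(x)=A''(\theta)$. It is implicitly assumed that $\mu$ is not concentrated at one point (so $A''>0$ and $A'$ is injective) and that parameters considered are interior points of $\Phi$. $\kappa(\theta)=\sup\{r : \forall\theta'\in[\theta-r,\theta+r],\ A''(\theta)/A''(\theta')\in[\tfrac12,2]\}$ (interval required to lie where $A''$ is defined; may be $+\infty$). A randomized mechanism $M$ is $(\varepsilon,\delta)$-DP if for all datasets $d,d'$ of the same size differing in one record and all events $E$, $\Pr[M(d)\in E]\le e^\varepsilon\Pr[M(d')\in E]+\delta$; $\varepsilon$-DP means $(\varepsilon,0)$-DP. $\mathcal{F}^{\rm test}_\varepsilon$ is the class of all $\varepsilon$-DP tests (randomized $\{0,1\}$-valued functions of the sample). A test $T$ distinguishes $P,Q$ with $n$ samples if $\Pr(T(P^n)=0)\ge0.75$ and $\Pr(T(Q^n)=1)\ge0.75$; $\mathrm{SC}_\varepsilon(P,Q)$ is the smallest $n$ such that some $\varepsilon$-DP test distinguishes $P$ and $Q$ with $N$ samples for all $N\ge n$; and $\omega_n(P_\theta,\mathcal{F}^{\rm test}_\varepsilon)=\sup\{|\theta-\theta'|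 : \theta'\in\Phi,\ \mathrm{SC}_\varepsilon(P_\theta,P_{\theta'})>n\}$. Algorithm $\mathrm{nCLLRE}(X,\hat t,C,\varepsilon)$ for $X=(x_1,\dots,x_n)$: let $\alpha_n(\theta)=\frac{1}{\sqrt{nA''(\theta)}}$ and $\tilde\alpha=\alpha_n\big((A')^{-1}(\hat t)\big)$; let $f_{\tilde\alpha}(X)=\frac1n\sum_{i=1}^n[x_i-\hat t]_{-\varepsilon/(C\tilde\alpha)}^{\varepsilon/(C\tilde\alpha)}$, where $[u]_a^b=\min\{\max\{u,a\},b\}$; let $\hat f=f_{\tilde\alpha}(X)+\mathrm{Lap}\left(\frac{2}{nC\tilde\alpha}\right)$ with $\mathrm{Lap}(s)$ an independent centered Laplace variable of scale $s$; return $\hat\theta=\arg\min_\theta\big|\hat f-\mathbb{E}_{X'\sim P_\theta^n}(f_{\tilde\alpha}(X'))\big|$. Algorithm $\mathcal{A}_{\rm low}$ with privacy parameter $\varepsilon$ and constant $C$: the input is two independent samples $X_1,X_2\sim P_{\theta_0}^n$ and an $(\varepsilon/2,\delta)$-DP mean estimator $\mathcal{M}$ (a randomized map from datasets to $\mathbb{R}$); compute $\hat t=\mathcal{M}(X_2)$ and return $\mathrm{nCLLRE}(X_1,\hat t,C,\varepsilon/2)$. $\mathfrak{R}_n(\theta_0,\mathcal{A})$ is the smallest $r$ such that, when the samples given to $\mathcal{A}$ ($n$ points in each of $X_1,X_2$) are drawn i.i.d. from $P_{\theta_0}$, the output satisfies $|\hat\theta-\theta_0|\le r$ with probability at least $0.75$.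 *)

theory Defs
  imports "HOL-Probability.Probability"
begin

text \<open>Exponential families on the real line\<close>

text \<open>The last clause says that \<open>\<mu>\<close> is not concentrated at one point; it also excludes the null
  measure.\<close>

definition base_measure :: "real measure \<Rightarrow> bool" where
  "base_measure \<mu> \<longleftrightarrow> sets \<mu> = sets borel \<and> \<not> (\<exists>a. AE x in \<mu>. x = a)"

definition log_partition :: "real measure \<Rightarrow> real \<Rightarrow> real" where
  "log_partition \<mu> \<theta> = ln (\<integral>x. exp (\<theta> * x) \<partial>\<mu>)"

text \<open>Finiteness of the log-partition function is expressed by the nonnegative integral, because the
  Bochner integral of a non-integrable function is 0.\<close>

definition param_space :: "real measure \<Rightarrow> real set" where
  "param_space \<mu> = {\<theta>. (\<integral>\<^sup>+x. ennreal (exp (\<theta> * x)) \<partial>\<mu>) < \<infinity>}"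

definition expfam :: "real measure \<Rightarrow> real \<Rightarrow> real measure" where
  "expfam \<mu> \<theta> = density \<mu> (\<lambda>x. ennreal (exp (\<theta> * x - log_partition \<mu> \<theta>)))"

text \<open>The derivatives are only meaningful on \<open>interior (param_space \<mu>)\<close>, and are only used there.\<close>

definition log_partition' :: "real measure \<Rightarrow> real \<Rightarrow> real" where
  "log_partition' \<mu> = deriv (log_partition \<mu>)"

definition log_partition'' :: "real measure \<Rightarrow> real \<Rightarrow> real" where
  "log_partition'' \<mu> = deriv (log_partition' \<mu>)"

definition fourth_central_moment :: "real measure \<Rightarrow> real" where
  "fourth_central_moment P = (\<integral>x. (x - (\<integral>y. y \<partial>P)) ^ 4 \<partial>P)"

definition kappa :: "real measure \<Rightarrow> real \<Rightarrow> ereal" where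
  "kappa \<mu> \<theta> = Sup {ereal r | r. 0 \<le> r \<and> {\<theta> - r..\<theta> + r} \<subseteq> interior (param_space \<mu>) \<and>
     (\<forall>\<theta>'\<in>{\<theta> - r..\<theta> + r}. log_partition'' \<mu> \<theta> / log_partition'' \<mu> \<theta>' \<in> {1/2..2})}"


text \<open>Differential privacy\<close>

text \<open>A data set of size \<open>n\<close> is a point of the product space below; a randomized map on data
  sets of size \<open>n\<close> is a probability kernel on that space.\<close>

definition datasets :: "nat \<Rightarrow> (nat \<Rightarrow> real) measure" where
  "datasets n = Pi\<^sub>M {..<n} (\<lambda>_. borel)"

definition iid :: "nat \<Rightarrow> real measure \<Rightarrow> (nat \<Rightarrow> real) measure" where
  "iid n P = Pi\<^sub>M {..<n} (\<lambda>_. P)"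

definition neighbours :: "nat \<Rightarrow> (nat \<Rightarrow> real) \<Rightarrow> (nat \<Rightarrow> real) \<Rightarrow> bool" where
  "neighbours n d d' \<longleftrightarrow> d \<in> space (datasets n) \<and> d' \<in> space (datasets n) \<and>
     (\<exists>i<n. \<forall>j<n. j \<noteq> i \<longrightarrow> d j = d' j)"

definition DP :: "nat \<Rightarrow> 'b measure \<Rightarrow> real \<Rightarrow> real \<Rightarrow> ((nat \<Rightarrow> real) \<Rightarrow> 'b measure) \<Rightarrow> bool" where
  "DP n S \<epsilon> \<delta> M \<longleftrightarrow> M \<in> datasets n \<rightarrow>\<^sub>M prob_algebra S \<and>
     (\<forall>d d'. neighbours n d d' \<longrightarrow>
        (\<forall>E\<in>sets S. measure (M d) E \<le> exp \<epsilon> * measure (M d') E + \<delta>))"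


text \<open>Private tests, sample complexity and modulus of continuity\<close>

definition DP_tests :: "real \<Rightarrow> (nat \<Rightarrow> (nat \<Rightarrow> real) \<Rightarrow> nat measure) set" where
  "DP_tests \<epsilon> = {T. \<forall>n. DP n (count_space {0, 1}) \<epsilon> 0 (T n)}"

definition distinguishes ::
    "(nat \<Rightarrow> (nat \<Rightarrow> real) \<Rightarrow> nat measure) \<Rightarrow> real measure \<Rightarrow> real measure \<Rightarrow> nat \<Rightarrow> bool" where
  "distinguishes T P Q n \<longleftrightarrow>
     measure (iid n P \<bind> T n) {0} \<ge> 3/4 \<and> measure (iid n Q \<bind> T n) {1} \<ge> 3/4"

definition SC :: "real \<Rightarrow> real measure \<Rightarrow> real measure \<Rightarrow> enat" where
  "SC \<epsilon> P Q = Inf {enat n | n. \<exists>T\<in>DP_tests \<epsilon>. \<forall>N\<ge>n. distinguishes T P Q N}"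

definition modulus :: "real measure \<Rightarrow> nat \<Rightarrow> real \<Rightarrow> real \<Rightarrow> ereal" where
  "modulus \<mu> n \<epsilon> \<theta> = Sup {ereal \<bar>\<theta> - \<theta>'\<bar> | \<theta>'.
     \<theta>' \<in> param_space \<mu> \<and> SC \<epsilon> (expfam \<mu> \<theta>) (expfam \<mu> \<theta>') > enat n}"


text \<open>The algorithms\<close>

definition laplace :: "real \<Rightarrow> real measure" where
  "laplace s = density lborel (\<lambda>x. ennreal (exp (- \<bar>x\<bar> / s) / (2 * s)))"

definition clip :: "real \<Rightarrow> real \<Rightarrow> real \<Rightarrow> real" where
  "clip a b u = min (max u a) b"

definition alpha :: "real measure \<Rightarrow> nat \<Rightarrow> real \<Rightarrow> real" where
  "alpha \<mu> n \<theta> = 1 / sqrt (real n * log_partition'' \<mu> \<theta>)"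

definition alpha_tilde :: "real measure \<Rightarrow> nat \<Rightarrow> real \<Rightarrow> real" where
  "alpha_tilde \<mu> n t = alpha \<mu> n (the_inv_into (interior (param_space \<mu>)) (log_partition' \<mu>) t)"

definition clipped_mean :: "nat \<Rightarrow> real \<Rightarrow> real \<Rightarrow> real \<Rightarrow> real \<Rightarrow> (nat \<Rightarrow> real) \<Rightarrow> real" where
  "clipped_mean n C \<epsilon> t a X =
     (1 / real n) * (\<Sum>i<n. clip (- (\<epsilon> / (C * a))) (\<epsilon> / (C * a)) (X i - t))"

text \<open>The output distribution of nCLLRE. If \<open>t\<close> is not in the range of the derivative of the
  log-partition function, \<open>alpha_tilde\<close> is not defined; the algorithm then outputs an
  unspecified constant. Likewise \<open>arg_min\<close> denotes an arbitrary minimizer if there are several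
  (the clipped mean is then a constant), and an unspecified constant if there is none.\<close>

definition nCLLRE ::
    "real measure \<Rightarrow> nat \<Rightarrow> real \<Rightarrow> real \<Rightarrow> (nat \<Rightarrow> real) \<Rightarrow> real \<Rightarrow> real measure" where
  "nCLLRE \<mu> n C \<epsilon> X t =
     (if t \<in> log_partition' \<mu> ` interior (param_space \<mu>) then
        (let a = alpha_tilde \<mu> n t; f = clipped_mean n C \<epsilon> t a
         in distr (laplace (2 / (real n * C * a))) borel
              (\<lambda>z. arg_min (\<lambda>\<theta>. \<bar>(f X + z) - (\<integral>X'. f X' \<partial>iid n (expfam \<mu> \<theta>))\<bar>)
                           (\<lambda>\<theta>. \<theta> \<in> param_space \<mu>)))
      else return borel undefined)"

text \<open>The input of \<open>A_low \<mu> n C \<epsilon> M\<close> is a data set of size \<open>2 * n\<close>: its first \<open>n\<close> records form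
  the first sample, the other \<open>n\<close> records form the sample given to the mean estimator \<open>M\<close>.\<close>

definition A_low ::
    "real measure \<Rightarrow> nat \<Rightarrow> real \<Rightarrow> real \<Rightarrow> ((nat \<Rightarrow> real) \<Rightarrow> real measure) \<Rightarrow>
     (nat \<Rightarrow> real) \<Rightarrow> real measure" where
  "A_low \<mu> n C \<epsilon> M X =
     M (\<lambda>i\<in>{..<n}. X (n + i)) \<bind> nCLLRE \<mu> n C (\<epsilon> / 2) (\<lambda>i\<in>{..<n}. X i)"

definition risk ::
    "real measure \<Rightarrow> nat \<Rightarrow> real \<Rightarrow> ((nat \<Rightarrow> real) \<Rightarrow> real measure) \<Rightarrow> ereal" where
  "risk \<mu> n \<theta>\<^sub>0 \<A> = Inf {ereal r | r.
     measure (iid (2 * n) (expfam \<mu> \<theta>\<^sub>0) \<bind> \<A>) {\<theta>. \<bar>\<theta> - \<theta>\<^sub>0\<bar> \<le> r} \<ge> 3/4}"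

text \<open>\<open>ln (1 / \<delta>)\<close> with its value \<open>\<infinity>\<close> at \<open>\<delta> = 0\<close> (where the real-valued expression would be 0).\<close>

definition ln_recip :: "real \<Rightarrow> ereal" where
  "ln_recip \<delta> = (if \<delta> = 0 then \<infinity> else ereal (ln (1 / \<delta>)))"

end

theory Submission
  imports Defs
begin

text \<open>Privacy: conditionally on the other half of the data, the output is a post-processed Laplace mechanism, so
  the two halves compose; the work is in showing that the \<open>arg_min\<close> is measurable.

  Accuracy: the minimizer inverts the strictly increasing map taking \<open>\<theta>\<close> to the mean of the clipped
  average. Near \<open>\<theta>\<^sub>0\<close> its increments are at least a quarter of the variance times the step, because clipping at a
  large multiple of the standard deviation \<open>\<sigma>\<close> costs only a small part of the increment of the unclipped mean
  (fourth moment and chi-square divergence). The noise is of order \<open>\<sigma> / \<surd>n\<close>, hence the risk is of order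
  \<open>1 / (\<sigma> \<surd>n)\<close>, and below that scale no test distinguishes the two parameters.

  The initial estimator has to find location and scale from scratch. Blocks of order \<open>\<zeta>\<close> records each vote for
  a cell (logarithm of the block variance, block mean) of a randomly shifted grid. With high probability most blocks
  agree, and then changing few records does not change the majority; its distance to a change is released with Laplace
  noise and compared with \<open>ln (1/\<delta>) / \<epsilon>\<close>. A clipped average around the winning cell refines the estimate.\<close>

text \<open>The initial estimator has to be chosen before the measure \<mu>, so neither location nor
  scale can be built into it, and the cells it votes on form an infinite set. Releasing a cell by
  stability copes with this but asks for \<delta> > 0; for \<delta> = 0 the condition on the sample
  size reads n \<ge> \<infinity>, and a constant estimator serves.

  A crude estimate is enough. An error of
  \<open>sqrt (log_partition'' \<mu> \<theta>) / (4 * C)\<close> keeps the preimage of the estimate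
  under \<open>log_partition'\<close> within half of the radius that the hypothesis on
  \<open>kappa\<close> guarantees. There the variance is known up to a factor 2, so
  \<open>alpha_tilde\<close> has the right order, and the rate comes from the second step alone.

  Budgets: the two stages of the estimator spend \<epsilon>/4 each and \<open>nCLLRE\<close> spends
  \<epsilon>/2. The estimator succeeds with probability 4/5 and \<open>nCLLRE\<close>, given a good
  centre, with probability 19/20; the product 19/25 exceeds 3/4.\<close>

section \<open>Indistinguishability of measures and its composition rules\<close>

definition close :: "real \<Rightarrow> real \<Rightarrow> 'a measure \<Rightarrow> 'a measure \<Rightarrow> bool" where
  "close \<epsilon> \<delta> P Q \<longleftrightarrow> (\<forall>E\<in>sets P. measure P E \<le> exp \<epsilon> * measure Q E + \<delta>)"

lemma closeD: "close \<epsilon> \<delta> P Q \<Longrightarrow> E \<in> sets P \<Longrightarrow> measure P E \<le> exp \<epsilon> * measure Q E + \<delta>"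
  by (auto simp: close_def)

lemma close_refl: "0 \<le> \<epsilon> \<Longrightarrow> 0 \<le> \<delta> \<Longrightarrow> close \<epsilon> \<delta> P P"
  by (auto simp: close_def) (metis add_increasing2 measure_nonneg mult_right_mono one_le_exp_iff mult_1)

lemma close_mono:
  assumes "close \<epsilon> \<delta> P Q" "\<epsilon> \<le> \<epsilon>'" "\<delta> \<le> \<delta>'"
  shows "close \<epsilon>' \<delta>' P Q"
  unfolding close_def
proof
  fix E assume "E \<in> sets P"
  then have "measure P E \<le> exp \<epsilon> * measure Q E + \<delta>" using assms by (auto simp: close_def)
  also have "\<dots> \<le> exp \<epsilon>' * measure Q E + \<delta>'" using assms by (intro add_mono mult_right_mono) auto
  finally show "measure P E \<le> exp \<epsilon>' * measure Q E + \<delta>'" .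
qed

lemma DP_I:
  assumes "M \<in> datasets n \<rightarrow>\<^sub>M prob_algebra S"
    and "\<And>d d'. neighbours n d d' \<Longrightarrow> close \<epsilon> \<delta> (M d) (M d')"
  shows "DP n S \<epsilon> \<delta> M"
  unfolding DP_def
proof (intro conjI assms(1) allI impI ballI)
  fix d d' E assume *: "neighbours n d d'" and E: "E \<in> sets S"
  have "d \<in> space (datasets n)" using * by (auto simp: neighbours_def)
  then have "sets (M d) = sets S"
    using measurable_space[OF assms(1)] by (auto simp: space_prob_algebra)
  then show "measure (M d) E \<le> exp \<epsilon> * measure (M d') E + \<delta>"
    using assms(2)[OF *] E by (auto simp: close_def)
qed

lemma DP_close:
  assumes "DP n S \<epsilon> \<delta> M" "neighbours n d d'"
  shows "close \<epsilon> \<delta> (M d) (M d')"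
proof -
  have "d \<in> space (datasets n)" using assms by (auto simp: neighbours_def)
  then have "sets (M d) = sets S"
    using assms(1) by (auto simp: space_prob_algebra DP_def dest!: measurable_space)
  then show ?thesis using assms by (auto simp: DP_def close_def)
qed

text \<open>Layer cake: \<open>g x\<close> is the Lebesgue measure of \<open>{t. 0 \<le> t < g x}\<close>, so the bound on events,
  applied to the superlevel sets of \<open>g\<close>, integrates to a bound on \<open>g\<close>.\<close>

lemma close_integral:
  assumes P: "prob_space P" and Q: "prob_space Q" and s: "sets Q = sets P"
    and c: "close \<epsilon> \<delta> P Q" and g: "g \<in> borel_measurable P"
    and g01: "\<And>x. x \<in> space P \<Longrightarrow> 0 \<le> g x \<and> g x \<le> 1"
  shows "(\<integral>x. g x \<partial>P) \<le> exp \<epsilon> * (\<integral>x. g x \<partial>Q) + (\<delta>::real)"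
proof -
  interpret P: prob_space P by fact
  interpret Q: prob_space Q by fact
  note [measurable] = g
  have gQ[measurable]: "g \<in> borel_measurable Q" using g s by (simp cong: measurable_cong_sets)
  have sp: "space Q = space P" using s by (rule sets_eq_imp_space_eq)
  have "{} \<in> sets P" by simp
  \<comment> \<open>The bound for the empty event already forces this.\<close>
  then have d0: "0 \<le> \<delta>" using c by (auto simp: close_def dest: bspec[where x="{}"])
  let ?I = "{0..<1::real}"
  have layer: "(\<integral>\<^sup>+x. ennreal (g x) \<partial>R) = (\<integral>\<^sup>+t. emeasure R {x\<in>space R. t < g x} * indicator ?I t \<partial>lborel)"
    if R: "prob_space R" and gR[measurable]: "g \<in> borel_measurable R" and spR: "space R = space P" for R
  proof -
    interpret R: prob_space R by fact
    interpret pair_sigma_finite R lborel ..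
    have 1: "ennreal (g x) = (\<integral>\<^sup>+t. indicator {0..<g x} t \<partial>lborel)" if "x \<in> space R" for x
      using g01 that spR by (simp add: nn_integral_indicator)
    have "(\<integral>\<^sup>+x. ennreal (g x) \<partial>R) = (\<integral>\<^sup>+x. (\<integral>\<^sup>+t. indicator {0..<g x} t \<partial>lborel) \<partial>R)"
      by (intro nn_integral_cong 1)
    also have "\<dots> = (\<integral>\<^sup>+x. (\<integral>\<^sup>+t. indicator {(x,t). x \<in> space R \<and> 0 \<le> t \<and> t < g x \<and> t < 1} (x,t) \<partial>lborel) \<partial>R)"
      using g01 spR by (intro nn_integral_cong) (auto simp: indicator_def, fastforce)
    also have "\<dots> = (\<integral>\<^sup>+t. (\<integral>\<^sup>+x. indicator {(x,t). x \<in> space R \<and> 0 \<le> t \<and> t < g x \<and> t < 1} (x,t) \<partial>R) \<partial>lborel)"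
      by (intro Fubini'[symmetric]) measurable
    also have "\<dots> = (\<integral>\<^sup>+t. (\<integral>\<^sup>+x. indicator {x\<in>space R. t < g x} x * indicator ?I t \<partial>R) \<partial>lborel)"
      by (intro nn_integral_cong) (auto simp: indicator_def)
    also have "\<dots> = (\<integral>\<^sup>+t. emeasure R {x\<in>space R. t < g x} * indicator ?I t \<partial>lborel)"
      by (intro nn_integral_cong) (simp add: nn_integral_multc)
    finally show ?thesis .
  qed
  have mQ: "(\<lambda>t. emeasure Q {x\<in>space Q. t < g x}) \<in> borel_measurable lborel"
    by measurable
  have ptw: "emeasure P {x\<in>space P. t < g x} \<le> ennreal (exp \<epsilon>) * emeasure Q {x\<in>space Q. t < g x} + ennreal \<delta>" for t
  proof -
    have "measure P {x\<in>space P. t < g x} \<le> exp \<epsilon> * measure Q {x\<in>space P. t < g x} + \<delta>"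
      by (rule closeD[OF c]) measurable
    then show ?thesis
      using d0 by (simp add: P.emeasure_eq_measure Q.emeasure_eq_measure sp flip: ennreal_mult' ennreal_plus)
  qed
  have "(\<integral>\<^sup>+x. ennreal (g x) \<partial>P) \<le> (\<integral>\<^sup>+t. ennreal (exp \<epsilon>) * (emeasure Q {x\<in>space Q. t < g x} * indicator ?I t) + ennreal \<delta> * indicator ?I t \<partial>lborel)"
    unfolding layer[OF P g refl]
    by (intro nn_integral_mono) (use ptw in \<open>auto simp: indicator_def\<close>)
  also have "\<dots> = ennreal (exp \<epsilon>) * (\<integral>\<^sup>+x. ennreal (g x) \<partial>Q) + ennreal \<delta>"
    unfolding layer[OF Q gQ sp] using mQ
    by (subst nn_integral_add) (auto simp: nn_integral_cmult)
  finally have *: "(\<integral>\<^sup>+x. ennreal (g x) \<partial>P) \<le> ennreal (exp \<epsilon>) * (\<integral>\<^sup>+x. ennreal (g x) \<partial>Q) + ennreal \<delta>" .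
  have "integrable P g" by (rule P.integrable_const_bound[where B=1]) (use g01 in auto)
  then have 1: "(\<integral>\<^sup>+x. ennreal (g x) \<partial>P) = ennreal (\<integral>x. g x \<partial>P)"
    by (rule nn_integral_eq_integral) (use g01 in auto)
  have "integrable Q g" by (rule Q.integrable_const_bound[where B=1]) (use g01 sp in auto)
  then have 2: "(\<integral>\<^sup>+x. ennreal (g x) \<partial>Q) = ennreal (\<integral>x. g x \<partial>Q)"
    by (rule nn_integral_eq_integral) (use g01 sp in auto)
  have "0 \<le> (\<integral>x. g x \<partial>Q)" by (rule integral_nonneg_AE) (use g01 sp in auto)
  then show ?thesis using * d0 unfolding 1 2
    by (simp flip: ennreal_mult' ennreal_plus)
qed

lemma measure_bind_prob:
  assumes P: "P \<in> space (prob_algebra N)" and K: "K \<in> N \<rightarrow>\<^sub>M prob_algebra L" and E: "E \<in> sets L"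
  shows "measure (P \<bind> K) E = (\<integral>x. measure (K x) E \<partial>P)"
    and "(\<lambda>x. measure (K x) E) \<in> borel_measurable N"
    and "integrable P (\<lambda>x. measure (K x) E)"
proof -
  have sP: "sets P = sets N" and pP: "prob_space P" using P by (auto simp: space_prob_algebra)
  interpret prob_space P by fact
  have spP: "space P = space N" using sP by (rule sets_eq_imp_space_eq)
  have Kx: "prob_space (K x)" if "x \<in> space N" for x
    using measurable_space[OF K that] by (auto simp: space_prob_algebra)
  show m: "(\<lambda>x. measure (K x) E) \<in> borel_measurable N"
    using measure_measurable_prob_algebra2[OF _ K, of "\<lambda>_. E"] E by auto
  then have mP: "(\<lambda>x. measure (K x) E) \<in> borel_measurable P"
    using sP by (simp cong: measurable_cong_sets)
  show i: "integrable P (\<lambda>x. measure (K x) E)"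
    by (rule integrable_const_bound[where B=1]) (use Kx spP mP in \<open>auto simp: prob_space.prob_le_1\<close>)
  have "emeasure (P \<bind> K) E = (\<integral>\<^sup>+x. emeasure (K x) E \<partial>P)"
    by (rule emeasure_bind_prob_algebra[OF P K E])
  also have "\<dots> = (\<integral>\<^sup>+x. ennreal (measure (K x) E) \<partial>P)"
  proof (intro nn_integral_cong)
    fix x assume "x \<in> space P"
    then interpret K: prob_space "K x" using Kx spP by auto
    show "emeasure (K x) E = ennreal (measure (K x) E)" by (rule K.emeasure_eq_measure)
  qed
  also have "\<dots> = ennreal (\<integral>x. measure (K x) E \<partial>P)"
    by (intro nn_integral_eq_integral i) auto
  finally show "measure (P \<bind> K) E = (\<integral>x. measure (K x) E \<partial>P)"
    by (simp add: measure_def)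
qed

lemma bind_in_prob_algebra:
  assumes P: "P \<in> space (prob_algebra N)" and K: "K \<in> N \<rightarrow>\<^sub>M prob_algebra L"
  shows "P \<bind> K \<in> space (prob_algebra L)"
proof -
  \<comment> \<open>A single measure is treated as a kernel on a one-point space.\<close>
  have "(\<lambda>_. P) \<in> count_space {()} \<rightarrow>\<^sub>M prob_algebra N" using P by simp
  from measurable_bind_prob_space[OF this K] show ?thesis
    by (auto dest: measurable_space)
qed

text \<open>Composition with an adaptively chosen second step. Under \<open>P\<close> the kernel
  \<open>K\<close> is first replaced by \<open>exp \<epsilon>2\<close> times \<open>K'\<close>,
  truncated at 1, plus \<delta>2; only then is \<open>P\<close> exchanged for \<open>Q\<close>. The
  truncation makes \<open>close_integral\<close> applicable, and as \<delta>2 stays outside the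
  exchanged integral it is not multiplied by \<open>exp \<epsilon>1\<close>.\<close>

lemma close_bind:
  assumes P: "P \<in> space (prob_algebra N)" and Q: "Q \<in> space (prob_algebra N)"
    and K: "K \<in> N \<rightarrow>\<^sub>M prob_algebra L" and K': "K' \<in> N \<rightarrow>\<^sub>M prob_algebra L"
    and c1: "close \<epsilon>1 \<delta>1 P Q" and c2: "\<And>x. x \<in> space N \<Longrightarrow> close \<epsilon>2 \<delta>2 (K x) (K' x)"
    and e1: "0 \<le> \<epsilon>1" and d2: "0 \<le> \<delta>2"
  shows "close (\<epsilon>1 + \<epsilon>2) (\<delta>1 + \<delta>2) (P \<bind> K) (Q \<bind> K')"
  unfolding close_def
proof
  fix E assume "E \<in> sets (P \<bind> K)"
  have sP: "sets P = sets N" and pP: "prob_space P" using P by (auto simp: space_prob_algebra)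
  have sQ: "sets Q = sets N" and pQ: "prob_space Q" using Q by (auto simp: space_prob_algebra)
  have spP: "space P = space N" using sP by (rule sets_eq_imp_space_eq)
  have spQ: "space Q = space N" using sQ by (rule sets_eq_imp_space_eq)
  interpret P: prob_space P by fact
  interpret Q: prob_space Q by fact
  have E: "E \<in> sets L" using \<open>E \<in> sets (P \<bind> K)\<close> bind_in_prob_algebra[OF P K] by (auto simp: space_prob_algebra)
  note b1 = measure_bind_prob[OF P K E] and b2 = measure_bind_prob[OF Q K' E]
  let ?g = "\<lambda>x. min 1 (exp \<epsilon>2 * measure (K' x) E)"
  have mg[measurable]: "?g \<in> borel_measurable N" using b2(2) by measurable
  have mgP: "?g \<in> borel_measurable P" using mg sP by (simp cong: measurable_cong_sets)
  have mgQ: "?g \<in> borel_measurable Q" using mg sQ by (simp cong: measurable_cong_sets)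
  have iP: "integrable P ?g" by (rule P.integrable_const_bound[where B=1]) (use mgP in \<open>auto simp: min_def\<close>)
  have iQ: "integrable Q ?g" by (rule Q.integrable_const_bound[where B=1]) (use mgQ in \<open>auto simp: min_def\<close>)
  have le: "measure (K x) E \<le> ?g x + \<delta>2" if "x \<in> space N" for x
  proof -
    have "K x \<in> space (prob_algebra L)" using K that by (rule measurable_space)
    then have "prob_space (K x)" "sets (K x) = sets L" by (auto simp: space_prob_algebra)
    then show ?thesis using closeD[OF c2[OF that], of E] E d2
      by (auto simp: min_def prob_space.prob_le_1 add_increasing2)
  qed
  have "measure (P \<bind> K) E \<le> (\<integral>x. ?g x + \<delta>2 \<partial>P)"
    unfolding b1(1) by (intro integral_mono b1(3) Bochner_Integration.integrable_add iP) (use le spP in auto)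
  also have "\<dots> = (\<integral>x. ?g x \<partial>P) + \<delta>2" using iP by (simp add: P.prob_space)
  also have "(\<integral>x. ?g x \<partial>P) \<le> exp \<epsilon>1 * (\<integral>x. ?g x \<partial>Q) + \<delta>1"
    by (rule close_integral[OF pP pQ _ c1 mgP]) (use sP sQ in auto)
  also have "(\<integral>x. ?g x \<partial>Q) \<le> (\<integral>x. exp \<epsilon>2 * measure (K' x) E \<partial>Q)"
    by (intro integral_mono iQ integrable_mult_right b2(3)) auto
  also have "\<dots> = exp \<epsilon>2 * measure (Q \<bind> K') E" using b2 by simp
  finally show "measure (P \<bind> K) E \<le> exp (\<epsilon>1 + \<epsilon>2) * measure (Q \<bind> K') E + (\<delta>1 + \<delta>2)"
    by (simp add: exp_add algebra_simps)
qed

lemma close_distr: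
  assumes P: "prob_space P" and Q: "prob_space Q" and s: "sets P = sets Q"
    and f: "f \<in> P \<rightarrow>\<^sub>M N" and c: "close \<epsilon> \<delta> P Q"
  shows "close \<epsilon> \<delta> (distr P N f) (distr Q N f)"
  unfolding close_def
proof
  fix E assume "E \<in> sets (distr P N f)"
  then have E: "E \<in> sets N" by simp
  have f': "f \<in> Q \<rightarrow>\<^sub>M N" using f s by (simp cong: measurable_cong_sets)
  have sp: "space P = space Q" using s by (rule sets_eq_imp_space_eq)
  show "measure (distr P N f) E \<le> exp \<epsilon> * measure (distr Q N f) E + \<delta>"
    using E f f' closeD[OF c measurable_sets[OF f E]] by (simp add: measure_distr sp)
qed

section \<open>The Laplace distribution\<close>

lemma sets_laplace [simp, measurable_cong]: "sets (laplace b) = sets borel"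
  by (simp add: laplace_def)

lemma space_laplace [simp]: "space (laplace b) = UNIV"
  by (simp add: laplace_def)

text \<open>The Laplace law is the even mixture of an exponential law and its mirror image, so its
  total mass and tails reduce to those of the exponential distribution.\<close>

lemma emeasure_laplace:
  assumes b: "0 < b" and E[measurable]: "E \<in> sets borel"
  shows "emeasure (laplace b) E = (emeasure (density lborel (exponential_density (1/b))) E +
     emeasure (density lborel (exponential_density (1/b))) (uminus -` E)) / 2"
proof -
  have [measurable]: "uminus -` E \<in> sets borel"
    using measurable_sets[OF borel_measurable_uminus[OF measurable_ident_sets[OF refl]] E] by simp
  \<comment> \<open>At 0 both exponential densities are positive, so the identity of densities fails
    at this one point.\<close>
  have "AE x in lborel. x \<noteq> (0::real)" by (rule AE_lborel_singleton)
  then have "emeasure (laplace b) E = (\<integral>\<^sup>+x. (ennreal (exponential_density (1/b) x) * indicator E x + ennreal (exponential_density (1/b) (-x)) * indicator E x) / 2 \<partial>lborel)"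
    unfolding laplace_def
    by (subst emeasure_density; (intro nn_integral_cong_AE)?)
       (auto elim!: eventually_mono simp: exponential_density_def indicator_def divide_ennreal ennreal_divide_numeral field_simps b split: if_splits)
  also have "\<dots> = ((\<integral>\<^sup>+x. ennreal (exponential_density (1/b) x) * indicator E x \<partial>lborel) + (\<integral>\<^sup>+x. ennreal (exponential_density (1/b) (-x)) * indicator E x \<partial>lborel)) / 2"
    by (simp add: nn_integral_divide nn_integral_add)
  also have "(\<integral>\<^sup>+x. ennreal (exponential_density (1/b) (-x)) * indicator E x \<partial>lborel) = (\<integral>\<^sup>+x. ennreal (exponential_density (1/b) x) * indicator (uminus -` E) x \<partial>lborel)"
    by (subst nn_integral_real_affine[where c="-1" and t=0]) (auto simp: indicator_def)
  finally show ?thesis by (simp add: emeasure_density)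
qed

lemma prob_space_laplace:
  assumes "0 < b" shows "prob_space (laplace b)"
proof
  interpret prob_space "density lborel (exponential_density (1/b))"
    using assms by (intro prob_space_exponential_density) simp
  show "emeasure (laplace b) (space (laplace b)) = 1"
    using emeasure_space_1 by (simp add: emeasure_laplace assms)
qed

lemma measure_laplace_greater:
  assumes b: "0 < b" and a: "0 \<le> a"
  shows "measure (laplace b) {a<..} = exp (- a / b) / 2"
    and "measure (laplace b) {..< - a} = exp (- a / b) / 2"
proof -
  let ?D = "density lborel (exponential_density (1/b))"
  interpret prob_space ?D
    using assms by (intro prob_space_exponential_density) simp
  have d: "distributed ?D lborel (\<lambda>x. x) (exponential_density (1/b))"
    using b by (auto simp: distributed_def distr_id2 exponential_density_nonneg)
  have 1: "prob {a<..} = exp (- a / b)"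
    using exponential_distributedD_gt[OF d a] b by (simp add: greaterThan_def)
  have "AE x in ?D. 0 \<le> x" by (subst AE_density) (auto simp: exponential_density_def)
  then have "prob {..< -a} = 0"
    by (intro prob_eq_0[THEN iffD2]) (use a in \<open>auto elim!: eventually_mono\<close>)
  moreover have "uminus -` {..< -a} = {a<..}" "uminus -` {a<..} = {..< -a}" by auto
  ultimately show "measure (laplace b) {a<..} = exp (- a / b) / 2"
     "measure (laplace b) {..< - a} = exp (- a / b) / 2"
    using 1 by (simp_all add: measure_def[of "laplace b"] emeasure_laplace[OF b] emeasure_eq_measure ennreal_divide_numeral)
qed

lemma laplace_tail:
  assumes b: "0 < b" and a: "0 \<le> a"
  shows "measure (laplace b) {z. a < \<bar>z\<bar>} = exp (- a / b)"
proof -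
  interpret prob_space "laplace b" using b by (rule prob_space_laplace)
  have "{z. a < \<bar>z\<bar>} = {a<..} \<union> {..< -a}" by auto
  then show ?thesis using a by (simp add: finite_measure_Union measure_laplace_greater[OF b a] disjoint_iff)
qed

text \<open>Moves the scale, which in \<open>nCLLRE\<close> depends on the estimate
  \<open>t\<close>, out of the measure and into the mapped function; joint measurability of
  \<open>nCLLRE\<close> rests on this.\<close>

lemma laplace_scale:
  assumes b: "0 < b"
  shows "laplace b = distr (laplace 1) borel (\<lambda>z. b * z)"
proof (rule measure_eqI)
  fix E assume "E \<in> sets (laplace b)"
  then have [measurable]: "E \<in> sets borel" by simp
  have [measurable]: "(\<lambda>z. b * z) -` E \<in> sets borel"
    using measurable_sets[OF borel_measurable_times[OF borel_measurable_const measurable_ident_sets[OF refl]] \<open>E \<in> sets borel\<close>] by simp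
  show "emeasure (laplace b) E = emeasure (distr (laplace 1) borel (\<lambda>z. b * z)) E"
    unfolding laplace_def using b
    by (subst emeasure_distr; simp add: emeasure_density)
       (subst nn_integral_real_affine[where c=b and t=0],
         auto simp: abs_mult indicator_def nn_integral_cmult[symmetric] simp flip: ennreal_mult' intro!: nn_integral_cong)
qed simp

text \<open>By the triangle inequality the two densities differ by a factor of at most
  \<open>exp (\<bar>v - v'\<bar> / b)\<close> at every point.\<close>

lemma laplace_shift:
  assumes b: "0 < b"
  shows "close (\<bar>v - v'\<bar> / b) 0 (distr (laplace b) borel (\<lambda>z. v + z)) (distr (laplace b) borel (\<lambda>z. v' + z))"
  unfolding close_def
proof
  fix E assume "E \<in> sets (distr (laplace b) borel (\<lambda>z. v + z))"
  then have [measurable]: "E \<in> sets borel" by simp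
  interpret L: prob_space "laplace b" using b by (rule prob_space_laplace)
  have eq: "emeasure (distr (laplace b) borel (\<lambda>z. w + z)) E =
       (\<integral>\<^sup>+x. ennreal (exp (- \<bar>x - w\<bar> / b) / (2 * b)) * indicator E x \<partial>lborel)" for w
  proof -
    have [measurable]: "(\<lambda>z. w + z) -` E \<in> sets borel"
      using measurable_sets[OF borel_measurable_add[OF borel_measurable_const measurable_ident_sets[OF refl]] \<open>E \<in> sets borel\<close>] by simp
    show ?thesis
      unfolding laplace_def using b
      by (subst emeasure_distr; simp add: emeasure_density)
         (subst nn_integral_real_affine[where c=1 and t="-w"], auto simp: indicator_def intro!: nn_integral_cong)
  qed
  have "emeasure (distr (laplace b) borel (\<lambda>z. v + z)) E \<le>
       (\<integral>\<^sup>+x. ennreal (exp (\<bar>v - v'\<bar> / b)) * (ennreal (exp (- \<bar>x - v'\<bar> / b) / (2 * b)) * indicator E x) \<partial>lborel)"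
    unfolding eq
  proof (intro nn_integral_mono)
    fix x
    have "- \<bar>x - v\<bar> / b \<le> \<bar>v - v'\<bar> / b + - \<bar>x - v'\<bar> / b" using b
      by (simp add: field_simps)
    then have "exp (- \<bar>x - v\<bar> / b) \<le> exp (\<bar>v - v'\<bar> / b) * exp (- \<bar>x - v'\<bar> / b)"
      unfolding exp_add[symmetric] by simp
    then have "exp (- \<bar>x - v\<bar> / b) / (2*b) \<le> exp (\<bar>v - v'\<bar> / b) * (exp (- \<bar>x - v'\<bar> / b) / (2*b))"
      using b by (simp add: divide_right_mono)
    then show "ennreal (exp (- \<bar>x - v\<bar> / b) / (2 * b)) * indicator E x \<le>
       ennreal (exp (\<bar>v - v'\<bar> / b)) * (ennreal (exp (- \<bar>x - v'\<bar> / b) / (2 * b)) * indicator E x)"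
      using b by (auto simp: indicator_def simp flip: ennreal_mult' intro!: ennreal_leI)
  qed
  also have "\<dots> = ennreal (exp (\<bar>v - v'\<bar> / b)) * emeasure (distr (laplace b) borel (\<lambda>z. v' + z)) E"
    unfolding eq by (intro nn_integral_cmult) auto
  finally show "measure (distr (laplace b) borel (\<lambda>z. v + z)) E \<le> exp (\<bar>v - v'\<bar> / b) * measure (distr (laplace b) borel (\<lambda>z. v' + z)) E + 0"
    using L.prob_space_distr[of "\<lambda>z. v + z" borel] L.prob_space_distr[of "\<lambda>z. v' + z" borel]
    by (simp add: finite_measure.emeasure_eq_measure[OF prob_space.finite_measure] flip: ennreal_mult')
qed

text \<open>The map \<phi> stands for whatever is computed from the noisy value: the minimizer in
  \<open>nCLLRE\<close>, a threshold test in \<open>release\<close>, the identity in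
  \<open>clip_release\<close>.\<close>

lemma laplace_mechanism:
  assumes b: "0 < b" and d: "\<bar>v - v'\<bar> \<le> \<epsilon> * b" and \<phi>: "\<phi> \<in> borel \<rightarrow>\<^sub>M N"
  shows "close \<epsilon> 0 (distr (laplace b) N (\<lambda>z. \<phi> (v + z))) (distr (laplace b) N (\<lambda>z. \<phi> (v' + z)))"
proof -
  have "close \<epsilon> 0 (distr (laplace b) borel (\<lambda>z. v + z)) (distr (laplace b) borel (\<lambda>z. v' + z))"
    by (rule close_mono[OF laplace_shift[OF b]]) (use b d in \<open>auto simp: field_simps\<close>)
  then have "close \<epsilon> 0 (distr (distr (laplace b) borel (\<lambda>z. v + z)) N \<phi>) (distr (distr (laplace b) borel (\<lambda>z. v' + z)) N \<phi>)"
    by (intro close_distr prob_space.prob_space_distr prob_space_laplace b) (use \<phi> in auto)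
  then show ?thesis using \<phi> by (subst (asm) (1 2) distr_distr) (auto simp: comp_def)
qed

section \<open>Elementary bounds for the exponential function\<close>

text \<open>A single term of the exponential series with nonnegative terms is at most its
  sum.\<close>

lemma abs_power_le_exp:
  fixes x :: real assumes "0 < e"
  shows "\<bar>x\<bar> ^ k \<le> fact k / e ^ k * exp (e * \<bar>x\<bar>)"
proof -
  let ?y = "e * \<bar>x\<bar>"
  have "(\<lambda>n. ?y ^ n /\<^sub>R fact n) sums exp ?y" by (rule exp_converges)
  then have "(\<Sum>n\<in>{k}. ?y ^ n /\<^sub>R fact n) \<le> exp ?y"
    using assms sum_le_suminf[of "\<lambda>n. ?y ^ n /\<^sub>R fact n" "{k}"] by (simp add: sums_iff)
  then show ?thesis using assms by (simp add: field_simps power_mult_distrib)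
qed

lemma exp_minus_linear_le:
  fixes u :: real
  shows "\<bar>exp u - 1 - u\<bar> \<le> u\<^sup>2 * exp \<bar>u\<bar>"
proof -
  obtain t where t: "\<bar>t\<bar> \<le> \<bar>u\<bar>" "exp u = (\<Sum>m<2. u ^ m / fact m) + exp t / fact 2 * u ^ 2"
    using Maclaurin_exp_le[of u 2] by blast
  then have "exp u - 1 - u = exp t / 2 * u\<^sup>2" by (simp add: eval_nat_numeral)
  moreover have "exp t / 2 \<le> exp \<bar>u\<bar>" using t(1) by (smt (verit) exp_le_cancel_iff exp_gt_zero field_sum_of_halves)
  moreover have "\<bar>exp t / 2 * u\<^sup>2\<bar> = u\<^sup>2 * (exp t / 2)" by simp
  ultimately show ?thesis by (metis mult_left_mono zero_le_power2)
qed

text \<open>A bound that no longer depends on \<theta>: it shows that the parameter space is an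
  interval and provides the dominating function in \<open>expectation_continuous\<close>.\<close>

lemma exp_interval_le:
  fixes x :: real assumes "a \<le> \<theta>" "\<theta> \<le> b"
  shows "exp (\<theta> * x) \<le> exp (a * x) + exp (b * x)"
proof (cases "0 \<le> x")
  case True
  then have "exp (\<theta> * x) \<le> exp (b * x)" using assms by (simp add: mult_right_mono)
  then show ?thesis by (smt (verit) exp_gt_zero)
next
  case False
  then have "exp (\<theta> * x) \<le> exp (a * x)" using assms by (simp add: mult_right_mono_neg)
  then show ?thesis by (smt (verit) exp_gt_zero)
qed

section \<open>Moments and derivatives of the log-partition function\<close>

locale exp_family =
  fixes \<mu> :: "real measure"
  assumes base: "base_measure \<mu>"
begin

lemma sets_mu [simp, measurable_cong]: "sets \<mu> = sets borel"
  using base by (simp add: base_measure_def)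

lemma space_mu [simp]: "space \<mu> = UNIV"
  using sets_eq_imp_space_eq[OF sets_mu] by simp

lemma not_AE_const: "\<not> (AE x in \<mu>. x = a)"
  using base by (auto simp: base_measure_def)

abbreviation "\<Phi> \<equiv> param_space \<mu>"
abbreviation "A \<equiv> log_partition \<mu>"

text \<open>Unnormalized moments. Each is the derivative of the preceding one
  (\<open>mom_deriv\<close>), so the derivatives of \<open>A = ln Z\<close> become rational
  expressions in them.\<close>

definition mom :: "nat \<Rightarrow> real \<Rightarrow> real" where
  "mom k \<theta> = (\<integral>x. x ^ k * exp (\<theta> * x) \<partial>\<mu>)"

abbreviation "Z \<equiv> mom 0"

lemma integrable_exp_iff: "integrable \<mu> (\<lambda>x. exp (\<theta> * x)) \<longleftrightarrow> \<theta> \<in> \<Phi>"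
  by (simp add: param_space_def integrable_iff_bounded)

lemma integrable_exp: "\<theta> \<in> \<Phi> \<Longrightarrow> integrable \<mu> (\<lambda>x. exp (\<theta> * x))"
  by (simp add: integrable_exp_iff)

lemma Phi_interval: "a \<in> \<Phi> \<Longrightarrow> b \<in> \<Phi> \<Longrightarrow> a \<le> \<theta> \<Longrightarrow> \<theta> \<le> b \<Longrightarrow> \<theta> \<in> \<Phi>"
  unfolding integrable_exp_iff[symmetric]
proof (rule Bochner_Integration.integrable_bound[OF Bochner_Integration.integrable_add])
  assume "a \<le> \<theta>" "\<theta> \<le> b"
  then show "AE x in \<mu>. norm (exp (\<theta> * x)) \<le> norm (exp (a * x) + exp (b * x))"
    by (intro AE_I2) (metis abs_exp_cancel abs_of_nonneg add_nonneg_nonneg exp_ge_zero exp_interval_le real_norm_def)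
qed auto

lemma is_interval_Phi: "is_interval \<Phi>"
  unfolding is_interval_1 using Phi_interval by blast

lemma Z_pos: "\<theta> \<in> \<Phi> \<Longrightarrow> 0 < Z \<theta>"
proof -
  assume \<theta>: "\<theta> \<in> \<Phi>"
  have "Z \<theta> \<noteq> 0"
  proof
    assume "Z \<theta> = 0"
    then have "AE x in \<mu>. exp (\<theta> * x) = 0"
      using integral_nonneg_eq_0_iff_AE[OF integrable_exp[OF \<theta>]] by (simp add: mom_def)
    \<comment> \<open>Since \<open>exp\<close> never vanishes, \<mu> would be the null measure, for
      which this holds vacuously.\<close>
    then have "AE x in \<mu>. x = 0" by (rule eventually_mono) simp
    then show False using not_AE_const by blast
  qed
  moreover have "0 \<le> Z \<theta>" unfolding mom_def by (intro integral_nonneg_AE) auto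
  ultimately show ?thesis by simp
qed

lemma A_eq: "A \<theta> = ln (Z \<theta>)"
  by (simp add: log_partition_def mom_def)

lemma interior_nbhd:
  assumes "\<theta> \<in> interior \<Phi>"
  obtains e where "0 < e" "{\<theta> - e..\<theta> + e} \<subseteq> \<Phi>" "{\<theta> - e..\<theta> + e} \<subseteq> interior \<Phi>"
proof -
  obtain d where d: "0 < d" "ball \<theta> d \<subseteq> interior \<Phi>"
    using assms by (meson open_contains_ball open_interior)
  have "{\<theta> - d/2..\<theta> + d/2} \<subseteq> ball \<theta> d" using d by (auto simp: dist_real_def)
  then show ?thesis using d interior_subset[of \<Phi>] that[of "d/2"] by (meson dual_order.trans half_gt_zero)
qed

text \<open>Of the distance d by which \<theta> can move inside the parameter space, one half
  absorbs the power of \<open>\<bar>x\<bar>\<close> into an exponential; the other half is kept as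
  the slack \<open>e\<close>, which \<open>mom_deriv\<close> needs for its difference
  quotients.\<close>

lemma integrable_dominant:
  assumes "\<theta> \<in> interior \<Phi>"
  obtains e where "0 < e" "{\<theta> - e..\<theta> + e} \<subseteq> \<Phi>"
    "\<And>k. integrable \<mu> (\<lambda>x. \<bar>x\<bar> ^ k * exp (\<theta> * x + e * \<bar>x\<bar>))"
proof -
  obtain d where d: "0 < d" "{\<theta> - d..\<theta> + d} \<subseteq> \<Phi>" using interior_nbhd[OF assms] by metis
  let ?e = "d / 2"
  have i: "integrable \<mu> (\<lambda>x. \<bar>x\<bar> ^ k * exp (\<theta> * x + ?e * \<bar>x\<bar>))" for k
  proof (rule Bochner_Integration.integrable_bound)
    show "integrable \<mu> (\<lambda>x. fact k / ?e ^ k * (exp ((\<theta> - d) * x) + exp ((\<theta> + d) * x)))"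
      by (intro integrable_mult_right Bochner_Integration.integrable_add integrable_exp) (use d in auto)
    show "AE x in \<mu>. norm (\<bar>x\<bar> ^ k * exp (\<theta> * x + ?e * \<bar>x\<bar>)) \<le> norm (fact k / ?e ^ k * (exp ((\<theta> - d) * x) + exp ((\<theta> + d) * x)))"
    proof (rule AE_I2)
      fix x
      have c: "0 \<le> fact k / ?e ^ k" using d by simp
      have e: "0 < ?e" using d by simp
      have "\<bar>x\<bar> ^ k * exp (\<theta> * x + ?e * \<bar>x\<bar>) \<le> (fact k / ?e ^ k * exp (?e * \<bar>x\<bar>)) * exp (\<theta> * x + ?e * \<bar>x\<bar>)"
        by (intro mult_right_mono abs_power_le_exp e) auto
      also have "\<dots> = fact k / ?e ^ k * exp (\<theta> * x + d * \<bar>x\<bar>)"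
        by (simp add: exp_add[symmetric] field_simps flip: exp_add)
      finally have fin: "\<bar>x\<bar> ^ k * exp (\<theta> * x + ?e * \<bar>x\<bar>) \<le> fact k / ?e ^ k * exp (\<theta> * x + d * \<bar>x\<bar>)" .
       have "exp (\<theta> * x + d * \<bar>x\<bar>) \<le> exp ((\<theta> - d) * x) + exp ((\<theta> + d) * x)"
        by (cases "0 \<le> x") (auto simp: algebra_simps)
      then have "fact k / ?e ^ k * exp (\<theta> * x + d * \<bar>x\<bar>) \<le> fact k / ?e ^ k * (exp ((\<theta> - d) * x) + exp ((\<theta> + d) * x))"
        using c by (rule mult_left_mono)
      with fin have *: "\<bar>x\<bar> ^ k * exp (\<theta> * x + ?e * \<bar>x\<bar>) \<le> fact k / ?e ^ k * (exp ((\<theta> - d) * x) + exp ((\<theta> + d) * x))" by (rule order_trans)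
      have "0 \<le> \<bar>x\<bar> ^ k * exp (\<theta> * x + ?e * \<bar>x\<bar>)" by simp
      then show "norm (\<bar>x\<bar> ^ k * exp (\<theta> * x + ?e * \<bar>x\<bar>)) \<le> norm (fact k / ?e ^ k * (exp ((\<theta> - d) * x) + exp ((\<theta> + d) * x)))"
        using * unfolding real_norm_def by linarith
    qed
  qed measurable
  show ?thesis by (rule that[of ?e]) (use d i in auto)
qed

lemma integrable_mom:
  assumes "\<theta> \<in> interior \<Phi>" shows "integrable \<mu> (\<lambda>x. x ^ k * exp (\<theta> * x))"
proof -
  obtain e where "0 < e" "integrable \<mu> (\<lambda>x. \<bar>x\<bar> ^ k * exp (\<theta> * x + e * \<bar>x\<bar>))"
    using integrable_dominant[OF assms] by metis
  then show ?thesis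
    by (elim Bochner_Integration.integrable_bound)
       (auto simp: abs_mult power_abs intro!: AE_I2 mult_left_mono)
qed

text \<open>The first-order Taylor remainder of the integrand is at most \<open>h\<^sup>2\<close>
  times a fixed integrable function, so the difference quotient misses the next moment by at most
  \<open>\<bar>h\<bar> * B\<close>.\<close>

lemma mom_deriv:
  assumes \<theta>: "\<theta> \<in> interior \<Phi>" shows "(mom k has_real_derivative mom (Suc k) \<theta>) (at \<theta>)"
proof -
  obtain e where e: "0 < e" "{\<theta> - e..\<theta> + e} \<subseteq> \<Phi>"
    and i: "\<And>k. integrable \<mu> (\<lambda>x. \<bar>x\<bar> ^ k * exp (\<theta> * x + e * \<bar>x\<bar>))"
    using integrable_dominant[OF assms] by metis
  define B where "B = (\<integral>x. \<bar>x\<bar> ^ (k + 2) * exp (\<theta> * x + e * \<bar>x\<bar>) \<partial>\<mu>)"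
  have dom: "integrable \<mu> (\<lambda>x. x ^ k * exp ((\<theta> + h) * x))" if "\<bar>h\<bar> \<le> e" for h
    using i[of k]
  proof (rule Bochner_Integration.integrable_bound)
    show "AE x in \<mu>. norm (x ^ k * exp ((\<theta> + h) * x)) \<le> norm (\<bar>x\<bar> ^ k * exp (\<theta> * x + e * \<bar>x\<bar>))"
    proof (rule AE_I2)
      fix x
      have "h * x \<le> e * \<bar>x\<bar>"
        using abs_ge_self[of "h * x"] mult_right_mono[OF that abs_ge_zero[of x]] by (simp add: abs_mult)
      then show "norm (x ^ k * exp ((\<theta> + h) * x)) \<le> norm (\<bar>x\<bar> ^ k * exp (\<theta> * x + e * \<bar>x\<bar>))"
        by (auto simp: abs_mult power_abs algebra_simps intro!: mult_left_mono)
    qed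
  qed measurable
  have bd: "\<bar>mom k (\<theta> + h) - mom k \<theta> - h * mom (Suc k) \<theta>\<bar> \<le> h\<^sup>2 * B" if h: "\<bar>h\<bar> \<le> e" for h
  proof -
    have eq: "mom k (\<theta> + h) - mom k \<theta> - h * mom (Suc k) \<theta> =
        (\<integral>x. x ^ k * exp ((\<theta> + h) * x) - x ^ k * exp (\<theta> * x) - h * (x ^ Suc k * exp (\<theta> * x)) \<partial>\<mu>)"
      unfolding mom_def
      using Bochner_Integration.integral_diff[OF Bochner_Integration.integrable_diff[OF dom[OF h] integrable_mom[OF \<theta>, of k]]
          integrable_mult_right[of h, OF integrable_mom[OF \<theta>, of "Suc k"]]]
        Bochner_Integration.integral_diff[OF dom[OF h] integrable_mom[OF \<theta>, of k]]
      by (simp only: integral_mult_right_zero)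
    have "\<bar>(\<integral>x. x ^ k * exp ((\<theta> + h) * x) - x ^ k * exp (\<theta> * x) - h * (x ^ Suc k * exp (\<theta> * x)) \<partial>\<mu>)\<bar> \<le> (\<integral>x. h\<^sup>2 * (\<bar>x\<bar> ^ (k + 2) * exp (\<theta> * x + e * \<bar>x\<bar>)) \<partial>\<mu>)"
    proof (rule integral_abs_bound[THEN order_trans], rule integral_mono')
      show "integrable \<mu> (\<lambda>x. h\<^sup>2 * (\<bar>x\<bar> ^ (k + 2) * exp (\<theta> * x + e * \<bar>x\<bar>)))"
        by (intro integrable_mult_right i)
      fix x
      have "x ^ k * exp ((\<theta> + h) * x) - x ^ k * exp (\<theta> * x) - h * (x ^ Suc k * exp (\<theta> * x)) =
          x ^ k * exp (\<theta> * x) * (exp (h * x) - 1 - h * x)" by (simp add: exp_add algebra_simps)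
      also have "\<bar>\<dots>\<bar> = \<bar>x\<bar> ^ k * exp (\<theta> * x) * \<bar>exp (h * x) - 1 - h * x\<bar>"
        by (simp add: abs_mult power_abs)
      also have "\<dots> \<le> \<bar>x\<bar> ^ k * exp (\<theta> * x) * ((h * x)\<^sup>2 * exp (e * \<bar>x\<bar>))"
      proof (intro mult_left_mono order_trans[OF exp_minus_linear_le])
        show "exp \<bar>h * x\<bar> \<le> exp (e * \<bar>x\<bar>)" using h by (simp add: abs_mult mult_right_mono)
      qed auto
      also have "\<dots> = h\<^sup>2 * (\<bar>x\<bar> ^ (k + 2) * exp (\<theta> * x + e * \<bar>x\<bar>))"
        by (simp add: exp_add power_mult_distrib power_add power2_eq_square)
      finally show "\<bar>x ^ k * exp ((\<theta> + h) * x) - x ^ k * exp (\<theta> * x) - h * (x ^ Suc k * exp (\<theta> * x))\<bar> \<le>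
         h\<^sup>2 * (\<bar>x\<bar> ^ (k + 2) * exp (\<theta> * x + e * \<bar>x\<bar>))" .
      show "0 \<le> h\<^sup>2 * (\<bar>x\<bar> ^ (k + 2) * exp (\<theta> * x + e * \<bar>x\<bar>))"
        by (intro mult_nonneg_nonneg zero_le_power zero_le_power2 abs_ge_zero exp_ge_zero)
    qed
    also have "\<dots> = h\<^sup>2 * B" unfolding B_def by (rule integral_mult_right_zero)
    finally show ?thesis unfolding eq .
  qed
  have "((\<lambda>h. (mom k (\<theta> + h) - mom k \<theta>) / h - mom (Suc k) \<theta>) \<longlongrightarrow> 0) (at 0)"
  proof (rule Lim_null_comparison)
    show "\<forall>\<^sub>F h in at 0. norm ((mom k (\<theta> + h) - mom k \<theta>) / h - mom (Suc k) \<theta>) \<le> \<bar>h\<bar> * B"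
      unfolding eventually_at
    proof (intro exI[of _ e] conjI e ballI impI)
      fix h :: real assume "h \<noteq> 0 \<and> dist h 0 < e"
      then have h: "h \<noteq> 0" "\<bar>h\<bar> \<le> e" by auto
      have "\<bar>(mom k (\<theta> + h) - mom k \<theta>) / h - mom (Suc k) \<theta>\<bar> = \<bar>mom k (\<theta> + h) - mom k \<theta> - h * mom (Suc k) \<theta>\<bar> / \<bar>h\<bar>"
        using h by (subst abs_divide[symmetric]) (simp add: diff_divide_distrib)
      also have "\<dots> \<le> h\<^sup>2 * B / \<bar>h\<bar>" by (intro divide_right_mono bd h) auto
      also have "\<dots> = \<bar>h\<bar> * B" using h abs_mult_self_eq[of h] by (simp add: power2_eq_square divide_eq_eq mult.commute mult.left_commute)
      finally show "norm ((mom k (\<theta> + h) - mom k \<theta>) / h - mom (Suc k) \<theta>) \<le> \<bar>h\<bar> * B" by simp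
    qed
    show "((\<lambda>h. \<bar>h\<bar> * B) \<longlongrightarrow> 0) (at 0)" by (auto intro!: tendsto_eq_intros)
  qed
  then show ?thesis unfolding DERIV_def LIM_zero_iff .
qed

lemma interiorD: "\<theta> \<in> interior \<Phi> \<Longrightarrow> \<theta> \<in> \<Phi>"
  using interior_subset by blast

lemma A_deriv:
  assumes \<theta>: "\<theta> \<in> interior \<Phi>" shows "(A has_real_derivative mom 1 \<theta> / Z \<theta>) (at \<theta>)"
  unfolding A_eq[abs_def]
  by (auto intro!: derivative_eq_intros mom_deriv \<theta> Z_pos interiorD)

lemma A'_eq: "\<theta> \<in> interior \<Phi> \<Longrightarrow> log_partition' \<mu> \<theta> = mom 1 \<theta> / Z \<theta>"
  unfolding log_partition'_def by (intro DERIV_imp_deriv A_deriv)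

lemma A_has_deriv: "\<theta> \<in> interior \<Phi> \<Longrightarrow> (A has_real_derivative log_partition' \<mu> \<theta>) (at \<theta>)"
  using A_deriv A'_eq by simp

lemma A'_deriv:
  assumes \<theta>: "\<theta> \<in> interior \<Phi>"
  shows "(log_partition' \<mu> has_real_derivative mom 2 \<theta> / Z \<theta> - (mom 1 \<theta> / Z \<theta>)\<^sup>2) (at \<theta>)"
proof (rule has_field_derivative_transform_within_open[of "\<lambda>\<theta>. mom 1 \<theta> / Z \<theta>"])
  show "((\<lambda>\<theta>. mom 1 \<theta> / Z \<theta>) has_real_derivative mom 2 \<theta> / Z \<theta> - (mom 1 \<theta> / Z \<theta>)\<^sup>2) (at \<theta>)"
    using Z_pos[OF interiorD[OF \<theta>]]
    by (auto intro!: derivative_eq_intros mom_deriv \<theta> simp: field_simps power2_eq_square numeral_2_eq_2)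
qed (use \<theta> A'_eq in auto)

lemma A''_eq: "\<theta> \<in> interior \<Phi> \<Longrightarrow> log_partition'' \<mu> \<theta> = mom 2 \<theta> / Z \<theta> - (mom 1 \<theta> / Z \<theta>)\<^sup>2"
  unfolding log_partition''_def by (intro DERIV_imp_deriv A'_deriv)

lemma A'_has_deriv: "\<theta> \<in> interior \<Phi> \<Longrightarrow> (log_partition' \<mu> has_real_derivative log_partition'' \<mu> \<theta>) (at \<theta>)"
  using A'_deriv A''_eq by simp

lemma continuous_A'': "continuous_on (interior \<Phi>) (log_partition'' \<mu>)"
proof -
  have c: "continuous_on (interior \<Phi>) (mom k)" for k
    using mom_deriv by (intro DERIV_continuous_on[where D="mom (Suc k)"]) (auto intro: has_field_derivative_at_within)
  have "continuous_on (interior \<Phi>) (\<lambda>\<theta>. mom 2 \<theta> / Z \<theta> - (mom 1 \<theta> / Z \<theta>)\<^sup>2)"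
    by (intro continuous_intros c; use Z_pos[OF interiorD] in \<open>simp add: less_imp_neq[symmetric]\<close>)
  then show ?thesis by (rule continuous_on_eq) (simp add: A''_eq)
qed

section \<open>The members of the family\<close>

abbreviation "P \<equiv> expfam \<mu>"

lemma sets_P [simp, measurable_cong]: "sets (P \<theta>) = sets borel"
  by (simp add: expfam_def)

lemma space_P [simp]: "space (P \<theta>) = UNIV"
  by (simp add: expfam_def)

lemma exp_A: "\<theta> \<in> \<Phi> \<Longrightarrow> exp (u - A \<theta>) = exp u / Z \<theta>"
  by (simp add: A_eq exp_diff Z_pos)

lemma prob_space_P: assumes "\<theta> \<in> \<Phi>" shows "prob_space (P \<theta>)"
proof
  have "emeasure (P \<theta>) (space (P \<theta>)) = (\<integral>\<^sup>+x. ennreal (exp (\<theta> * x - A \<theta>)) \<partial>\<mu>)"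
    by (simp add: expfam_def emeasure_density)
  also have "\<dots> = ennreal (\<integral>x. exp (\<theta> * x - A \<theta>) \<partial>\<mu>)"
    by (intro nn_integral_eq_integral) (use assms Z_pos[OF assms] in \<open>auto simp: exp_A intro!: integrable_exp\<close>)
  also have "\<dots> = 1" using assms Z_pos[OF assms] by (simp add: exp_A mom_def)
  finally show "emeasure (P \<theta>) (space (P \<theta>)) = 1" .
qed

lemma integral_P:
  fixes f :: "real \<Rightarrow> real"
  assumes "\<theta> \<in> \<Phi>" "f \<in> borel_measurable borel"
  shows "(\<integral>x. f x \<partial>P \<theta>) = (\<integral>x. f x * exp (\<theta> * x) \<partial>\<mu>) / Z \<theta>"
  using assms Z_pos[OF assms(1)] unfolding expfam_def
  by (subst integral_density) (simp_all add: exp_A mult.commute)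

lemma integrable_P:
  fixes f :: "real \<Rightarrow> real"
  assumes "\<theta> \<in> \<Phi>" "f \<in> borel_measurable borel"
  shows "integrable (P \<theta>) f \<longleftrightarrow> integrable \<mu> (\<lambda>x. f x * exp (\<theta> * x))"
proof -
  have "(\<lambda>x. exp (\<theta> * x - A \<theta>) *\<^sub>R f x) = (\<lambda>x. inverse (Z \<theta>) * (f x * exp (\<theta> * x)))"
    using assms by (auto simp: exp_A field_simps)
  then show ?thesis
    using assms Z_pos[OF assms(1)] unfolding expfam_def by (subst integrable_density) simp_all
qed

lemma AE_P: "(AE x in P \<theta>. Q x) \<longleftrightarrow> (AE x in \<mu>. Q x)"
  unfolding expfam_def by (subst AE_density) auto

text \<open>The likelihood ratio of two members is again exponential in x. Monotonicity of
  expectations, the chi-square computation and the analysis of clipping all work with it.\<close>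

lemma P_change:
  assumes "\<theta> \<in> \<Phi>"
  shows "P \<theta>' = density (P \<theta>) (\<lambda>x. ennreal (exp ((\<theta>' - \<theta>) * x - (A \<theta>' - A \<theta>))))"
  unfolding expfam_def
  by (subst density_density_eq) (auto simp: algebra_simps simp flip: ennreal_mult' exp_add intro!: density_cong)

lemma integrable_power: "\<theta> \<in> interior \<Phi> \<Longrightarrow> integrable (P \<theta>) (\<lambda>x. x ^ k)"
  by (subst integrable_P) (auto intro: interiorD integrable_mom)

lemma integrable_power_minus: assumes "\<theta> \<in> interior \<Phi>" shows "integrable (P \<theta>) (\<lambda>x. (x - t) ^ k)"
  unfolding diff_conv_add_uminus binomial_ring
  by (intro Bochner_Integration.integrable_sum integrable_mult_left integrable_mult_right integrable_power assms)

lemma mean_P: "\<theta> \<in> interior \<Phi> \<Longrightarrow> (\<integral>x. x \<partial>P \<theta>) = log_partition' \<mu> \<theta>"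
  by (subst integral_P) (auto simp: A'_eq mom_def interiorD)

lemma variance_P:
  assumes \<theta>: "\<theta> \<in> interior \<Phi>" shows "(\<integral>x. (x - log_partition' \<mu> \<theta>)\<^sup>2 \<partial>P \<theta>) = log_partition'' \<mu> \<theta>"
proof -
  interpret prob_space "P \<theta>" using \<theta> by (intro prob_space_P interiorD)
  have "(\<integral>x. x\<^sup>2 \<partial>P \<theta>) = mom 2 \<theta> / Z \<theta>"
    by (subst integral_P) (auto simp: \<theta> mom_def interiorD)
  then show ?thesis
    using variance_eq[of "\<lambda>x. x"] integrable_power[OF \<theta>, of 1] integrable_power[OF \<theta>, of 2]
    by (simp add: mean_P \<theta> A''_eq A'_eq)
qed

text \<open>A vanishing variance would concentrate \<mu> at the mean, which
  \<open>base_measure\<close> excludes.\<close>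

lemma A''_pos:
  assumes \<theta>: "\<theta> \<in> interior \<Phi>" shows "0 < log_partition'' \<mu> \<theta>"
proof -
  let ?t = "log_partition' \<mu> \<theta>"
  have "(\<integral>x. (x - ?t)\<^sup>2 \<partial>P \<theta>) \<noteq> 0"
  proof
    assume "(\<integral>x. (x - ?t)\<^sup>2 \<partial>P \<theta>) = 0"
    then have "AE x in P \<theta>. (x - ?t)\<^sup>2 = 0"
      by (subst (asm) integral_nonneg_eq_0_iff_AE) (auto intro: integrable_power_minus \<theta>)
    then have "AE x in \<mu>. x = ?t" by (simp add: AE_P)
    then show False using not_AE_const by blast
  qed
  moreover have "0 \<le> (\<integral>x. (x - ?t)\<^sup>2 \<partial>P \<theta>)" by (intro integral_nonneg_AE) auto
  ultimately show ?thesis using variance_P[OF \<theta>] by simp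
qed

lemma interior_interval: "a \<in> interior \<Phi> \<Longrightarrow> b \<in> interior \<Phi> \<Longrightarrow> {a..b} \<subseteq> interior \<Phi>"
proof -
  assume ab: "a \<in> interior \<Phi>" "b \<in> interior \<Phi>"
  have "convex (interior \<Phi>)" using is_interval_Phi by (intro convex_interior is_interval_convex)
  then have "is_interval (interior \<Phi>)" by (simp add: is_interval_convex_1)
  then show ?thesis using ab unfolding is_interval_1 by (meson atLeastAtMost_iff subsetI)
qed

lemma A'_strict_mono:
  assumes "a \<in> interior \<Phi>" "b \<in> interior \<Phi>" "a < b" shows "log_partition' \<mu> a < log_partition' \<mu> b"
proof (rule DERIV_pos_imp_increasing[OF \<open>a < b\<close>])
  fix x assume "a \<le> x" "x \<le> b"
  then have "x \<in> interior \<Phi>" using interior_interval[OF assms(1,2)] by auto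
  then show "\<exists>y. (log_partition' \<mu> has_real_derivative y) (at x) \<and> 0 < y"
    using A'_has_deriv A''_pos by blast
qed

lemma A'_inj: "inj_on (log_partition' \<mu>) (interior \<Phi>)"
  by (rule inj_onI) (metis A'_strict_mono linorder_neqE_linordered_idom less_irrefl)

lemma A'_less_iff:
  assumes "a \<in> interior \<Phi>" "b \<in> interior \<Phi>" shows "log_partition' \<mu> a < log_partition' \<mu> b \<longleftrightarrow> a < b"
  using A'_strict_mono assms by (metis linorder_neqE_linordered_idom order_less_asym order_less_irrefl)

lemma integrable_bounded_P:
  fixes \<phi> :: "real \<Rightarrow> real"
  assumes "\<theta> \<in> \<Phi>" "\<phi> \<in> borel_measurable borel" "\<And>x. \<bar>\<phi> x\<bar> \<le> B"
  shows "integrable (P \<theta>) \<phi>"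
proof -
  interpret prob_space "P \<theta>" using assms by (intro prob_space_P)
  show ?thesis by (rule integrable_const_bound[of _ B]) (use assms in auto)
qed

text \<open>The likelihood ratio \<open>W\<close> is increasing, so \<open>(\<phi> x - \<phi> x\<^sub>0) * (W x - 1)\<close> is nonnegative
  when \<open>W x\<^sub>0 = 1\<close>; its expectation is the difference of the two expectations of \<open>\<phi>\<close>.\<close>

lemma expectation_mono:
  fixes \<phi> :: "real \<Rightarrow> real"
  assumes ab: "a \<in> \<Phi>" "b \<in> \<Phi>" "a < b" and \<phi>: "mono \<phi>" "\<And>x. \<bar>\<phi> x\<bar> \<le> B"
  shows "(\<integral>x. \<phi> x \<partial>P a) \<le> (\<integral>x. \<phi> x \<partial>P b)"
    and "(\<integral>x. \<phi> x \<partial>P a) = (\<integral>x. \<phi> x \<partial>P b) \<Longrightarrow> \<exists>c. AE x in \<mu>. \<phi> x = c"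
proof -
  have m\<phi>[measurable]: "\<phi> \<in> borel_measurable borel" using \<phi>(1) by (rule borel_measurable_mono)
  interpret prob_space "P a" using ab by (intro prob_space_P)
  define W where "W x = exp ((b - a) * x - (A b - A a))" for x
  define x0 where "x0 = (A b - A a) / (b - a)"
  have [measurable]: "W \<in> borel_measurable borel" unfolding W_def by measurable
  have W_nonneg: "0 \<le> W x" for x by (simp add: W_def)
  have pb: "P b = density (P a) W" unfolding W_def using ab by (intro P_change)
  interpret b: prob_space "P b" using ab by (intro prob_space_P)
  have iW: "integrable (P a) W" and W1: "(\<integral>x. W x \<partial>P a) = 1"
  proof -
    have "integrable (P b) (\<lambda>_. 1::real)" by simp
    then show "integrable (P a) W"
      unfolding pb by (subst (asm) integrable_density) (simp_all add: W_nonneg)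
    have "(\<integral>x. 1 \<partial>P b) = (1::real)" using b.prob_space by simp
    then show "(\<integral>x. W x \<partial>P a) = 1"
      unfolding pb by (subst (asm) integral_density) (simp_all add: W_nonneg)
  qed
  have i\<phi>: "integrable (P a) \<phi>" "integrable (P b) \<phi>"
    using integrable_bounded_P[OF ab(1) m\<phi> \<phi>(2)] integrable_bounded_P[OF ab(2) m\<phi> \<phi>(2)] by blast+
  have i\<phi>W: "integrable (P a) (\<lambda>x. W x * \<phi> x)"
    using i\<phi>(2) unfolding pb by (subst (asm) integrable_density) (auto simp: W_def)
  have E: "(\<integral>x. \<phi> x \<partial>P b) = (\<integral>x. W x * \<phi> x \<partial>P a)"
    unfolding pb by (subst integral_density) (auto simp: W_def)
  let ?F = "\<lambda>x. (\<phi> x - \<phi> x0) * (W x - 1)"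
  have Feq: "?F = (\<lambda>x. W x * \<phi> x - \<phi> x - (\<phi> x0 * W x - \<phi> x0))" by (auto simp: algebra_simps)
  have iF: "integrable (P a) ?F" unfolding Feq
    by (intro Bochner_Integration.integrable_diff i\<phi>W i\<phi> integrable_mult_right iW integrable_const)
  have diff: "(\<integral>x. ?F x \<partial>P a) = (\<integral>x. \<phi> x \<partial>P b) - (\<integral>x. \<phi> x \<partial>P a)"
    unfolding Feq E using i\<phi>W i\<phi> iW W1 prob_space by simp
  have x0: "(b - a) * x0 = A b - A a" using ab by (simp add: x0_def)
  have "W x0 = 1" unfolding W_def x0 by simp
  moreover have W_less: "W x < W y" if "x < y" for x y
    using that ab by (simp add: W_def)
  ultimately have W0: "W x < 1 \<longleftrightarrow> x < x0" "W x > 1 \<longleftrightarrow> x > x0" "W x = 1 \<longleftrightarrow> x = x0" for x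
    by (metis linorder_less_linear order_less_asym order_less_irrefl)+
  have nn: "0 \<le> ?F x" for x
  proof (cases "x < x0")
    case True
    then show ?thesis using W0(1)[of x] monoD[OF \<phi>(1), of x x0] by (intro mult_nonpos_nonpos) auto
  next
    case False
    then show ?thesis using W0(1)[of x] monoD[OF \<phi>(1), of x0 x] by (intro mult_nonneg_nonneg) auto
  qed
  show "(\<integral>x. \<phi> x \<partial>P a) \<le> (\<integral>x. \<phi> x \<partial>P b)"
  proof -
    have "0 \<le> (\<integral>x. ?F x \<partial>P a)" by (intro integral_nonneg_AE AE_I2 nn)
    then show ?thesis using diff by linarith
  qed
  assume "(\<integral>x. \<phi> x \<partial>P a) = (\<integral>x. \<phi> x \<partial>P b)"
  then have "(\<integral>x. ?F x \<partial>P a) = 0" using diff by linarith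
  then have "AE x in P a. ?F x = 0" using integral_nonneg_eq_0_iff_AE[OF iF AE_I2[OF nn]] by blast
  \<comment> \<open>Off \<open>x0\<close> the factor \<open>W x - 1\<close> is nonzero; at
    \<open>x0\<close> the equation is trivial.\<close>
  then have "AE x in P a. \<phi> x = \<phi> x0"
    by eventually_elim (metis W0(3) eq_iff_diff_eq_0 mult_eq_0_iff)
  then show "\<exists>c. AE x in \<mu>. \<phi> x = c" by (auto simp: AE_P)
qed

lemma expectation_const:
  fixes \<phi> :: "real \<Rightarrow> real"
  assumes "a \<in> \<Phi>" "AE x in \<mu>. \<phi> x = c" "\<phi> \<in> borel_measurable borel" shows "(\<integral>x. \<phi> x \<partial>P a) = (c::real)"
proof -
  interpret prob_space "P a" using assms by (intro prob_space_P)
  have "(\<integral>x. \<phi> x \<partial>P a) = (\<integral>x. c \<partial>P a)"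
    by (intro integral_cong_AE) (use assms in \<open>auto simp: AE_P\<close>)
  then show ?thesis using prob_space by simp
qed

text \<open>Dominated convergence, with the bound taken from the end points \<open>a\<close> and
  \<open>b\<close>. Thus continuity reaches those boundary points of the parameter space that belong
  to it, as the minimization runs over the whole space and not only its interior.\<close>

lemma expectation_continuous:
  fixes \<phi> :: "real \<Rightarrow> real"
  assumes ab: "a \<in> \<Phi>" "b \<in> \<Phi>" and [measurable]: "\<phi> \<in> borel_measurable borel" and B: "\<And>x. \<bar>\<phi> x\<bar> \<le> B"
  shows "continuous_on {a..b} (\<lambda>\<theta>. \<integral>x. \<phi> x \<partial>P \<theta>)"
proof -
  have c: "continuous_on {a..b} (\<lambda>\<theta>. \<integral>x. \<psi> x * exp (\<theta> * x) \<partial>\<mu>)"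
    if [measurable]: "\<psi> \<in> borel_measurable borel" and B: "\<And>x. \<bar>\<psi> x\<bar> \<le> B" for \<psi> B
    unfolding continuous_on_sequentially
  proof (intro allI ballI impI, unfold comp_def)
    fix u \<theta> assume \<theta>: "\<theta> \<in> {a..b}" and u: "(\<forall>n. u n \<in> {a..b}) \<and> u \<longlonglongrightarrow> \<theta>"
    show "(\<lambda>n. \<integral>x. \<psi> x * exp (u n * x) \<partial>\<mu>) \<longlonglongrightarrow> (\<integral>x. \<psi> x * exp (\<theta> * x) \<partial>\<mu>)"
    proof (rule integral_dominated_convergence)
      show "integrable \<mu> (\<lambda>x. \<bar>B\<bar> * (exp (a * x) + exp (b * x)))"
        by (intro integrable_mult_right Bochner_Integration.integrable_add integrable_exp ab)
      show "AE x in \<mu>. (\<lambda>n. \<psi> x * exp (u n * x)) \<longlonglongrightarrow> \<psi> x * exp (\<theta> * x)"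
        using u by (auto intro!: AE_I2 tendsto_intros)
      fix n
      show "AE x in \<mu>. norm (\<psi> x * exp (u n * x)) \<le> \<bar>B\<bar> * (exp (a * x) + exp (b * x))"
      proof (rule AE_I2)
        fix x
        have "\<bar>\<psi> x\<bar> \<le> \<bar>B\<bar>" using B[of x] by linarith
        then show "norm (\<psi> x * exp (u n * x)) \<le> \<bar>B\<bar> * (exp (a * x) + exp (b * x))"
          using u by (auto simp: abs_mult intro!: mult_mono exp_interval_le)
      qed
    qed auto
  qed
  have "continuous_on {a..b} (\<lambda>\<theta>. (\<integral>x. \<phi> x * exp (\<theta> * x) \<partial>\<mu>) / (\<integral>x. 1 * exp (\<theta> * x) \<partial>\<mu>))"
    by (intro continuous_intros c[of _ B] c[of _ 1] B)
       (use Z_pos Phi_interval[OF ab] in \<open>force simp: mom_def\<close>)+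
  then show ?thesis
    by (rule continuous_on_eq) (use Phi_interval[OF ab] in \<open>auto simp: integral_P mom_def\<close>)
qed

text \<open>The square of the ratio is a tilt by \<open>2 * h\<close>, so its mean is the quotient
  \<open>Z \<theta> * Z (\<theta> + 2 * h) / (Z (\<theta> + h))\<^sup>2\<close> of partition
  functions. The exponent is a second difference of \<open>A\<close>, hence controlled by the second
  derivative.\<close>

lemma chi_square:
  assumes "\<theta> \<in> \<Phi>" "\<theta> + h \<in> \<Phi>" "\<theta> + 2 * h \<in> \<Phi>"
  defines "W \<equiv> \<lambda>x. exp (h * x - (A (\<theta> + h) - A \<theta>))"
  shows "integrable (P \<theta>) W" "(\<integral>x. W x \<partial>P \<theta>) = 1" "integrable (P \<theta>) (\<lambda>x. (W x)\<^sup>2)"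
    "(\<integral>x. (W x)\<^sup>2 \<partial>P \<theta>) = exp (A (\<theta> + 2 * h) - 2 * A (\<theta> + h) + A \<theta>)"
proof -
  have [measurable]: "W \<in> borel_measurable borel" unfolding W_def by measurable
  have We: "W x = Z \<theta> / Z (\<theta> + h) * exp (h * x)" for x
    using Z_pos[OF assms(1)] Z_pos[OF assms(2)] unfolding W_def A_eq
    by (simp add: exp_diff)
  have W: "W x * exp (\<theta> * x) = Z \<theta> / Z (\<theta> + h) * exp ((\<theta> + h) * x)" for x
    unfolding We by (simp add: exp_add algebra_simps)
  have W2: "(W x)\<^sup>2 * exp (\<theta> * x) = (Z \<theta> / Z (\<theta> + h))\<^sup>2 * exp ((\<theta> + 2 * h) * x)" for x
  proof -
    have "exp ((\<theta> + 2 * h) * x) = (exp (h * x))\<^sup>2 * exp (\<theta> * x)"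
      by (simp add: power2_eq_square flip: exp_add) (simp add: algebra_simps)
    then show ?thesis unfolding We by (simp add: power_mult_distrib power_divide)
  qed
  show "integrable (P \<theta>) W" "integrable (P \<theta>) (\<lambda>x. (W x)\<^sup>2)"
    using assms(1-3) by (simp_all add: integrable_P W W2 integrable_exp)
  show "(\<integral>x. W x \<partial>P \<theta>) = 1" using Z_pos[OF assms(1)] Z_pos[OF assms(2)] assms(1) by (simp add: integral_P W mom_def)
  have "(\<integral>x. (W x)\<^sup>2 \<partial>P \<theta>) = (Z \<theta> / Z (\<theta> + h))\<^sup>2 * Z (\<theta> + 2 * h) / Z \<theta>"
    using assms(1) by (simp add: integral_P W2 mom_def)
  also have "\<dots> = exp (A (\<theta> + 2 * h) - 2 * A (\<theta> + h) + A \<theta>)"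
    using Z_pos[OF assms(1)] Z_pos[OF assms(2)] Z_pos[OF assms(3)]
    by (simp add: A_eq exp_diff exp_add exp_double field_simps power2_eq_square)
  finally show "(\<integral>x. (W x)\<^sup>2 \<partial>P \<theta>) = exp (A (\<theta> + 2 * h) - 2 * A (\<theta> + h) + A \<theta>)" .
qed

text \<open>Two applications of the mean value theorem, first to \<open>s \<mapsto> A (s + h) - A s\<close>.\<close>

lemma second_difference_le:
  assumes I: "\<And>s. s \<in> {min \<theta> (\<theta> + 2 * h)..max \<theta> (\<theta> + 2 * h)} \<Longrightarrow> s \<in> interior \<Phi> \<and> log_partition'' \<mu> s \<le> V"
  shows "A (\<theta> + 2 * h) - 2 * A (\<theta> + h) + A \<theta> \<le> V * h\<^sup>2"
proof (cases "h = 0")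
  case False
  have *: "A (s + 2 * k) - 2 * A (s + k) + A s \<le> V * k\<^sup>2"
    if k: "0 < k" and I: "\<And>x. x \<in> {s..s + 2 * k} \<Longrightarrow> x \<in> interior \<Phi> \<and> log_partition'' \<mu> x \<le> V" for s k
  proof -
    have "\<exists>z. s < z \<and> z < s + k \<and> (A (s + k + k) - A (s + k)) - (A (s + k) - A s) = (s + k - s) * (log_partition' \<mu> (z + k) - log_partition' \<mu> z)"
      by (rule MVT2[of s "s + k" "\<lambda>x. A (x + k) - A x"])
         (use k I in \<open>auto intro!: derivative_eq_intros DERIV_shift[THEN iffD1, OF A_has_deriv] A_has_deriv\<close>)
    then obtain z where z: "s < z" "z < s + k"
      "(A (s + k + k) - A (s + k)) - (A (s + k) - A s) = k * (log_partition' \<mu> (z + k) - log_partition' \<mu> z)" by auto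
    have "\<exists>w. z < w \<and> w < z + k \<and> log_partition' \<mu> (z + k) - log_partition' \<mu> z = (z + k - z) * log_partition'' \<mu> w"
      by (rule MVT2) (use k I z in \<open>auto intro!: A'_has_deriv\<close>)
    then obtain w where w: "z < w" "w < z + k" "log_partition' \<mu> (z + k) - log_partition' \<mu> z = k * log_partition'' \<mu> w" by auto
    have "log_partition'' \<mu> w \<le> V" using I[of w] z w by auto
    then have "k * (k * log_partition'' \<mu> w) \<le> k * (k * V)" using k by (intro mult_left_mono) auto
    then show ?thesis using z(3) w(3) by (simp add: algebra_simps power2_eq_square)
  qed
  show ?thesis
  proof (cases "0 < h")
    case True then show ?thesis using *[of h \<theta>] I by auto
  next
    case f: False
    then have "0 < - h" using False by simp
    \<comment> \<open>The second difference is symmetric in its end points, so a negative step is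
      read from the other end.\<close>
    from *[OF this, of "\<theta> + 2 * h"] show ?thesis using I f by (auto simp: algebra_simps)
  qed
qed simp

end

section \<open>Measurability of the minimizer\<close>

text \<open>Turns "for all \<theta> in \<Phi>" into a countable condition when the function is
  monotone in \<theta>. The rationals in \<Phi> miss at most the extreme points, which are added if
  they are attained.\<close>

lemma interval_cofinal:
  fixes \<Phi> :: "real set"
  assumes I: "is_interval \<Phi>"
  obtains D where "countable D" "D \<subseteq> \<Phi>" "\<And>\<theta>. \<theta> \<in> \<Phi> \<Longrightarrow> \<exists>a\<in>D. \<exists>b\<in>D. a \<le> \<theta> \<and> \<theta> \<le> b"
proof
  let ?mx = "{x\<in>\<Phi>. \<forall>\<theta>\<in>\<Phi>. \<theta> \<le> x}" and ?mn = "{x\<in>\<Phi>. \<forall>\<theta>\<in>\<Phi>. x \<le> \<theta>}"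
  let ?D = "(\<Phi> \<inter> \<rat>) \<union> ?mx \<union> ?mn"
  have fin: "finite S" if "\<And>x y. x \<in> S \<Longrightarrow> y \<in> S \<Longrightarrow> x = y" for S :: "real set"
  proof (cases "S = {}")
    case False
    then obtain x where "x \<in> S" by blast
    then have "S \<subseteq> {x}" using that by blast
    then show ?thesis by (rule finite_subset) simp
  qed simp
  have "finite ?mx" "finite ?mn" by (rule fin; force)+
  then show "countable ?D" using countable_rat by (auto intro: uncountable_infinite countable_finite countable_Int2)
  show "?D \<subseteq> \<Phi>" by auto
  fix \<theta> assume \<theta>: "\<theta> \<in> \<Phi>"
  have conv: "x \<in> \<Phi>" if "a \<in> \<Phi>" "b \<in> \<Phi>" "a \<le> x" "x \<le> b" for a b x
    using I that unfolding is_interval_1 by blast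
  have "\<exists>b\<in>?D. \<theta> \<le> b"
  proof (cases "\<theta> \<in> ?mx")
    case False
    then obtain \<theta>' where "\<theta>' \<in> \<Phi>" "\<theta> < \<theta>'" using \<theta> by force
    moreover obtain r where "r \<in> \<rat>" "\<theta> < r" "r < \<theta>'" using Rats_dense_in_real[OF \<open>\<theta> < \<theta>'\<close>] by blast
    ultimately have "r \<in> \<Phi>" using conv[OF \<theta>, of \<theta>' r] by simp
    then show ?thesis using \<open>r \<in> \<rat>\<close> \<open>\<theta> < r\<close> by (intro bexI[of _ r]) auto
  qed auto
  moreover have "\<exists>b\<in>?D. b \<le> \<theta>"
  proof (cases "\<theta> \<in> ?mn")
    case False
    then obtain \<theta>' where "\<theta>' \<in> \<Phi>" "\<theta>' < \<theta>" using \<theta> by force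
    moreover obtain r where "r \<in> \<rat>" "\<theta>' < r" "r < \<theta>" using Rats_dense_in_real[OF \<open>\<theta>' < \<theta>\<close>] by blast
    ultimately have "r \<in> \<Phi>" using conv[of \<theta>' \<theta> r] \<theta> by simp
    then show ?thesis using \<open>r \<in> \<rat>\<close> \<open>r < \<theta>\<close> by (intro bexI[of _ r]) auto
  qed auto
  ultimately show "\<exists>a\<in>?D. \<exists>b\<in>?D. a \<le> \<theta> \<and> \<theta> \<le> b" by blast
qed

text \<open>As \<open>arg_min\<close> is a choice from the set of minimizers, problems with the same
  set get the same value, even where the minimizer is not unique or does not exist.\<close>

lemma arg_min_eqI:
  assumes "\<And>x. is_arg_min f P x \<longleftrightarrow> Q x" shows "arg_min f P = (SOME x. Q x)"
  unfolding arg_min_def using assms by presburger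

lemma is_arg_min_linear: "is_arg_min (f :: _ \<Rightarrow> real) P x \<longleftrightarrow> P x \<and> (\<forall>y. P y \<longrightarrow> f x \<le> f y)"
  by (auto simp: is_arg_min_def not_less)

text \<open>The event \<open>arg_min \<le> c\<close> is described case by case: for constant \<open>G t\<close> and for \<open>y\<close> above or below the
  range of \<open>G t\<close> the (possibly unspecified) value does not depend on \<open>(t, y)\<close>; otherwise the minimizer
  is the unique solution of \<open>G t \<theta> = y\<close>.\<close>

lemma arg_min_measurable:
  fixes G :: "'a \<Rightarrow> real \<Rightarrow> real"
  assumes I: "is_interval \<Phi>"
    and mG: "\<And>\<theta>. \<theta> \<in> \<Phi> \<Longrightarrow> (\<lambda>t. G t \<theta>) \<in> borel_measurable M"
    and dich: "\<And>t. t \<in> space M \<Longrightarrow> (\<forall>a\<in>\<Phi>. \<forall>b\<in>\<Phi>. G t a = G t b) \<or> (\<forall>a\<in>\<Phi>. \<forall>b\<in>\<Phi>. a < b \<longrightarrow> G t a < G t b)"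
    and cont: "\<And>t a b. t \<in> space M \<Longrightarrow> a \<in> \<Phi> \<Longrightarrow> b \<in> \<Phi> \<Longrightarrow> continuous_on {a..b} (G t)"
  shows "(\<lambda>(t, y). arg_min (\<lambda>\<theta>. \<bar>y - G t \<theta>\<bar>) (\<lambda>\<theta>. \<theta> \<in> \<Phi>)) \<in> borel_measurable (M \<Otimes>\<^sub>M borel)"
proof -
  define \<Theta> where "\<Theta> t y = arg_min (\<lambda>\<theta>. \<bar>y - G t \<theta>\<bar>) (\<lambda>\<theta>. \<theta> \<in> \<Phi>)" for t y
  define k0 where "k0 = (SOME x. x \<in> \<Phi>)"
  have const: "\<Theta> t y = k0" if "\<And>a b. a \<in> \<Phi> \<Longrightarrow> b \<in> \<Phi> \<Longrightarrow> G t a = G t b" for t y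
    unfolding \<Theta>_def k0_def
  proof (rule arg_min_eqI)
    show "is_arg_min (\<lambda>\<theta>. \<bar>y - G t \<theta>\<bar>) (\<lambda>\<theta>. \<theta> \<in> \<Phi>) x \<longleftrightarrow> x \<in> \<Phi>" for x
      unfolding is_arg_min_linear using that by (metis order_refl)
  qed
  have "(\<lambda>(t, y). \<Theta> t y) \<in> borel_measurable (M \<Otimes>\<^sub>M borel)"
  proof (cases "\<exists>p\<in>\<Phi>. \<exists>q\<in>\<Phi>. p < q")
    case False
    then have "\<Theta> t y = k0" for t y by (intro const) (metis linorder_less_linear)
    then show ?thesis by simp
  next
    case True
    then obtain p q where pq: "p \<in> \<Phi>" "q \<in> \<Phi>" "p < q" by blast
    have conv: "x \<in> \<Phi>" if "a \<in> \<Phi>" "b \<in> \<Phi>" "a \<le> x" "x \<le> b" for a b x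
      using I that unfolding is_interval_1 by blast
    obtain D where D: "countable D" "D \<subseteq> \<Phi>" "\<And>\<theta>. \<theta> \<in> \<Phi> \<Longrightarrow> \<exists>a\<in>D. \<exists>b\<in>D. a \<le> \<theta> \<and> \<theta> \<le> b"
      using interval_cofinal[OF I] by metis
    define kU where "kU = (SOME x. x \<in> \<Phi> \<and> (\<forall>\<theta>\<in>\<Phi>. \<theta> \<le> x))"
    define kL where "kL = (SOME x. x \<in> \<Phi> \<and> (\<forall>\<theta>\<in>\<Phi>. x \<le> \<theta>))"
    \<comment> \<open>For \<open>c\<close> outside the interval \<Phi>, a point of \<Phi> is at most
      \<open>c\<close> exactly if all of \<Phi> lies below \<open>c\<close>.\<close>
    define R where "R c t y \<longleftrightarrow> (if c \<in> \<Phi> then y \<le> G t c else \<forall>\<theta>\<in>\<Phi>. \<theta> < c)" for c t y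
    have char: "\<Theta> t y \<le> c \<longleftrightarrow> (if G t p = G t q then k0 \<le> c else if \<forall>\<theta>\<in>D. G t \<theta> < y then kU \<le> c
       else if \<forall>\<theta>\<in>D. y < G t \<theta> then kL \<le> c else R c t y)" if t: "t \<in> space M" for t y c
    proof (cases "G t p = G t q")
      case True
      then have "\<forall>a\<in>\<Phi>. \<forall>b\<in>\<Phi>. G t a = G t b" using dich[OF t] pq by (metis order_less_irrefl)
      then have "\<Theta> t y = k0" by (intro const) blast
      then show ?thesis using True by simp
    next
      case ne: False
      then have strict: "G t a < G t b" if "a \<in> \<Phi>" "b \<in> \<Phi>" "a < b" for a b
        using dich[OF t] ne pq(1,2) that by blast
      have le_iff: "G t a \<le> G t b \<longleftrightarrow> a \<le> b" if "a \<in> \<Phi>" "b \<in> \<Phi>" for a b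
        using strict[of a b] strict[of b a] that by (cases a b rule: linorder_cases) auto
      show ?thesis
      proof (cases "\<forall>\<theta>\<in>D. G t \<theta> < y")
        case True
        have lt: "G t \<theta> < y" if "\<theta> \<in> \<Phi>" for \<theta>
        proof -
          obtain b where "b \<in> D" "\<theta> \<le> b" using D(3)[OF \<open>\<theta> \<in> \<Phi>\<close>] by blast
          then have "b \<in> \<Phi>" "G t b < y" using True D(2) by auto
          then show ?thesis using le_iff[of \<theta> b] that \<open>\<theta> \<le> b\<close> by simp
        qed
        have "\<Theta> t y = kU" unfolding \<Theta>_def kU_def
        proof (rule arg_min_eqI)
          fix x
          have "\<bar>y - G t x\<bar> \<le> \<bar>y - G t \<theta>\<bar> \<longleftrightarrow> \<theta> \<le> x" if "x \<in> \<Phi>" "\<theta> \<in> \<Phi>" for \<theta>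
            using lt[OF that(1)] lt[OF that(2)] le_iff[OF that(2,1)] by (simp add: abs_if)
          then show "is_arg_min (\<lambda>\<theta>. \<bar>y - G t \<theta>\<bar>) (\<lambda>\<theta>. \<theta> \<in> \<Phi>) x \<longleftrightarrow> x \<in> \<Phi> \<and> (\<forall>\<theta>\<in>\<Phi>. \<theta> \<le> x)"
            unfolding is_arg_min_linear by auto
        qed
        then show ?thesis using True ne by simp
      next
        case nU: False
        then obtain \<theta>1 where \<theta>1: "\<theta>1 \<in> \<Phi>" "y \<le> G t \<theta>1" using D(2) by (meson linorder_not_less subsetD)
        show ?thesis
        proof (cases "\<forall>\<theta>\<in>D. y < G t \<theta>")
          case True
          have lt: "y < G t \<theta>" if "\<theta> \<in> \<Phi>" for \<theta>
          proof -
            obtain b where "b \<in> D" "b \<le> \<theta>" using D(3)[OF \<open>\<theta> \<in> \<Phi>\<close>] by blast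
            then have "b \<in> \<Phi>" "y < G t b" using True D(2) by auto
            then show ?thesis using le_iff[of b \<theta>] that \<open>b \<le> \<theta>\<close> by simp
          qed
          have "\<Theta> t y = kL" unfolding \<Theta>_def kL_def
          proof (rule arg_min_eqI)
            fix x
            have "\<bar>y - G t x\<bar> \<le> \<bar>y - G t \<theta>\<bar> \<longleftrightarrow> x \<le> \<theta>" if "x \<in> \<Phi>" "\<theta> \<in> \<Phi>" for \<theta>
              using lt[OF that(1)] lt[OF that(2)] le_iff[OF that(1,2)] by (simp add: abs_if)
            then show "is_arg_min (\<lambda>\<theta>. \<bar>y - G t \<theta>\<bar>) (\<lambda>\<theta>. \<theta> \<in> \<Phi>) x \<longleftrightarrow> x \<in> \<Phi> \<and> (\<forall>\<theta>\<in>\<Phi>. x \<le> \<theta>)"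
              unfolding is_arg_min_linear by auto
          qed
          then show ?thesis unfolding if_not_P[OF ne] if_not_P[OF nU] if_P[OF True] by simp
        next
          case nL: False
          then obtain \<theta>2 where \<theta>2: "\<theta>2 \<in> \<Phi>" "G t \<theta>2 \<le> y" using D(2) by (meson linorder_not_less subsetD)
          then have "\<theta>2 \<le> \<theta>1" using le_iff[OF \<theta>2(1) \<theta>1(1)] \<theta>1 by simp
          then obtain s where s: "\<theta>2 \<le> s" "s \<le> \<theta>1" "G t s = y"
            using IVT'[of "G t" \<theta>2 y \<theta>1] \<theta>1 \<theta>2 cont[OF t] by blast
          then have s\<Phi>: "s \<in> \<Phi>" using conv \<theta>1 \<theta>2 by blast
          have "is_arg_min (\<lambda>\<theta>. \<bar>y - G t \<theta>\<bar>) (\<lambda>\<theta>. \<theta> \<in> \<Phi>) x \<longleftrightarrow> x = s" for x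
          proof
            assume "is_arg_min (\<lambda>\<theta>. \<bar>y - G t \<theta>\<bar>) (\<lambda>\<theta>. \<theta> \<in> \<Phi>) x"
            then have x: "x \<in> \<Phi>" "\<bar>y - G t x\<bar> \<le> \<bar>y - G t s\<bar>" using s\<Phi> unfolding is_arg_min_linear by auto
            then have "G t x = G t s" using s by simp
            then show "x = s" using le_iff[OF x(1) s\<Phi>] le_iff[OF s\<Phi> x(1)] by simp
          qed (use s s\<Phi> in \<open>simp add: is_arg_min_linear\<close>)
          then have \<Theta>: "\<Theta> t y = s" unfolding \<Theta>_def by (subst arg_min_eqI[where Q="\<lambda>x. x = s"]) auto
          have "s \<le> c \<longleftrightarrow> R c t y"
          proof (cases "c \<in> \<Phi>")
            case True then show ?thesis using le_iff[OF s\<Phi> True] s by (simp add: R_def)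
          next
            case False
            then have "s \<le> c \<longleftrightarrow> (\<forall>\<theta>\<in>\<Phi>. \<theta> < c)" using conv s\<Phi> by (meson linorder_not_less order_less_imp_le)
            then show ?thesis using False by (simp add: R_def)
          qed
          then show ?thesis unfolding if_not_P[OF ne] if_not_P[OF nU] if_not_P[OF nL] \<Theta> .
        qed
      qed
    qed
    show ?thesis
    proof (rule borel_measurableI_le)
      fix c
      have [measurable]: "(\<lambda>t. G t p) \<in> borel_measurable M" "(\<lambda>t. G t q) \<in> borel_measurable M" using pq mG by auto
      have [measurable]: "\<And>\<theta>. \<theta> \<in> D \<Longrightarrow> (\<lambda>t. G t \<theta>) \<in> borel_measurable M" using D(2) mG by auto
      have [measurable]: "countable D" by fact
      have [measurable]: "Measurable.pred (M \<Otimes>\<^sub>M borel) (\<lambda>x. R c (fst x) (snd x))"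
      proof (cases "c \<in> \<Phi>")
        case True
        then have [measurable]: "(\<lambda>t. G t c) \<in> borel_measurable M" by (rule mG)
        show ?thesis using True by (simp add: R_def)
      qed (simp add: R_def)
      have "{x \<in> space (M \<Otimes>\<^sub>M borel). (case x of (t, y) \<Rightarrow> \<Theta> t y) \<le> c} =
        {x \<in> space (M \<Otimes>\<^sub>M borel). (if G (fst x) p = G (fst x) q then k0 \<le> c else if \<forall>\<theta>\<in>D. G (fst x) \<theta> < snd x then kU \<le> c
         else if \<forall>\<theta>\<in>D. snd x < G (fst x) \<theta> then kL \<le> c else R c (fst x) (snd x))}"
        by (intro Collect_cong conj_cong refl) (auto simp: space_pair_measure char split del: if_split cong: if_cong)
      also have "\<dots> \<in> sets (M \<Otimes>\<^sub>M borel)" by measurable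
      finally show "{x \<in> space (M \<Otimes>\<^sub>M borel). (case x of (t, y) \<Rightarrow> \<Theta> t y) \<le> c} \<in> sets (M \<Otimes>\<^sub>M borel)" .
    qed
  qed
  then show ?thesis by (simp add: \<Theta>_def)
qed

section \<open>Clipping\<close>

lemma clip_measurable [measurable]:
  "\<lbrakk>a \<in> borel_measurable M; b \<in> borel_measurable M; u \<in> borel_measurable M\<rbrakk> \<Longrightarrow> (\<lambda>x. clip (a x) (b x) (u x)) \<in> borel_measurable M"
  unfolding clip_def by (intro borel_measurable_min borel_measurable_max)

lemma abs_clip_le: "0 \<le> B \<Longrightarrow> \<bar>clip (- B) B u\<bar> \<le> B"
  by (auto simp: clip_def min_def max_def)

lemma mono_clip: "mono (\<lambda>x. clip a b (x - t))"
  by (rule monoI) (auto simp: clip_def min_def max_def)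

lemma clip_lipschitz: "\<bar>clip a b u - clip a b v\<bar> \<le> \<bar>u - v\<bar>"
  by (auto simp: clip_def min_def max_def)

lemma neighbours_sum_diff:
  fixes f :: "real \<Rightarrow> real"
  assumes nb: "neighbours n X X'" and B: "\<And>x. \<bar>f x\<bar> \<le> B"
  shows "\<bar>(\<Sum>i<n. f (X i)) - (\<Sum>i<n. f (X' i))\<bar> \<le> 2 * B"
proof -
  obtain i where i: "i < n" "\<And>j. j < n \<Longrightarrow> j \<noteq> i \<Longrightarrow> X j = X' j" using nb by (auto simp: neighbours_def)
  have "(\<Sum>i<n. f (X i)) - (\<Sum>i<n. f (X' i)) = (\<Sum>j<n. if j = i then f (X i) - f (X' i) else 0)"
    unfolding sum_subtractf[symmetric] by (intro sum.cong) (auto simp: i)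
  also have "\<dots> = f (X i) - f (X' i)" using i by simp
  also have "\<bar>\<dots>\<bar> \<le> 2 * B" using B[of "X i"] B[of "X' i"] by linarith
  finally show ?thesis .
qed

lemma datasets_component: "i < n \<Longrightarrow> (\<lambda>X. X i) \<in> borel_measurable (datasets n)"
  unfolding datasets_def by (rule measurable_component_singleton) simp

lemma clipped_mean_measurable:
  assumes [measurable]: "t \<in> borel_measurable M" "a \<in> borel_measurable M" "X \<in> M \<rightarrow>\<^sub>M datasets n"
  shows "(\<lambda>x. clipped_mean n C \<epsilon> (t x) (a x) (X x)) \<in> borel_measurable M"
proof -
  have [measurable]: "(\<lambda>x. X x i) \<in> borel_measurable M" if "i < n" for i
    using measurable_compose[OF assms(3) datasets_component[OF that]] .
  show ?thesis unfolding clipped_mean_def by measurable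
qed

lemma iid_component:
  assumes "prob_space P" "i < n"
  shows "distr (iid n P) P (\<lambda>X. X i) = P"
  unfolding iid_def using assms by (intro distr_PiM_component) auto

lemma sets_iid: "sets P = sets borel \<Longrightarrow> sets (iid n P) = sets (datasets n)"
  unfolding iid_def datasets_def by (intro sets_PiM_cong) auto

lemma prob_space_iid: "prob_space P \<Longrightarrow> prob_space (iid n P)"
  unfolding iid_def by (intro prob_space_PiM)

lemma iid_in_prob_algebra:
  "prob_space P \<Longrightarrow> sets P = sets borel \<Longrightarrow> iid n P \<in> space (prob_algebra (datasets n))"
  by (simp add: space_prob_algebra sets_iid prob_space_iid)

lemma integral_iid_component:
  fixes f :: "real \<Rightarrow> real"
  assumes P: "prob_space P" "sets P = sets borel" and i: "i < n" and f: "f \<in> borel_measurable borel"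
  shows "(\<integral>X. f (X i) \<partial>iid n P) = (\<integral>x. f x \<partial>P)"
    and "integrable (iid n P) (\<lambda>X. f (X i)) \<longleftrightarrow> integrable P f"
proof -
  have m: "(\<lambda>X. X i) \<in> iid n P \<rightarrow>\<^sub>M P"
    unfolding iid_def using i by (intro measurable_component_singleton) simp
  have f': "f \<in> borel_measurable P" using f P by (simp cong: measurable_cong_sets)
  show "(\<integral>X. f (X i) \<partial>iid n P) = (\<integral>x. f x \<partial>P)"
    using integral_distr[OF m f'] iid_component[OF P(1) i] by simp
  show "integrable (iid n P) (\<lambda>X. f (X i)) \<longleftrightarrow> integrable P f"
    using integrable_distr_eq[OF m f'] iid_component[OF P(1) i] by simp
qed

section \<open>Measurability and privacy of the clipped likelihood estimator\<close>

context exp_family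
begin

abbreviation "I \<equiv> log_partition' \<mu> ` interior \<Phi>"
abbreviation "A'inv \<equiv> the_inv_into (interior \<Phi>) (log_partition' \<mu>)"

lemma A'inv: assumes "t \<in> I" shows "A'inv t \<in> interior \<Phi>" "log_partition' \<mu> (A'inv t) = t"
  using the_inv_into_into[OF A'_inj assms order_refl] f_the_inv_into_f[OF A'_inj assms] by auto

lemma alpha_tilde_pos: "0 < n \<Longrightarrow> t \<in> I \<Longrightarrow> 0 < alpha_tilde \<mu> n t"
  unfolding alpha_tilde_def alpha_def using A''_pos[OF A'inv(1)] by simp

lemma I_borel [measurable]: "I \<in> sets borel"
proof -
  have "continuous_on (interior \<Phi>) (log_partition' \<mu>)"
    by (intro DERIV_continuous_on[where D="log_partition'' \<mu>"]) (auto intro: has_field_derivative_at_within A'_has_deriv)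
  then have "open I" using A'_inj by (intro invariance_of_domain) auto
  then show ?thesis by simp
qed

text \<open>A total version of \<open>alpha_tilde\<close>: the value 1 outside the range of the
  derivative keeps it positive, so the facts about \<open>G\<close> hold for every t without a case
  distinction.\<close>

definition atl :: "nat \<Rightarrow> real \<Rightarrow> real" where
  "atl n t = (if t \<in> I then alpha_tilde \<mu> n t else 1)"

lemma atl_pos: "0 < n \<Longrightarrow> 0 < atl n t"
  by (simp add: atl_def alpha_tilde_pos)

text \<open>The inverse of the derivative is monotone on its range, hence Borel there, and the
  second derivative is continuous on the interior.\<close>

lemma atl_measurable [measurable]: "atl n \<in> borel_measurable borel"
proof -
  have "mono_on I A'inv"
    by (rule mono_onI) (metis A'inv A'_less_iff linorder_not_less)
  then have "A'inv \<in> borel_measurable (restrict_space borel I)"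
    by (rule borel_measurable_mono_on_fnc)
  then have 1: "A'inv \<in> restrict_space borel I \<rightarrow>\<^sub>M restrict_space borel (interior \<Phi>)"
    by (intro measurable_restrict_space2) (auto simp: space_restrict_space A'inv)
  have "log_partition'' \<mu> \<in> borel_measurable (restrict_space borel (interior \<Phi>))"
    by (rule borel_measurable_continuous_on_restrict[OF continuous_A''])
  from measurable_compose[OF 1 this] have [measurable]: "(\<lambda>t. log_partition'' \<mu> (A'inv t)) \<in> borel_measurable (restrict_space borel I)" .
  have "alpha_tilde \<mu> n \<in> borel_measurable (restrict_space borel I)"
    unfolding alpha_tilde_def[abs_def] alpha_def by measurable
  then show ?thesis unfolding atl_def[abs_def]
    by (subst measurable_restrict_space_iff[symmetric]) auto
qed

text \<open>By linearity the expectation of the clipped mean of n records is that of a single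
  clipped record, which is the form kept here (\<open>clipped_mean_expectation\<close>).\<close>

definition G :: "nat \<Rightarrow> real \<Rightarrow> real \<Rightarrow> real \<Rightarrow> real \<Rightarrow> real" where
  "G n C \<epsilon> t \<theta> = (\<integral>x. clip (- (\<epsilon> / (C * atl n t))) (\<epsilon> / (C * atl n t)) (x - t) \<partial>P \<theta>)"

lemma clipped_mean_expectation:
  assumes "0 < n" "\<theta> \<in> \<Phi>" "0 < C" "0 < \<epsilon>" "0 < a"
  shows "(\<integral>X. clipped_mean n C \<epsilon> t a X \<partial>iid n (P \<theta>)) = (\<integral>x. clip (- (\<epsilon> / (C * a))) (\<epsilon> / (C * a)) (x - t) \<partial>P \<theta>)"
proof -
  let ?c = "\<lambda>x. clip (- (\<epsilon> / (C * a))) (\<epsilon> / (C * a)) (x - t)"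
  have P: "prob_space (P \<theta>)" "sets (P \<theta>) = sets borel" using assms prob_space_P by auto
  have i: "integrable (P \<theta>) ?c"
    by (rule integrable_bounded_P[where B="\<epsilon> / (C * a)"]) (use assms abs_clip_le in auto)
  show ?thesis
    unfolding clipped_mean_def using assms
    by (simp add: Bochner_Integration.integral_sum integral_iid_component[OF P, of _ n ?c] i)
qed

lemma G_measurable: "\<theta> \<in> \<Phi> \<Longrightarrow> (\<lambda>t. G n C \<epsilon> t \<theta>) \<in> borel_measurable borel"
proof -
  assume "\<theta> \<in> \<Phi>"
  then interpret prob_space "P \<theta>" by (rule prob_space_P)
  show ?thesis unfolding G_def by measurable
qed

text \<open>Clipping preserves monotonicity, so \<open>expectation_mono\<close> applies: equality at
  two parameters makes the clipped record constant almost everywhere, and then all expectations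
  agree.\<close>

lemma G_dichotomy:
  assumes "0 < n" "0 < C" "0 < \<epsilon>"
  shows "(\<forall>a\<in>\<Phi>. \<forall>b\<in>\<Phi>. G n C \<epsilon> t a = G n C \<epsilon> t b) \<or> (\<forall>a\<in>\<Phi>. \<forall>b\<in>\<Phi>. a < b \<longrightarrow> G n C \<epsilon> t a < G n C \<epsilon> t b)"
proof -
  let ?B = "\<epsilon> / (C * atl n t)"
  have B: "0 \<le> ?B" using atl_pos[of n t] assms by simp
  note m = expectation_mono[OF _ _ _ mono_clip abs_clip_le[OF B], of _ _ t, folded G_def]
  show ?thesis
  proof (cases "\<exists>c. AE x in \<mu>. clip (- ?B) ?B (x - t) = c")
    case True
    then obtain c where "AE x in \<mu>. clip (- ?B) ?B (x - t) = c" by blast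
    then have "G n C \<epsilon> t a = c" if "a \<in> \<Phi>" for a unfolding G_def using that by (intro expectation_const) auto
    then show ?thesis by simp
  next
    case False
    then have "G n C \<epsilon> t a < G n C \<epsilon> t b" if "a \<in> \<Phi>" "b \<in> \<Phi>" "a < b" for a b
      using m[OF that] by (meson order_le_less)
    then show ?thesis by blast
  qed
qed

lemma G_continuous:
  assumes "0 < n" "0 < C" "0 < \<epsilon>" "a \<in> \<Phi>" "b \<in> \<Phi>" shows "continuous_on {a..b} (G n C \<epsilon> t)"
proof -
  have B: "0 \<le> \<epsilon> / (C * atl n t)" using atl_pos[of n t] assms by simp
  show ?thesis unfolding G_def
    by (rule expectation_continuous[OF assms(4,5) _ abs_clip_le[OF B]]) measurable
qed

definition \<Theta> :: "nat \<Rightarrow> real \<Rightarrow> real \<Rightarrow> real \<Rightarrow> real \<Rightarrow> real" where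
  "\<Theta> n C \<epsilon> t y = arg_min (\<lambda>\<theta>. \<bar>y - G n C \<epsilon> t \<theta>\<bar>) (\<lambda>\<theta>. \<theta> \<in> \<Phi>)"

lemma \<Theta>_measurable:
  assumes "0 < n" "0 < C" "0 < \<epsilon>"
  shows "(\<lambda>(t, y). \<Theta> n C \<epsilon> t y) \<in> borel_measurable (borel \<Otimes>\<^sub>M borel)"
  unfolding \<Theta>_def using assms
  by (intro arg_min_measurable is_interval_Phi G_measurable G_dichotomy G_continuous) auto

lemma nCLLRE_in:
  assumes "0 < n" "0 < C" "0 < \<epsilon>" "t \<in> I"
  shows "nCLLRE \<mu> n C \<epsilon> X t = distr (laplace (2 / (real n * C * atl n t))) borel
    (\<lambda>z. \<Theta> n C \<epsilon> t (clipped_mean n C \<epsilon> t (atl n t) X + z))"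
proof -
  have "atl n t = alpha_tilde \<mu> n t" using assms by (simp add: atl_def)
  \<comment> \<open>The two objective functions are only known to agree on \<Phi>. Hence the
    minimality predicates are compared, which look at no other points.\<close>
  moreover have "arg_min (\<lambda>\<theta>. \<bar>y - (\<integral>X'. clipped_mean n C \<epsilon> t (atl n t) X' \<partial>iid n (P \<theta>))\<bar>) (\<lambda>\<theta>. \<theta> \<in> \<Phi>) = \<Theta> n C \<epsilon> t y" for y
    unfolding \<Theta>_def arg_min_def
  proof (intro arg_cong[where f=Eps] ext)
    have "(\<integral>X'. clipped_mean n C \<epsilon> t (atl n t) X' \<partial>iid n (P \<theta>)) = G n C \<epsilon> t \<theta>" if "\<theta> \<in> \<Phi>" for \<theta>
      unfolding G_def using assms that by (intro clipped_mean_expectation atl_pos)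
    then show "is_arg_min (\<lambda>\<theta>. \<bar>y - (\<integral>X'. clipped_mean n C \<epsilon> t (atl n t) X' \<partial>iid n (P \<theta>))\<bar>) (\<lambda>\<theta>. \<theta> \<in> \<Phi>) x =
       is_arg_min (\<lambda>\<theta>. \<bar>y - G n C \<epsilon> t \<theta>\<bar>) (\<lambda>\<theta>. \<theta> \<in> \<Phi>) x" for x
      unfolding is_arg_min_linear by auto
  qed
  ultimately show ?thesis using assms by (simp add: nCLLRE_def Let_def)
qed

text \<open>One formula for all \<open>t\<close> with a noise law that does not depend on
  \<open>t\<close>; outside the range of the derivative a constant function of the noise reproduces
  the point mass.\<close>

lemma nCLLRE_eq:
  assumes "0 < n" "0 < C" "0 < \<epsilon>"
  shows "nCLLRE \<mu> n C \<epsilon> X t = distr (laplace 1) borel (\<lambda>z. if t \<in> I then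
     \<Theta> n C \<epsilon> t (clipped_mean n C \<epsilon> t (atl n t) X + 2 / (real n * C * atl n t) * z) else undefined)"
proof (cases "t \<in> I")
  case True
  have b: "0 < 2 / (real n * C * atl n t)" using assms atl_pos[of n t] by simp
  let ?f = "\<lambda>z. \<Theta> n C \<epsilon> t (clipped_mean n C \<epsilon> t (atl n t) X + z)"
  have "distr (laplace (2 / (real n * C * atl n t))) borel ?f =
      distr (laplace 1) borel (?f \<circ> (\<lambda>z. 2 / (real n * C * atl n t) * z))"
    unfolding laplace_scale[OF b]
  proof (rule distr_distr)
    have "\<Theta> n C \<epsilon> t \<in> borel_measurable borel"
      using measurable_compose[OF measurable_Pair1'[of t borel borel] \<Theta>_measurable[OF assms]] by simp
    then show "?f \<in> borel_measurable borel"
      by (rule measurable_compose[rotated]) (rule borel_measurable_add[OF borel_measurable_const measurable_ident_sets[OF refl]])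
    have "(\<lambda>z. 2 / (real n * C * atl n t) * z) \<in> borel_measurable borel"
      by (rule borel_measurable_times[OF borel_measurable_const measurable_ident_sets[OF refl]])
    then show "(\<lambda>z. 2 / (real n * C * atl n t) * z) \<in> borel_measurable (laplace 1)"
      by (simp cong: measurable_cong_sets)
  qed
  then show ?thesis using True by (simp add: nCLLRE_in assms comp_def)
next
  case False
  interpret prob_space "laplace 1" by (rule prob_space_laplace) simp
  show ?thesis using False by (simp add: nCLLRE_def distr_const)
qed

lemma nCLLRE_measurable:
  assumes "0 < n" "0 < C" "0 < \<epsilon>"
  shows "(\<lambda>(X, t). nCLLRE \<mu> n C \<epsilon> X t) \<in> datasets n \<Otimes>\<^sub>M borel \<rightarrow>\<^sub>M prob_algebra borel"
proof -
  note [measurable] = \<Theta>_measurable[OF assms] clipped_mean_measurable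
  have [measurable]: "laplace 1 \<in> space (prob_algebra borel)" by (simp add: space_prob_algebra prob_space_laplace)
  show ?thesis unfolding nCLLRE_eq[OF assms] by measurable
qed

lemma nCLLRE_close:
  assumes "0 < n" "0 < C" "0 < \<epsilon>" and nb: "neighbours n X X'"
  shows "close \<epsilon> 0 (nCLLRE \<mu> n C \<epsilon> X t) (nCLLRE \<mu> n C \<epsilon> X' t)"
proof (cases "t \<in> I")
  case True
  note [measurable] = \<Theta>_measurable[OF assms(1-3)]
  let ?a = "atl n t"
  have a: "0 < ?a" using assms atl_pos by simp
  let ?B = "\<epsilon> / (C * ?a)"
  have B: "0 \<le> ?B" using a assms by simp
  have "\<bar>clipped_mean n C \<epsilon> t ?a X - clipped_mean n C \<epsilon> t ?a X'\<bar> = 1 / real n *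
     \<bar>(\<Sum>i<n. clip (- ?B) ?B (X i - t)) - (\<Sum>i<n. clip (- ?B) ?B (X' i - t))\<bar>"
    unfolding clipped_mean_def by (simp add: abs_mult flip: right_diff_distrib diff_divide_distrib)
  also have "\<dots> \<le> 1 / real n * (2 * ?B)"
    by (intro mult_left_mono neighbours_sum_diff[OF nb, of "\<lambda>x. clip (- ?B) ?B (x - t)"] abs_clip_le B) simp
  \<comment> \<open>The clipping level carries the factor \<epsilon>, so the noise scale is exactly
    the sensitivity divided by \<epsilon>.\<close>
  also have "\<dots> = \<epsilon> * (2 / (real n * C * ?a))" by (simp add: mult_ac)
  finally show ?thesis using assms a unfolding nCLLRE_in[OF assms(1-3) True]
    by (intro laplace_mechanism) auto
next
  case False
  then show ?thesis using assms by (auto simp: nCLLRE_def intro!: close_refl)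
qed

end

section \<open>Privacy of the two-sample algorithm\<close>

lemma split_datasets:
  "(\<lambda>X. \<lambda>i\<in>{..<n}. X i) \<in> datasets (2 * n) \<rightarrow>\<^sub>M datasets n"
  "(\<lambda>X. \<lambda>i\<in>{..<n}. X (n + i)) \<in> datasets (2 * n) \<rightarrow>\<^sub>M datasets n"
  by (subst (2) datasets_def, rule measurable_restrict, rule datasets_component, simp)+

lemma A_low_measurable:
  assumes "base_measure \<mu>" "0 < n" "0 < C" "0 < \<epsilon>" and M: "M \<in> datasets n \<rightarrow>\<^sub>M prob_algebra borel"
  shows "A_low \<mu> n C \<epsilon> M \<in> datasets (2 * n) \<rightarrow>\<^sub>M prob_algebra borel"
proof -
  interpret exp_family \<mu> by standard fact
  note split_datasets[measurable] M[measurable]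
  have "0 < \<epsilon> / 2" using assms by simp
  note nCLLRE_measurable[OF assms(2,3) this, measurable]
  show ?thesis unfolding A_low_def by measurable
qed

theorem A_low_private:
  assumes "base_measure \<mu>" "0 < n" "0 < C" "0 < \<epsilon>" "0 \<le> \<delta>" and M: "DP n borel (\<epsilon> / 2) \<delta> M"
  shows "DP (2 * n) borel \<epsilon> \<delta> (A_low \<mu> n C \<epsilon> M)"
proof (rule DP_I)
  interpret exp_family \<mu> by standard fact
  have mM: "M \<in> datasets n \<rightarrow>\<^sub>M prob_algebra borel" using M by (simp add: DP_def)
  show "A_low \<mu> n C \<epsilon> M \<in> datasets (2 * n) \<rightarrow>\<^sub>M prob_algebra borel"
    using assms mM by (intro A_low_measurable)
  fix d d' assume nb: "neighbours (2 * n) d d'"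
  then have d: "d \<in> space (datasets (2 * n))" "d' \<in> space (datasets (2 * n))" by (auto simp: neighbours_def)
  obtain i where i: "i < 2 * n" "\<And>j. j < 2 * n \<Longrightarrow> j \<noteq> i \<Longrightarrow> d j = d' j" using nb by (auto simp: neighbours_def)
  define l r where "l = (\<lambda>X::nat\<Rightarrow>real. \<lambda>i\<in>{..<n}. X i)" and "r = (\<lambda>X::nat\<Rightarrow>real. \<lambda>i\<in>{..<n}. X (n + i))"
  have sp: "l d \<in> space (datasets n)" "l d' \<in> space (datasets n)" "r d \<in> space (datasets n)" "r d' \<in> space (datasets n)"
    unfolding l_def r_def using split_datasets[THEN measurable_space] d by auto
  have e2: "0 < \<epsilon> / 2" using assms by simp
  have K: "nCLLRE \<mu> n C (\<epsilon> / 2) X \<in> borel \<rightarrow>\<^sub>M prob_algebra borel" if "X \<in> space (datasets n)" for X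
    using measurable_compose[OF measurable_Pair1'[OF that] nCLLRE_measurable[OF assms(2,3) e2]] by simp
  have pM: "M X \<in> space (prob_algebra borel)" if "X \<in> space (datasets n)" for X
    using measurable_space[OF mM that] .
  have A: "A_low \<mu> n C \<epsilon> M X = M (r X) \<bind> nCLLRE \<mu> n C (\<epsilon> / 2) (l X)" for X by (simp add: A_low_def l_def r_def)
  \<comment> \<open>The changed record lies in one half only. The other half is the same in both
    data sets, and its stage is covered by reflexivity of \<open>close\<close>.\<close>
  have "(close (\<epsilon>/2) \<delta> (M (r d)) (M (r d')) \<and> (\<forall>t. close (\<epsilon>/2) 0 (nCLLRE \<mu> n C (\<epsilon> / 2) (l d) t) (nCLLRE \<mu> n C (\<epsilon> / 2) (l d') t)))"
  proof (cases "i < n")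
    case True
    then have "r d = r d'" unfolding r_def by (intro restrict_ext i) auto
    moreover have "neighbours n (l d) (l d')"
      unfolding neighbours_def using sp True i by (auto simp: l_def intro!: exI[of _ i])
    ultimately show ?thesis using nCLLRE_close[OF assms(2,3) e2] e2 assms by (auto intro: close_refl)
  next
    case False
    then have "l d = l d'" unfolding l_def by (intro restrict_ext i) auto
    moreover have "neighbours n (r d) (r d')"
      unfolding neighbours_def using sp False i by (auto simp: r_def intro!: exI[of _ "i - n"])
    ultimately show ?thesis using DP_close[OF M] e2 by (auto intro: close_refl)
  qed
  then have "close (\<epsilon>/2 + \<epsilon>/2) (\<delta> + 0) (A_low \<mu> n C \<epsilon> M d) (A_low \<mu> n C \<epsilon> M d')"
    unfolding A using sp e2 by (intro close_bind[where N=borel and L=borel] pM K) auto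
  then show "close \<epsilon> \<delta> (A_low \<mu> n C \<epsilon> M d) (A_low \<mu> n C \<epsilon> M d')" by simp
qed

section \<open>Independent samples\<close>

lemma iid_prod:
  fixes f :: "nat \<Rightarrow> real \<Rightarrow> real"
  assumes P: "prob_space P" and K: "K \<subseteq> {..<n}" and f: "\<And>k. k \<in> K \<Longrightarrow> integrable P (f k)"
  shows "(\<integral>X. (\<Prod>k\<in>K. f k (X k)) \<partial>iid n P) = (\<Prod>k\<in>K. \<integral>x. f k x \<partial>P)"
    and "integrable (iid n P) (\<lambda>X. \<Prod>k\<in>K. f k (X k))"
proof -
  interpret P: prob_space P by fact
  interpret product_sigma_finite "\<lambda>_::nat. P" by unfold_locales
  \<comment> \<open>Coordinates outside \<open>K\<close> are padded with the factor 1, which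
    integrates to 1.\<close>
  let ?g = "\<lambda>k. if k \<in> K then f k else (\<lambda>_. 1)"
  have g: "integrable P (?g k)" for k using f by simp
  have eq: "(\<Prod>k\<in>K. f k (X k)) = (\<Prod>k<n. ?g k (X k))" for X
    by (intro prod.mono_neutral_cong_left) (use K in auto)
  have "(\<Prod>k<n. \<integral>x. ?g k x \<partial>P) = (\<Prod>k\<in>K. \<integral>x. f k x \<partial>P)"
    by (intro prod.mono_neutral_cong_right) (use K P.prob_space in auto)
  then show "(\<integral>X. (\<Prod>k\<in>K. f k (X k)) \<partial>iid n P) = (\<Prod>k\<in>K. \<integral>x. f k x \<partial>P)"
    unfolding eq iid_def using product_integral_prod[of "{..<n}" ?g] g by simp
  show "integrable (iid n P) (\<lambda>X. \<Prod>k\<in>K. f k (X k))"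
    unfolding eq iid_def using product_integrable_prod[of "{..<n}" ?g] g by simp
qed

text \<open>Chebyshev's inequality: by independence the cross terms of the squared sum vanish. The
  index set \<open>J\<close> is the whole sample for clipped averages and a single block for the
  initial estimator.\<close>

lemma iid_average_deviation:
  fixes h :: "real \<Rightarrow> real" and a v m :: real
  assumes P: "prob_space P" "sets P = sets borel" and J: "J \<subseteq> {..<n}" "J \<noteq> {}"
    and h: "integrable P h" "(\<integral>x. h x \<partial>P) = m"
    and v: "integrable P (\<lambda>x. (h x - m)\<^sup>2)" "(\<integral>x. (h x - m)\<^sup>2 \<partial>P) \<le> v" and a: "0 < a"
  shows "measure (iid n P) {X \<in> space (iid n P). a \<le> \<bar>(\<Sum>j\<in>J. h (X j)) / card J - m\<bar>} \<le> v / (card J * a\<^sup>2)"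
proof -
  interpret P: prob_space P by (rule P)
  interpret X: prob_space "iid n P" by (rule prob_space_iid[OF P(1)])
  have fin: "finite J" using J(1) by (rule finite_subset) simp
  then have cJ: "0 < real (card J)" using J(2) by (simp add: card_gt_0_iff)
  define u where "u x = h x - m" for x
  have mh: "h \<in> borel_measurable borel" using borel_measurable_integrable[OF h(1)] P(2) by (simp cong: measurable_cong_sets)
  then have mu: "(\<lambda>x. u x * u x) \<in> borel_measurable borel" by (simp add: u_def)
  have u: "integrable P u" "(\<integral>x. u x \<partial>P) = 0"
    using h P.prob_space by (simp_all add: u_def[abs_def])
  have u2: "integrable P (\<lambda>x. u x * u x)" "(\<integral>x. u x * u x \<partial>P) \<le> v"
    using v by (simp_all add: u_def power2_eq_square)
  have pair: "integrable (iid n P) (\<lambda>X. u (X j) * u (X k))"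
    "(\<integral>X. u (X j) * u (X k) \<partial>iid n P) = (if j = k then \<integral>x. u x * u x \<partial>P else 0)"
    if "j \<in> J" "k \<in> J" for j k
  proof -
    have jk: "j < n" "k < n" using that J by auto
    have "integrable (iid n P) (\<lambda>X. u (X j) * u (X k)) \<and>
     (\<integral>X. u (X j) * u (X k) \<partial>iid n P) = (if j = k then \<integral>x. u x * u x \<partial>P else 0)"
    proof (cases "j = k")
      case True
      then show ?thesis using integral_iid_component[OF P jk(2) mu] u2 by simp
    next
      case False
      then show ?thesis using iid_prod[OF P(1), of "{j,k}" n "\<lambda>_. u"] jk u by simp
    qed
    then show "integrable (iid n P) (\<lambda>X. u (X j) * u (X k))"
    "(\<integral>X. u (X j) * u (X k) \<partial>iid n P) = (if j = k then \<integral>x. u x * u x \<partial>P else 0)" by auto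
  qed
  let ?S = "\<lambda>X. (\<Sum>j\<in>J. u (X j))\<^sup>2"
  have S: "?S = (\<lambda>X. \<Sum>j\<in>J. \<Sum>k\<in>J. u (X j) * u (X k))"
    by (simp add: power2_eq_square sum_product)
  have iS: "integrable (iid n P) ?S" unfolding S by (intro Bochner_Integration.integrable_sum pair)
  have "(\<integral>X. ?S X \<partial>iid n P) = (\<Sum>j\<in>J. \<Sum>k\<in>J. if j = k then \<integral>x. u x * u x \<partial>P else 0)"
    unfolding S by (simp add: Bochner_Integration.integral_sum pair Bochner_Integration.integrable_sum)
  also have "\<dots> = card J * (\<integral>x. u x * u x \<partial>P)" using fin by simp
  also have "\<dots> \<le> card J * v" using u2 by (intro mult_left_mono) auto
  finally have ES: "(\<integral>X. ?S X \<partial>iid n P) \<le> card J * v" .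
  have dev: "(\<Sum>j\<in>J. h (X j)) / card J - m = (\<Sum>j\<in>J. u (X j)) / card J" for X
    using cJ by (simp add: u_def sum_subtractf diff_divide_distrib)
  have "{X \<in> space (iid n P). a \<le> \<bar>(\<Sum>j\<in>J. h (X j)) / card J - m\<bar>} = {X \<in> space (iid n P). (card J * a)\<^sup>2 \<le> ?S X}"
  proof (intro Collect_cong conj_cong refl)
    fix X
    have "a \<le> \<bar>(\<Sum>j\<in>J. u (X j)) / card J\<bar> \<longleftrightarrow> card J * a \<le> \<bar>\<Sum>j\<in>J. u (X j)\<bar>"
      using cJ by (simp add: abs_divide pos_le_divide_eq mult.commute)
    also have "\<dots> \<longleftrightarrow> (card J * a)\<^sup>2 \<le> ?S X" using cJ a by (simp add: abs_le_square_iff[symmetric])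
    finally show "a \<le> \<bar>(\<Sum>j\<in>J. h (X j)) / card J - m\<bar> \<longleftrightarrow> (card J * a)\<^sup>2 \<le> ?S X" unfolding dev .
  qed
  also have "measure (iid n P) \<dots> \<le> (\<integral>X. ?S X \<partial>iid n P) / (card J * a)\<^sup>2"
    by (rule integral_Markov_inequality_measure[where A="{}"]) (use iS cJ a in auto)
  also have "\<dots> \<le> card J * v / (card J * a)\<^sup>2" by (intro divide_right_mono ES) auto
  also have "\<dots> = v / (card J * a\<^sup>2)" using cJ by (simp add: power2_eq_square field_simps)
  finally show ?thesis .
qed

lemma measure_bind_ge:
  assumes P: "P \<in> space (prob_algebra N)" and K: "K \<in> N \<rightarrow>\<^sub>M prob_algebra L" and E: "E \<in> sets L"
    and A: "A \<in> sets N" "p \<le> measure P A" and q: "0 \<le> q" "\<And>x. x \<in> A \<Longrightarrow> q \<le> measure (K x) E"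
  shows "p * q \<le> measure (P \<bind> K) E"
proof -
  have sP: "sets P = sets N" and pP: "prob_space P" using P by (auto simp: space_prob_algebra)
  interpret prob_space P by fact
  have "p * q \<le> measure P A * q" using A q by (intro mult_right_mono) auto
  also have "\<dots> = (\<integral>x. q * indicator A x \<partial>P)" using A sP by (simp add: mult.commute)
  also have "\<dots> \<le> (\<integral>x. measure (K x) E \<partial>P)"
    by (intro integral_mono measure_bind_prob[OF P K E] integrable_mult_right integrable_real_indicator)
       (use A sP q emeasure_finite[of A] in \<open>auto simp: indicator_def less_top[symmetric]\<close>)
  also have "\<dots> = measure (P \<bind> K) E" using measure_bind_prob[OF P K E] by simp
  finally show ?thesis .
qed

text \<open>The product over 2n coordinates is the merge of two independent products, the second one
  reindexed by \<open>n + i\<close>.\<close>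

lemma nn_integral_iid_split:
  assumes P: "prob_space P" "sets P = sets borel"
    and f[measurable]: "f \<in> borel_measurable (datasets n \<Otimes>\<^sub>M datasets n)"
  shows "(\<integral>\<^sup>+X. f (\<lambda>i\<in>{..<n}. X i, \<lambda>i\<in>{..<n}. X (n + i)) \<partial>iid (2 * n) P) = (\<integral>\<^sup>+y. \<integral>\<^sup>+x. f (x, y) \<partial>iid n P \<partial>iid n P)"
proof -
  interpret P: prob_space P by fact
  interpret product_sigma_finite "\<lambda>_::nat. P" by unfold_locales
  let ?I = "{..<n}" and ?J = "{n..<2*n}"
  let ?MI = "Pi\<^sub>M ?I (\<lambda>_. P)" and ?MJ = "Pi\<^sub>M ?J (\<lambda>_. P)"
  let ?r = "\<lambda>w. \<lambda>i\<in>{..<n}. w (n + i)"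
  have IJ: "?I \<union> ?J = {..<2*n}" by auto
  interpret MI: prob_space ?MI by (intro prob_space_PiM P)
  interpret MJ: prob_space ?MJ by (intro prob_space_PiM P)
  interpret pair_sigma_finite ?MI ?MJ ..
  have sI: "sets ?MI = sets (datasets n)" unfolding datasets_def using P(2) by (intro sets_PiM_cong) auto
  have f': "f \<in> borel_measurable (?MI \<Otimes>\<^sub>M ?MI)" using f sI by (simp cong: measurable_cong_sets sets_pair_measure_cong)
  have r: "?r \<in> ?MJ \<rightarrow>\<^sub>M ?MI"
    by (intro measurable_restrict measurable_component_singleton) auto
  have F: "(\<lambda>X. f (\<lambda>i\<in>{..<n}. X i, ?r X)) \<in> borel_measurable (Pi\<^sub>M (?I \<union> ?J) (\<lambda>_. P))"
    by (intro measurable_compose[OF _ f'] measurable_Pair measurable_restrict measurable_component_singleton) auto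
  have dJ: "distr ?MJ ?MI ?r = ?MI"
    using distr_PiM_reindex[of ?J "\<lambda>_. P" "\<lambda>i. n + i" ?I] P(1) by (auto simp: inj_on_def)
  have m: "(\<lambda>y. \<integral>\<^sup>+x. f (x, y) \<partial>?MI) \<in> borel_measurable ?MI"
    using measurable_compose[OF measurable_Pair[OF measurable_snd measurable_fst] f']
    by (intro MI.borel_measurable_nn_integral) (simp add: case_prod_beta')
  have "(\<integral>\<^sup>+X. f (\<lambda>i\<in>{..<n}. X i, ?r X) \<partial>iid (2 * n) P) = (\<integral>\<^sup>+X. f (\<lambda>i\<in>{..<n}. X i, ?r X) \<partial>distr (?MI \<Otimes>\<^sub>M ?MJ) (Pi\<^sub>M (?I \<union> ?J) (\<lambda>_. P)) (merge ?I ?J))"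
    by (subst distr_merge) (auto simp: IJ iid_def)
  also have "\<dots> = (\<integral>\<^sup>+w. f (\<lambda>i\<in>{..<n}. merge ?I ?J w i, ?r (merge ?I ?J w)) \<partial>(?MI \<Otimes>\<^sub>M ?MJ))"
    by (rule nn_integral_distr[OF measurable_merge]) (use F in simp)
  also have "\<dots> = (\<integral>\<^sup>+w. f (fst w, ?r (snd w)) \<partial>(?MI \<Otimes>\<^sub>M ?MJ))"
  proof (intro nn_integral_cong)
    fix w assume "w \<in> space (?MI \<Otimes>\<^sub>M ?MJ)"
    then have "fst w \<in> extensional ?I" by (auto simp: space_pair_measure space_PiM PiE_def)
    then have "(\<lambda>i\<in>{..<n}. merge ?I ?J w i) = fst w" by (cases w) (auto simp: merge_def extensional_def fun_eq_iff)
    moreover have "?r (merge ?I ?J w) = ?r (snd w)" by (cases w) (auto simp: merge_def fun_eq_iff)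
    ultimately show "f (\<lambda>i\<in>{..<n}. merge ?I ?J w i, ?r (merge ?I ?J w)) = f (fst w, ?r (snd w))" by simp
  qed
  also have "\<dots> = (\<integral>\<^sup>+w. \<integral>\<^sup>+x. f (x, ?r w) \<partial>?MI \<partial>?MJ)"
    using f' r by (subst nn_integral_snd[symmetric]) (auto intro!: measurable_compose[OF _ f'] measurable_Pair measurable_compose[OF measurable_snd r] simp: case_prod_beta')
  also have "\<dots> = (\<integral>\<^sup>+y. \<integral>\<^sup>+x. f (x, y) \<partial>?MI \<partial>distr ?MJ ?MI ?r)"
    using m by (subst nn_integral_distr[OF r]) auto
  finally show ?thesis unfolding dJ by (simp add: iid_def)
qed

text \<open>The halves are independent, so the order of integration can be exchanged: once a good
  \<open>t\<close> is fixed, the first sample is still i.i.d. from \<open>P\<close>, and the uniform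
  bound \<open>q\<close> applies to it. The two success probabilities therefore multiply.\<close>

lemma A_low_measure_ge:
  assumes \<mu>: "base_measure \<mu>" and n: "0 < n" "0 < C" "0 < \<epsilon>" and M: "M \<in> datasets n \<rightarrow>\<^sub>M prob_algebra borel"
    and P: "prob_space P" "sets P = sets borel" and T: "T \<in> sets borel" and E: "E \<in> sets borel"
    and p: "0 \<le> p" "p \<le> measure (iid n P \<bind> M) T"
    and q: "0 \<le> q" "\<And>t. t \<in> T \<Longrightarrow> q \<le> measure (iid n P \<bind> (\<lambda>X. nCLLRE \<mu> n C (\<epsilon> / 2) X t)) E"
  shows "p * q \<le> measure (iid (2 * n) P \<bind> A_low \<mu> n C \<epsilon> M) E"
proof -
  interpret exp_family \<mu> by standard fact
  have e2: "0 < \<epsilon> / 2" using n by simp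
  let ?K = "nCLLRE \<mu> n C (\<epsilon> / 2)"
  note K = nCLLRE_measurable[OF n(1,2) e2]
  interpret X: prob_space "iid n P" by (rule prob_space_iid[OF P(1)])
  have iid: "iid m P \<in> space (prob_algebra (datasets m))" for m
    using P by (rule iid_in_prob_algebra)
  have sX: "sets (iid m P) = sets (datasets m)" for m using P by (simp add: sets_iid)
  have spX: "space (iid m P) = space (datasets m)" for m by (rule sets_eq_imp_space_eq[OF sX])
  have mK: "(\<lambda>(x,t). emeasure (?K x t) E) \<in> borel_measurable (datasets n \<Otimes>\<^sub>M borel)"
    using measurable_compose[OF measurable_prob_algebraD[OF K] measurable_emeasure_subprob_algebra[OF E]]
    by (simp add: case_prod_beta')
  have K1: "?K x \<in> borel \<rightarrow>\<^sub>M prob_algebra borel" if "x \<in> space (datasets n)" for x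
    using measurable_compose[OF measurable_Pair1'[OF that] K] by simp
  have K2: "(\<lambda>x. ?K x t) \<in> datasets n \<rightarrow>\<^sub>M prob_algebra borel" for t
    using measurable_compose[OF measurable_Pair2'[of t borel "datasets n"] K] by simp
  have pM: "M y \<in> space (prob_algebra borel)" if "y \<in> space (datasets n)" for y
    using measurable_space[OF M that] .
  define f where "f = (\<lambda>(x,y). \<integral>\<^sup>+t. emeasure (?K x t) E \<partial>M y)"
  have f: "f \<in> borel_measurable (datasets n \<Otimes>\<^sub>M datasets n)"
  proof -
    have "(\<lambda>z. \<integral>\<^sup>+t. (\<lambda>(x,t). emeasure (?K x t) E) (fst z, t) \<partial>M (snd z)) \<in> borel_measurable (datasets n \<Otimes>\<^sub>M datasets n)"
      by (rule nn_integral_measurable_subprob_algebra2[where N=borel])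
         (use mK in \<open>auto intro!: measurable_compose[OF _ mK] measurable_compose[OF measurable_snd] measurable_prob_algebraD M\<close>)
    then show ?thesis unfolding f_def by (simp add: case_prod_beta')
  qed
  have "ennreal (p * q) = ennreal q * ennreal p" using p q by (simp add: ennreal_mult mult.commute)
  also have "\<dots> \<le> ennreal q * emeasure (iid n P \<bind> M) T"
  proof (intro mult_left_mono)
    have "prob_space (iid n P \<bind> M)" using bind_in_prob_algebra[OF iid M] by (simp add: space_prob_algebra)
    then show "ennreal p \<le> emeasure (iid n P \<bind> M) T"
      using p by (simp add: finite_measure.emeasure_eq_measure[OF prob_space.finite_measure] ennreal_leI)
  qed simp
  also have "\<dots> = (\<integral>\<^sup>+y. ennreal q * emeasure (M y) T \<partial>iid n P)"
    using measurable_compose[OF measurable_prob_algebraD[OF M] measurable_emeasure_subprob_algebra[OF T]] sX[of n]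
    by (subst emeasure_bind_prob_algebra[OF iid M T], subst nn_integral_cmult) (auto cong: measurable_cong_sets)
  also have "\<dots> \<le> (\<integral>\<^sup>+y. \<integral>\<^sup>+x. f (x, y) \<partial>iid n P \<partial>iid n P)"
  proof (intro nn_integral_mono)
    fix y assume "y \<in> space (iid n P)"
    then have y: "y \<in> space (datasets n)" by (simp add: spX)
    then have sM: "sets (M y) = sets borel" and pMy: "prob_space (M y)" using pM by (auto simp: space_prob_algebra)
    interpret My: prob_space "M y" by fact
    interpret pair_sigma_finite "iid n P" "M y" ..
    have "ennreal q * emeasure (M y) T = (\<integral>\<^sup>+t. ennreal q * indicator T t \<partial>M y)"
      using T sM by (simp add: nn_integral_cmult)
    also have "\<dots> \<le> (\<integral>\<^sup>+t. \<integral>\<^sup>+x. emeasure (?K x t) E \<partial>iid n P \<partial>M y)"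
    proof (intro nn_integral_mono)
      fix t
      have "ennreal q \<le> (\<integral>\<^sup>+x. emeasure (?K x t) E \<partial>iid n P)" if "t \<in> T"
      proof -
        have "ennreal q \<le> ennreal (measure (iid n P \<bind> (\<lambda>X. ?K X t)) E)" using q that by (intro ennreal_leI)
        also have "\<dots> \<le> emeasure (iid n P \<bind> (\<lambda>X. ?K X t)) E" by (simp add: measure_def ennreal_enn2real_if)
        also have "\<dots> = (\<integral>\<^sup>+x. emeasure (?K x t) E \<partial>iid n P)" by (rule emeasure_bind_prob_algebra[OF iid K2 E])
        finally show ?thesis .
      qed
      then show "ennreal q * indicator T t \<le> (\<integral>\<^sup>+x. emeasure (?K x t) E \<partial>iid n P)" by (auto simp: indicator_def)
    qed
    also have "\<dots> = (\<integral>\<^sup>+x. \<integral>\<^sup>+t. emeasure (?K x t) E \<partial>M y \<partial>iid n P)"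
      using mK sX[of n] sM by (intro Fubini') (simp cong: measurable_cong_sets sets_pair_measure_cong)
    finally show "ennreal q * emeasure (M y) T \<le> (\<integral>\<^sup>+x. f (x, y) \<partial>iid n P)" by (simp add: f_def)
  qed
  also have "\<dots> = (\<integral>\<^sup>+X. f (\<lambda>i\<in>{..<n}. X i, \<lambda>i\<in>{..<n}. X (n + i)) \<partial>iid (2 * n) P)"
    by (rule nn_integral_iid_split[OF P f, symmetric])
  also have "\<dots> = (\<integral>\<^sup>+X. emeasure (A_low \<mu> n C \<epsilon> M X) E \<partial>iid (2 * n) P)"
  proof (intro nn_integral_cong)
    fix X assume "X \<in> space (iid (2 * n) P)"
    then have X: "X \<in> space (datasets (2 * n))" by (simp add: spX)
    show "f (\<lambda>i\<in>{..<n}. X i, \<lambda>i\<in>{..<n}. X (n + i)) = emeasure (A_low \<mu> n C \<epsilon> M X) E"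
      unfolding f_def A_low_def using emeasure_bind_prob_algebra[OF pM K1 E] split_datasets[THEN measurable_space, OF X] by simp
  qed
  also have "\<dots> = emeasure (iid (2 * n) P \<bind> A_low \<mu> n C \<epsilon> M) E"
    by (rule emeasure_bind_prob_algebra[OF iid A_low_measurable[OF \<mu> n M] E, symmetric])
  finally have *: "ennreal (p * q) \<le> emeasure (iid (2 * n) P \<bind> A_low \<mu> n C \<epsilon> M) E" .
  have "prob_space (iid (2 * n) P \<bind> A_low \<mu> n C \<epsilon> M)"
    using bind_in_prob_algebra[OF iid A_low_measurable[OF \<mu> n M]] by (simp add: space_prob_algebra)
  then show ?thesis using *
    by (simp add: finite_measure.emeasure_eq_measure[OF prob_space.finite_measure])
qed

section \<open>Lower bound for the modulus of continuity\<close>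

lemma iid_density:
  fixes W :: "real \<Rightarrow> real"
  assumes P: "prob_space P" "sets P = sets borel" and W[measurable]: "W \<in> borel_measurable borel" "\<And>x. 0 \<le> W x"
    and Q: "prob_space (density P W)"
  shows "iid n (density P W) = density (iid n P) (\<lambda>X. \<Prod>i<n. W (X i))"
proof -
  interpret P: prob_space P by fact
  interpret Q: prob_space "density P W" by fact
  interpret P: product_sigma_finite "\<lambda>_::nat. P" by unfold_locales
  interpret Q: product_sigma_finite "\<lambda>_::nat. density P W" by unfold_locales
  have WP: "W \<in> borel_measurable P" using W P by (simp cong: measurable_cong_sets)
  have [measurable]: "(\<lambda>X. W (X i)) \<in> borel_measurable (Pi\<^sub>M {..<n} (\<lambda>_. P))" if "i < n" for i
    using that by (intro measurable_compose[OF _ WP] measurable_component_singleton) simp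
  show ?thesis unfolding iid_def
  proof (rule Q.PiM_eqI[symmetric])
    show "sets (density (Pi\<^sub>M {..<n} (\<lambda>_. P)) (\<lambda>X. ennreal (\<Prod>i<n. W (X i)))) = sets (Pi\<^sub>M {..<n} (\<lambda>_. density P W))"
      unfolding sets_density by (intro sets_PiM_cong refl) simp
    fix A assume A: "\<And>i. i \<in> {..<n} \<Longrightarrow> A i \<in> sets (density P W)"
    then have [measurable]: "\<And>i. i < n \<Longrightarrow> A i \<in> sets P" by simp
    have "emeasure (density (Pi\<^sub>M {..<n} (\<lambda>_. P)) (\<lambda>X. ennreal (\<Prod>i<n. W (X i)))) (Pi\<^sub>E {..<n} A) =
       (\<integral>\<^sup>+X. ennreal (\<Prod>i<n. W (X i)) * indicator (Pi\<^sub>E {..<n} A) X \<partial>Pi\<^sub>M {..<n} (\<lambda>_. P))"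
      by (intro emeasure_density sets_PiM_I_finite) measurable
    also have "\<dots> = (\<integral>\<^sup>+X. (\<Prod>i<n. ennreal (W (X i)) * indicator (A i) (X i)) \<partial>Pi\<^sub>M {..<n} (\<lambda>_. P))"
    proof (intro nn_integral_cong)
      fix X assume "X \<in> space (Pi\<^sub>M {..<n} (\<lambda>_. P))"
      then have "indicator (Pi\<^sub>E {..<n} A) X = (\<Prod>i<n. indicator (A i) (X i) :: ennreal)"
        by (auto simp: indicator_def space_PiM PiE_iff prod_eq_1_iff intro!: prod_zero[symmetric] bexI)
      then show "ennreal (\<Prod>i<n. W (X i)) * indicator (Pi\<^sub>E {..<n} A) X = (\<Prod>i<n. ennreal (W (X i)) * indicator (A i) (X i))"
        using W by (simp add: prod.distrib prod_ennreal)
    qed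
    also have "\<dots> = (\<Prod>i<n. \<integral>\<^sup>+x. ennreal (W x) * indicator (A i) x \<partial>P)"
      by (rule P.product_nn_integral_prod) (use WP in auto)
    also have "\<dots> = (\<Prod>i<n. emeasure (density P W) (A i))"
      by (intro prod.cong refl) (use WP in \<open>simp add: emeasure_density\<close>)
    finally show "emeasure (density (Pi\<^sub>M {..<n} (\<lambda>_. P)) (\<lambda>X. ennreal (\<Prod>i<n. W (X i)))) (Pi\<^sub>E {..<n} A) = (\<Prod>i<n. emeasure (density P W) (A i))" .
  qed simp
qed

text \<open>The chi-square divergence of the product measures is \<open>E W\<^sup>2 ^ n - 1\<close>; by \<open>ab \<le> a\<^sup>2/4 + b\<^sup>2\<close> it bounds
  the difference of the rejection probabilities under the two hypotheses.\<close>

lemma not_distinguishes: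
  fixes W :: "real \<Rightarrow> real"
  assumes P: "prob_space P" "sets P = sets borel" and W[measurable]: "W \<in> borel_measurable borel" "\<And>x. 0 \<le> W x"
    and Q: "prob_space (density P W)" and W1: "integrable P W" "(\<integral>x. W x \<partial>P) = 1"
    and W2: "integrable P (\<lambda>x. (W x)\<^sup>2)" "(\<integral>x. (W x)\<^sup>2 \<partial>P) ^ n < 5 / 4"
    and T: "T \<in> DP_tests \<epsilon>"
  shows "\<not> distinguishes T P (density P W) n"
proof
  assume dist: "distinguishes T P (density P W) n"
  interpret X: prob_space "iid n P" by (rule prob_space_iid[OF P(1)])
  have iid: "iid n P \<in> space (prob_algebra (datasets n))" using P by (rule iid_in_prob_algebra)
  have iidQ: "iid n (density P W) \<in> space (prob_algebra (datasets n))" using P Q by (intro iid_in_prob_algebra) auto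
  have mT: "T n \<in> datasets n \<rightarrow>\<^sub>M prob_algebra (count_space {0, 1})" using T by (auto simp: DP_tests_def DP_def)
  define \<phi> where "\<phi> X = measure (T n X) {1}" for X
  define L where "L X = (\<Prod>i<n. W (X i))" for X
  have E: "{1::nat} \<in> sets (count_space {0, 1})" "{0::nat} \<in> sets (count_space {0, 1})" by auto
  note bP = measure_bind_prob[OF iid mT E(1), folded \<phi>_def]
  note bQ = measure_bind_prob[OF iidQ mT E(1), folded \<phi>_def]
  have spX: "space (iid n P) = space (datasets n)" using sets_iid[OF P(2)] by (rule sets_eq_imp_space_eq)
  have \<phi>01: "0 \<le> \<phi> X" "\<phi> X \<le> 1" if "X \<in> space (datasets n)" for X
  proof -
    have "prob_space (T n X)" using measurable_space[OF mT that] by (simp add: space_prob_algebra)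
    then show "0 \<le> \<phi> X" "\<phi> X \<le> 1" by (auto simp: \<phi>_def prob_space.prob_le_1)
  qed
  have L: "integrable (iid n P) L" "(\<integral>X. L X \<partial>iid n P) = 1"
    using iid_prod[OF P(1), of "{..<n}" n "\<lambda>_. W"] W1 by (simp_all add: L_def[abs_def])
  have L2: "integrable (iid n P) (\<lambda>X. (L X)\<^sup>2)" "(\<integral>X. (L X)\<^sup>2 \<partial>iid n P) = (\<integral>x. (W x)\<^sup>2 \<partial>P) ^ n"
    using iid_prod[OF P(1), of "{..<n}" n "\<lambda>_ x. (W x)\<^sup>2"] W2 by (simp_all add: L_def[abs_def] prod_power_distrib)
  have \<phi>m: "\<phi> \<in> borel_measurable (iid n P)" using bP(2) sets_iid[OF P(2)] by (simp cong: measurable_cong_sets)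
  have Lm: "L \<in> borel_measurable (iid n P)" using L(1) by (rule borel_measurable_integrable)
  have L0: "0 \<le> L X" for X using W(2) by (auto simp: L_def intro: prod_nonneg)
  have "iid n (density P W) = density (iid n P) L" using iid_density[OF P W Q] by (simp add: L_def[abs_def])
  then have EQ: "measure (iid n (density P W) \<bind> T n) {1} = (\<integral>X. L X * \<phi> X \<partial>iid n P)"
    using bQ(1) integral_density[OF \<phi>m Lm] L0 by simp
  have iL\<phi>: "integrable (iid n P) (\<lambda>X. L X * \<phi> X)"
    by (rule Bochner_Integration.integrable_bound[OF L(1)])
       (use \<phi>m Lm \<phi>01 L0 spX in \<open>auto intro!: AE_I2 simp: abs_mult mult_left_le\<close>)
  have bound: "L X * \<phi> X - \<phi> X \<le> 1/4 + ((L X)\<^sup>2 - 2 * L X + 1)" if "X \<in> space (iid n P)" for X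
  proof -
    have "0 \<le> (\<phi> X / 2 - (L X - 1))\<^sup>2" by simp
    then have "L X * \<phi> X - \<phi> X \<le> (\<phi> X)\<^sup>2 / 4 + ((L X)\<^sup>2 - 2 * L X + 1)" by (simp add: power2_eq_square algebra_simps)
    moreover have "(\<phi> X)\<^sup>2 \<le> 1" using \<phi>01[of X] that spX by (simp add: power_le_one)
    ultimately show ?thesis by simp
  qed
  have "(\<integral>X. L X * \<phi> X - \<phi> X \<partial>iid n P) \<le> (\<integral>X. 1/4 + ((L X)\<^sup>2 - 2 * L X + 1) \<partial>iid n P)"
    by (intro integral_mono bound Bochner_Integration.integrable_diff Bochner_Integration.integrable_add iL\<phi> bP(3) L2(1) integrable_mult_right L(1) X.integrable_const)
  also have "\<dots> = 1/4 + ((\<integral>x. (W x)\<^sup>2 \<partial>P) ^ n - 1)"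
    using L L2 X.prob_space by simp
  \<comment> \<open>The threshold 5/4 makes the sum smaller than 1/4 + 1/4, while a distinguishing
    test needs a difference of at least 3/4 - 1/4.\<close>
  finally have "(\<integral>X. L X * \<phi> X \<partial>iid n P) - (\<integral>X. \<phi> X \<partial>iid n P) < 1/2"
    using W2(2) iL\<phi> bP(3) by simp
  moreover have "3/4 \<le> (\<integral>X. L X * \<phi> X \<partial>iid n P)" using dist EQ by (simp add: distinguishes_def)
  moreover have "(\<integral>X. \<phi> X \<partial>iid n P) \<le> 1/4"
  proof -
    have B: "iid n P \<bind> T n \<in> space (prob_algebra (count_space {0, 1}))" by (rule bind_in_prob_algebra[OF iid mT])
    then interpret B: prob_space "iid n P \<bind> T n" by (simp add: space_prob_algebra)
    have "B.prob ({0} \<union> {1}) = B.prob {0} + B.prob {1}"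
      using B by (intro B.finite_measure_Union) (auto simp: space_prob_algebra)
    then show ?thesis using B.prob_le_1[of "{0} \<union> {1}"] dist bP(1) by (simp add: distinguishes_def)
  qed
  ultimately show False by simp
qed

text \<open>The sample complexity asks for success at every size from a threshold on, so failure at
  n rules out all thresholds up to n.\<close>

lemma SC_gt:
  assumes "\<And>T. T \<in> DP_tests \<epsilon> \<Longrightarrow> \<not> distinguishes T P Q n"
  shows "SC \<epsilon> P Q > enat n"
proof -
  have "enat (Suc n) \<le> SC \<epsilon> P Q" unfolding SC_def
  proof (rule Inf_greatest)
    fix x assume "x \<in> {enat n |n. \<exists>T\<in>DP_tests \<epsilon>. \<forall>N\<ge>n. distinguishes T P Q N}"
    then obtain m T where "x = enat m" "T \<in> DP_tests \<epsilon>" "\<forall>N\<ge>m. distinguishes T P Q N" by auto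
    then show "enat (Suc n) \<le> x" using assms[of T] by (auto simp: not_less_eq_eq[symmetric])
  qed
  then show ?thesis by (metis enat_ord_simps(2) lessI less_le_trans)
qed

text \<open>The second moment of the likelihood ratio of n records is at most
  \<open>exp (n * (V * h\<^sup>2))\<close>, and \<open>exp (1/8) \<le> 8/7 < 5/4\<close>. The
  interval is twice as long as the shift because the chi-square exponent is a second difference
  reaching \<theta> + 2h.\<close>

lemma (in exp_family) modulus_ge:
  assumes h: "0 \<le> h" and I: "\<And>s. s \<in> {\<theta>..\<theta> + 2 * h} \<Longrightarrow> s \<in> interior \<Phi> \<and> log_partition'' \<mu> s \<le> V"
    and n: "real n * (V * h\<^sup>2) \<le> 1 / 8"
  shows "ereal h \<le> modulus \<mu> n \<epsilon> \<theta>"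
proof -
  define W where "W x = exp (h * x - (A (\<theta> + h) - A \<theta>))" for x
  have \<theta>: "\<theta> \<in> \<Phi>" "\<theta> + h \<in> \<Phi>" "\<theta> + 2 * h \<in> \<Phi>" using I h interiorD by auto
  have [measurable]: "W \<in> borel_measurable borel" unfolding W_def by measurable
  have W_nonneg: "0 \<le> W x" for x by (simp add: W_def)
  have Q: "P (\<theta> + h) = density (P \<theta>) W" using P_change[OF \<theta>(1), of "\<theta> + h"] by (simp add: W_def[abs_def])
  note chi = chi_square[OF \<theta>, folded W_def]
  have "(\<integral>x. (W x)\<^sup>2 \<partial>P \<theta>) \<le> exp (V * h\<^sup>2)" unfolding chi(4)
    using second_difference_le[of \<theta> h V] I h by (simp add: min_def max_def)
  then have "(\<integral>x. (W x)\<^sup>2 \<partial>P \<theta>) ^ n \<le> exp (V * h\<^sup>2) ^ n" by (intro power_mono) auto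
  also have "\<dots> = exp (real n * (V * h\<^sup>2))" by (simp add: exp_of_nat_mult)
  also have "\<dots> \<le> exp (1/8)" using n by simp
  also have "\<dots> < 5/4"
  proof -
    have "1 + - (1/8::real) \<le> exp (- (1/8))" by (rule exp_ge_add_one_self)
    then have "exp (1/8::real) \<le> 8/7" by (simp add: exp_minus field_simps)
    then show ?thesis by simp
  qed
  finally have W2: "(\<integral>x. (W x)\<^sup>2 \<partial>P \<theta>) ^ n < 5 / 4" .
  have "SC \<epsilon> (P \<theta>) (P (\<theta> + h)) > enat n"
  proof (rule SC_gt)
    fix T assume T: "T \<in> DP_tests \<epsilon>"
    show "\<not> distinguishes T (P \<theta>) (P (\<theta> + h)) n" unfolding Q
      by (rule not_distinguishes[OF prob_space_P[OF \<theta>(1)] _ _ _ _ chi(1,2,3) W2 T])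
         (use prob_space_P[OF \<theta>(2)] Q in \<open>simp_all add: W_nonneg\<close>)
  qed
  then show ?thesis unfolding modulus_def using h \<theta> by (intro Sup_upper) (auto intro!: exI[of _ "\<theta> + h"])
qed

section \<open>Accuracy of the clipped likelihood estimator\<close>

text \<open>The removed part vanishes unless \<open>\<bar>u\<bar>\<close> exceeds \<open>B\<close>,
  and then one factor \<open>\<bar>u\<bar> / B\<close> can be afforded. Its mean is thus controlled
  by a second moment (\<open>clip_bias\<close>) and its mean square by a fourth moment
  (\<open>G_increment\<close>).\<close>

lemma abs_minus_clip_le:
  assumes "0 < B" shows "\<bar>u - clip (- B) B u\<bar> \<le> u\<^sup>2 / B"
proof (cases "\<bar>u\<bar> \<le> B")
  case True
  then have "clip (- B) B u = u" by (auto simp: clip_def min_def max_def)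
  then show ?thesis using assms by simp
next
  case False
  then have "\<bar>u - clip (- B) B u\<bar> \<le> \<bar>u\<bar>" using assms by (auto simp: clip_def min_def max_def)
  also have "\<bar>u\<bar> * B \<le> \<bar>u\<bar> * \<bar>u\<bar>" using False by (intro mult_left_mono) auto
  then have "\<bar>u\<bar> \<le> u\<^sup>2 / B" using assms by (simp add: field_simps power2_eq_square)
  finally show ?thesis .
qed

lemma power4_add_le: "(a + b) ^ 4 \<le> 8 * a ^ 4 + 8 * (b::real) ^ 4"
proof -
  have 2: "(x + y)\<^sup>2 \<le> 2 * x\<^sup>2 + 2 * y\<^sup>2" for x y :: real
    using zero_le_power2[of "x - y"] by (simp add: power2_eq_square algebra_simps)
  have "(a + b) ^ 4 = ((a + b)\<^sup>2)\<^sup>2" by simp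
  also have "\<dots> \<le> (2 * a\<^sup>2 + 2 * b\<^sup>2)\<^sup>2" using 2 by (intro power_mono) auto
  also have "\<dots> \<le> 2 * (2 * a\<^sup>2)\<^sup>2 + 2 * (2 * b\<^sup>2)\<^sup>2" by (rule 2)
  finally show ?thesis by (simp add: power_mult_distrib)
qed

lemma clip_average_measurable:
  "(\<lambda>X. \<Sum>j<n. clip (- B) B (X j - t)) \<in> borel_measurable (datasets n)"
  by (intro borel_measurable_sum clip_measurable borel_measurable_diff borel_measurable_const datasets_component) simp

lemma exp_minus_5_le: "exp (- 5) \<le> (1::real) / 32"
proof -
  have "(2::real) ^ 5 \<le> exp 1 ^ 5" by (intro power_mono) (use exp_ge_add_one_self[of 1] in auto)
  then have "32 \<le> exp (5::real)" by (simp flip: exp_of_nat_mult)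
  then show ?thesis by (simp add: exp_minus field_simps)
qed

text \<open>The source of the factor 5 in front of every noise scale below: the tail beyond it has
  mass \<open>exp (- 5) \<le> 1 / 32\<close>.\<close>

lemma laplace_concentrated:
  assumes b: "0 < b" and E: "E \<in> sets borel" "\<And>z. \<bar>z\<bar> \<le> 5 * b \<Longrightarrow> z \<in> E"
  shows "31 / 32 \<le> measure (laplace b) E"
proof -
  interpret L: prob_space "laplace b" by (rule prob_space_laplace[OF b])
  have "L.prob {z. 5 * b < \<bar>z\<bar>} = exp (- 5)" using laplace_tail[OF b, of "5 * b"] b by simp
  moreover have "L.prob (UNIV - {z. 5 * b < \<bar>z\<bar>}) = 1 - L.prob {z. 5 * b < \<bar>z\<bar>}"
    using L.prob_compl[of "{z. 5 * b < \<bar>z\<bar>}"] by simp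
  ultimately have "31 / 32 \<le> L.prob (UNIV - {z. 5 * b < \<bar>z\<bar>})" using exp_minus_5_le by simp
  also have "\<dots> \<le> L.prob E" by (rule L.finite_measure_mono) (use E in \<open>auto, meson not_less\<close>)
  finally show ?thesis .
qed

context exp_family
begin

text \<open>The radius \<open>r\<close> has to be strictly smaller because \<open>kappa\<close> is a
  supremum that need not be attained.\<close>

lemma kappaD:
  assumes k: "ereal \<rho> \<le> kappa \<mu> \<theta>" and r: "r < \<rho>" and s: "s \<in> {\<theta> - r..\<theta> + r}"
  shows "s \<in> interior \<Phi>" "log_partition'' \<mu> \<theta> / 2 \<le> log_partition'' \<mu> s" "log_partition'' \<mu> s \<le> 2 * log_partition'' \<mu> \<theta>"
proof -
  have "ereal r < kappa \<mu> \<theta>" using k r by (metis ereal_less_eq(3) less_le_trans less_ereal.simps(1))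
  then obtain r' where r': "r < r'" "{\<theta> - r'..\<theta> + r'} \<subseteq> interior \<Phi>"
     "\<And>\<theta>'. \<theta>' \<in> {\<theta> - r'..\<theta> + r'} \<Longrightarrow> log_partition'' \<mu> \<theta> / log_partition'' \<mu> \<theta>' \<in> {1/2..2}"
    unfolding kappa_def less_Sup_iff by auto
  have s': "s \<in> {\<theta> - r'..\<theta> + r'}" using s r'(1) by auto
  then show sI: "s \<in> interior \<Phi>" using r'(2) by blast
  have "0 < log_partition'' \<mu> s" by (rule A''_pos[OF sI])
  then show "log_partition'' \<mu> \<theta> / 2 \<le> log_partition'' \<mu> s" "log_partition'' \<mu> s \<le> 2 * log_partition'' \<mu> \<theta>"
    using r'(3)[OF s'] by (auto simp: field_simps)
qed

lemma A'_increment: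
  assumes I: "\<And>s. s \<in> {a..b} \<Longrightarrow> s \<in> interior \<Phi> \<and> L \<le> log_partition'' \<mu> s" and ab: "a \<le> b"
  shows "L * (b - a) \<le> log_partition' \<mu> b - log_partition' \<mu> a"
proof (cases "a = b")
  case False
  then have "a < b" using ab by simp
  then have "\<exists>z. a < z \<and> z < b \<and> log_partition' \<mu> b - log_partition' \<mu> a = (b - a) * log_partition'' \<mu> z"
    by (rule MVT2) (use I in \<open>auto intro!: A'_has_deriv\<close>)
  then obtain z where z: "a < z" "z < b" "log_partition' \<mu> b - log_partition' \<mu> a = (b - a) * log_partition'' \<mu> z" by blast
  have "L * (b - a) \<le> log_partition'' \<mu> z * (b - a)" using I[of z] z by (intro mult_right_mono) auto
  then show ?thesis using z(3) by (simp add: mult.commute)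
qed simp

text \<open>On each side of \<theta> the derivative moves by at least \<open>L * r\<close>, so the
  intermediate value theorem finds a preimage of \<open>t\<close> in the interval. This puts
  \<open>nCLLRE\<close> in its regular case and locates the parameter at which
  \<open>alpha_tilde\<close> evaluates the variance.\<close>

lemma near_mean_attained:
  assumes I: "\<And>s. s \<in> {\<theta> - r..\<theta> + r} \<Longrightarrow> s \<in> interior \<Phi> \<and> L \<le> log_partition'' \<mu> s" and r: "0 \<le> r"
    and t: "\<bar>t - log_partition' \<mu> \<theta>\<bar> \<le> L * r"
  shows "t \<in> I" "A'inv t \<in> {\<theta> - r..\<theta> + r}"
proof -
  have "log_partition' \<mu> (\<theta> - r) \<le> t" "t \<le> log_partition' \<mu> (\<theta> + r)"
    using A'_increment[of "\<theta> - r" \<theta> L] A'_increment[of \<theta> "\<theta> + r" L] I r t by auto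
  moreover have "continuous_on {\<theta> - r..\<theta> + r} (log_partition' \<mu>)"
    by (intro DERIV_continuous_on[where D="log_partition'' \<mu>"]) (use I in \<open>auto intro: has_field_derivative_at_within A'_has_deriv\<close>)
  ultimately obtain s where s: "\<theta> - r \<le> s" "s \<le> \<theta> + r" "log_partition' \<mu> s = t"
    using IVT'[of "log_partition' \<mu>" "\<theta> - r" t "\<theta> + r"] r by auto
  then have sI: "s \<in> interior \<Phi>" using I by auto
  show "t \<in> I" using s(3) sI by blast
  have "A'inv t = s" using the_inv_into_f_f[OF A'_inj sI] s(3) by simp
  then show "A'inv t \<in> {\<theta> - r..\<theta> + r}" using s by simp
qed

text \<open>The strict inequality between the end points excludes the constant case of
  \<open>G_dichotomy\<close>. Hence \<open>G\<close> is strictly increasing on all of \<Phi>, the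
  value \<open>y\<close> is attained within distance \<open>h\<close>, and no minimizer can lie
  further away.\<close>

lemma \<Theta>_near:
  assumes n: "0 < n" "0 < C" "0 < \<epsilon>" and h: "\<theta> - h \<in> \<Phi>" "\<theta> + h \<in> \<Phi>" "0 \<le> h"
    and y: "G n C \<epsilon> t (\<theta> - h) \<le> y" "y \<le> G n C \<epsilon> t (\<theta> + h)" and lt: "G n C \<epsilon> t (\<theta> - h) < G n C \<epsilon> t (\<theta> + h)"
  shows "\<bar>\<Theta> n C \<epsilon> t y - \<theta>\<bar> \<le> h"
proof -
  have strict: "G n C \<epsilon> t a < G n C \<epsilon> t b" if "a \<in> \<Phi>" "b \<in> \<Phi>" "a < b" for a b
    using G_dichotomy[OF n] that lt h by (metis order_less_irrefl)
  obtain s where s: "\<theta> - h \<le> s" "s \<le> \<theta> + h" "G n C \<epsilon> t s = y"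
    using IVT'[OF y _ G_continuous[OF n h(1,2)]] h(3) by auto
  have s\<Phi>: "s \<in> \<Phi>" using Phi_interval[OF h(1,2) s(1,2)] .
  have "is_arg_min (\<lambda>\<theta>. \<bar>y - G n C \<epsilon> t \<theta>\<bar>) (\<lambda>\<theta>. \<theta> \<in> \<Phi>) s" using s s\<Phi> by (simp add: is_arg_min_linear)
  then have "is_arg_min (\<lambda>\<theta>. \<bar>y - G n C \<epsilon> t \<theta>\<bar>) (\<lambda>\<theta>. \<theta> \<in> \<Phi>) (\<Theta> n C \<epsilon> t y)"
    unfolding \<Theta>_def arg_min_def by (rule someI)
  then have "\<Theta> n C \<epsilon> t y \<in> \<Phi>" "\<bar>y - G n C \<epsilon> t (\<Theta> n C \<epsilon> t y)\<bar> \<le> \<bar>y - G n C \<epsilon> t s\<bar>"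
    using s\<Phi> unfolding is_arg_min_linear by auto
  then have "\<Theta> n C \<epsilon> t y \<in> \<Phi>" "G n C \<epsilon> t (\<Theta> n C \<epsilon> t y) = y" using s by auto
  then have "\<not> \<Theta> n C \<epsilon> t y < \<theta> - h" "\<not> \<theta> + h < \<Theta> n C \<epsilon> t y" using strict h y by (metis linorder_not_less)+
  then show ?thesis by linarith
qed

text \<open>Writing \<open>x - t = \<phi> x + \<psi> x\<close> with \<open>\<phi>\<close> the clipped part and \<open>W\<close> for the likelihood ratio, clipping changes the
  increment of the mean by \<open>E[(W - 1) * \<psi>]\<close>, which the arithmetic-geometric mean inequality splits into the
  chi-square divergence and a tail term controlled by the fourth moment.\<close>

lemma G_increment:
  assumes n: "0 < n" "0 < C" "0 < \<epsilon>" and S: "S = log_partition'' \<mu> \<theta>" and h: "0 < h" "\<bar>s\<bar> = h"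
    and I: "\<And>x. x \<in> {\<theta> - 2 * h..\<theta> + 2 * h} \<Longrightarrow> x \<in> interior \<Phi> \<and> log_partition'' \<mu> x \<le> 2 * S"
    and hS: "2 * S * h\<^sup>2 \<le> 1"
    and m4: "(\<integral>x. (x - t) ^ 4 \<partial>P \<theta>) \<le> K * S\<^sup>2" and B: "64 * K * S \<le> (\<epsilon> / (C * atl n t))\<^sup>2"
  shows "\<bar>(G n C \<epsilon> t (\<theta> + s) - G n C \<epsilon> t \<theta>) - (log_partition' \<mu> (\<theta> + s) - log_partition' \<mu> \<theta>)\<bar> \<le> h * S / 4"
proof -
  define B where "B = \<epsilon> / (C * atl n t)"
  have Bpos: "0 < B" unfolding B_def using n atl_pos by simp
  define W where "W x = exp (s * x - (A (\<theta> + s) - A \<theta>))" for x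
  have Wnn: "0 \<le> W x" for x by (simp add: W_def)
  define \<phi> where "\<phi> x = clip (- B) B (x - t)" for x
  define \<psi> where "\<psi> x = x - t - \<phi> x" for x
  have m[measurable]: "W \<in> borel_measurable borel" "\<phi> \<in> borel_measurable borel" "\<psi> \<in> borel_measurable borel"
    unfolding W_def \<phi>_def \<psi>_def by measurable
  have int: "\<theta> \<in> interior \<Phi>" "\<theta> + s \<in> interior \<Phi>" "\<theta> + 2 * s \<in> interior \<Phi>"
    using I h by (auto simp: abs_if split: if_splits)
  note \<theta> = int[THEN interiorD]
  have Spos: "0 < S" unfolding S by (rule A''_pos[OF int(1)])
  interpret prob_space "P \<theta>" by (rule prob_space_P[OF \<theta>(1)])
  have pU: "prob UNIV = 1" using prob_space by simp
  note chi = chi_square[OF \<theta>, folded W_def]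
  have Pd: "P (\<theta> + s) = density (P \<theta>) W" using P_change[OF \<theta>(1), of "\<theta> + s"] by (simp add: W_def[abs_def])
  have tr: "integrable (P \<theta>) (\<lambda>x. W x * f x)" "(\<integral>x. f x \<partial>P (\<theta> + s)) = (\<integral>x. W x * f x \<partial>P \<theta>)"
    if [measurable]: "f \<in> borel_measurable borel" and f: "integrable (P (\<theta> + s)) f" for f :: "real \<Rightarrow> real"
    using f Wnn unfolding Pd by (simp_all add: integrable_density integral_density)
  have \<phi>B: "\<bar>\<phi> x\<bar> \<le> B" for x unfolding \<phi>_def using Bpos by (intro abs_clip_le) simp
  have i\<phi>: "integrable (P \<theta>) \<phi>" "integrable (P (\<theta> + s)) \<phi>"
    using integrable_bounded_P[OF \<theta>(1) m(2) \<phi>B] integrable_bounded_P[OF \<theta>(2) m(2) \<phi>B] by blast+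
  have ix: "integrable (P \<theta>) (\<lambda>x. x)" "integrable (P (\<theta> + s)) (\<lambda>x. x)"
    using integrable_power[OF int(1), of 1] integrable_power[OF int(2), of 1] by simp_all
  have mx: "(\<lambda>x::real. x) \<in> borel_measurable borel" by simp
  note tr\<phi> = tr[OF m(2) i\<phi>(2)] and trx = tr[OF mx ix(2)]
  have i\<psi>: "integrable (P \<theta>) \<psi>" unfolding \<psi>_def[abs_def]
    by (intro Bochner_Integration.integrable_diff ix i\<phi> integrable_const)
  have iW\<psi>: "integrable (P \<theta>) (\<lambda>x. (W x - 1) * \<psi> x)" and
    E: "(\<integral>x. (W x - 1) * \<psi> x \<partial>P \<theta>) = (log_partition' \<mu> (\<theta> + s) - log_partition' \<mu> \<theta>) - (G n C \<epsilon> t (\<theta> + s) - G n C \<epsilon> t \<theta>)"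
  proof -
    have eq: "(\<lambda>x. (W x - 1) * \<psi> x) = (\<lambda>x. (W x * x - x) - (W x * \<phi> x - \<phi> x) - (t * W x - t))"
      by (auto simp: \<psi>_def algebra_simps)
    have i: "integrable (P \<theta>) (\<lambda>x. W x * x - x)" "integrable (P \<theta>) (\<lambda>x. W x * \<phi> x - \<phi> x)" "integrable (P \<theta>) (\<lambda>x. t * W x - t)"
      using trx(1) tr\<phi>(1) ix i\<phi> chi(1) by simp_all
    show "integrable (P \<theta>) (\<lambda>x. (W x - 1) * \<psi> x)" unfolding eq by (intro Bochner_Integration.integrable_diff i)
    have "(\<integral>x. (W x - 1) * \<psi> x \<partial>P \<theta>) = (\<integral>x. W x * x - x \<partial>P \<theta>) - (\<integral>x. W x * \<phi> x - \<phi> x \<partial>P \<theta>) - (\<integral>x. t * W x - t \<partial>P \<theta>)"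
      unfolding eq Bochner_Integration.integral_diff[OF Bochner_Integration.integrable_diff[OF i(1,2)] i(3)]
        Bochner_Integration.integral_diff[OF i(1,2)] ..
    also have "(\<integral>x. t * W x - t \<partial>P \<theta>) = 0" using chi(1,2) pU by simp
    also have "(\<integral>x. W x * x - x \<partial>P \<theta>) = log_partition' \<mu> (\<theta> + s) - log_partition' \<mu> \<theta>"
      using trx ix by (simp add: mean_P[OF int(1)] flip: mean_P[OF int(2)])
    also have "(\<integral>x. W x * \<phi> x - \<phi> x \<partial>P \<theta>) = G n C \<epsilon> t (\<theta> + s) - G n C \<epsilon> t \<theta>"
      using tr\<phi> i\<phi> unfolding G_def B_def[symmetric] \<phi>_def[symmetric] by simp
    finally show "(\<integral>x. (W x - 1) * \<psi> x \<partial>P \<theta>) = (log_partition' \<mu> (\<theta> + s) - log_partition' \<mu> \<theta>) - (G n C \<epsilon> t (\<theta> + s) - G n C \<epsilon> t \<theta>)"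
      by simp
  qed
  have i4: "integrable (P \<theta>) (\<lambda>x. (x - t) ^ 4)" by (rule integrable_power_minus[OF int(1)])
  have \<psi>2: "(\<psi> x)\<^sup>2 \<le> (x - t) ^ 4 / B\<^sup>2" for x
  proof -
    have "(\<psi> x)\<^sup>2 = \<bar>\<psi> x\<bar>\<^sup>2" by simp
    also have "\<dots> \<le> ((x - t)\<^sup>2 / B)\<^sup>2"
      using abs_minus_clip_le[OF Bpos, of "x - t"] by (intro power_mono) (auto simp: \<psi>_def \<phi>_def)
    finally show ?thesis by (simp add: power_divide)
  qed
  have i\<psi>2: "integrable (P \<theta>) (\<lambda>x. (\<psi> x)\<^sup>2)"
    by (rule Bochner_Integration.integrable_bound[OF integrable_divide[OF i4, of "B\<^sup>2"]]) (use \<psi>2 in auto)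
  have "(\<integral>x. (\<psi> x)\<^sup>2 \<partial>P \<theta>) \<le> (\<integral>x. (x - t) ^ 4 / B\<^sup>2 \<partial>P \<theta>)"
    by (intro integral_mono i\<psi>2 integrable_divide i4 \<psi>2)
  also have "\<dots> = (\<integral>x. (x - t) ^ 4 \<partial>P \<theta>) / B\<^sup>2" by (rule integral_divide_zero)
  also have "\<dots> \<le> K * S\<^sup>2 / B\<^sup>2" by (intro divide_right_mono m4) simp
  also have "\<dots> \<le> S / 64"
  proof -
    have "64 * K * S * S \<le> B\<^sup>2 * S" using B Spos unfolding B_def by (intro mult_right_mono) auto
    then show ?thesis using Bpos by (simp add: divide_le_eq power2_eq_square mult_ac)
  qed
  finally have E\<psi>2: "(\<integral>x. (\<psi> x)\<^sup>2 \<partial>P \<theta>) \<le> S / 64" .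
  have W1: "integrable (P \<theta>) (\<lambda>x. (W x - 1)\<^sup>2)" "(\<integral>x. (W x - 1)\<^sup>2 \<partial>P \<theta>) \<le> 4 * S * h\<^sup>2"
  proof -
    have eq: "(\<lambda>x. (W x - 1)\<^sup>2) = (\<lambda>x. (W x)\<^sup>2 - 2 * W x + 1)" by (auto simp: power2_eq_square algebra_simps)
    show "integrable (P \<theta>) (\<lambda>x. (W x - 1)\<^sup>2)" unfolding eq using chi by simp
    have c2: "A (\<theta> + 2 * s) - 2 * A (\<theta> + s) + A \<theta> \<le> 2 * S * h\<^sup>2"
    proof -
      have "A (\<theta> + 2 * s) - 2 * A (\<theta> + s) + A \<theta> \<le> 2 * S * s\<^sup>2"
        by (rule second_difference_le, rule I) (use h in \<open>auto simp: abs_if min_def max_def split: if_splits\<close>)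
      also have "s\<^sup>2 = h\<^sup>2" using h by auto
      finally show ?thesis .
    qed
    have "(\<integral>x. (W x - 1)\<^sup>2 \<partial>P \<theta>) = exp (A (\<theta> + 2 * s) - 2 * A (\<theta> + s) + A \<theta>) - 1"
      unfolding eq using chi pU by simp
    also have "\<dots> \<le> exp (2 * S * h\<^sup>2) - 1" using c2 by simp
    \<comment> \<open>For u = \<open>2 * S * h\<^sup>2\<close> in [0,1]: exp u - 1 \<le> u + u^2
      \<le> 2u.\<close>
    also have "\<dots> \<le> 2 * S * h\<^sup>2 + (2 * S * h\<^sup>2)\<^sup>2"
      using exp_bound[of "2 * S * h\<^sup>2"] hS Spos by simp
    also have "(2 * S * h\<^sup>2)\<^sup>2 \<le> 2 * S * h\<^sup>2"
      using hS Spos mult_left_le[of "2 * S * h\<^sup>2" "2 * S * h\<^sup>2"] by (simp add: power2_eq_square)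
    finally show "(\<integral>x. (W x - 1)\<^sup>2 \<partial>P \<theta>) \<le> 4 * S * h\<^sup>2" by simp
  qed
  \<comment> \<open>The weight balances the two parts: the chi-square term contributes at most 4Sh^2
    / (32h) = hS/8 and the tail term 8h * S/64 = hS/8.\<close>
  have amgm: "\<bar>(W x - 1) * \<psi> x\<bar> \<le> (1 / (32 * h)) * (W x - 1)\<^sup>2 + 8 * h * (\<psi> x)\<^sup>2" for x
  proof -
    have "0 \<le> (\<bar>W x - 1\<bar> - 16 * h * \<bar>\<psi> x\<bar>)\<^sup>2" by simp
    then have "32 * h * (\<bar>W x - 1\<bar> * \<bar>\<psi> x\<bar>) \<le> (W x - 1)\<^sup>2 + 256 * h\<^sup>2 * (\<psi> x)\<^sup>2"
      by (simp add: power2_diff power_mult_distrib mult_ac)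
    then have "\<bar>W x - 1\<bar> * \<bar>\<psi> x\<bar> \<le> ((W x - 1)\<^sup>2 + 256 * h\<^sup>2 * (\<psi> x)\<^sup>2) / (32 * h)"
      using h by (simp add: pos_le_divide_eq mult_ac)
    also have "\<dots> = (1 / (32 * h)) * (W x - 1)\<^sup>2 + 8 * h * (\<psi> x)\<^sup>2"
      using h by (simp add: add_divide_distrib power2_eq_square)
    finally show ?thesis by (simp add: abs_mult)
  qed
  have "\<bar>\<integral>x. (W x - 1) * \<psi> x \<partial>P \<theta>\<bar> \<le> (\<integral>x. \<bar>(W x - 1) * \<psi> x\<bar> \<partial>P \<theta>)" by (rule integral_abs_bound)
  also have "\<dots> \<le> (\<integral>x. (1 / (32 * h)) * (W x - 1)\<^sup>2 + 8 * h * (\<psi> x)\<^sup>2 \<partial>P \<theta>)"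
    by (intro integral_mono amgm integrable_abs iW\<psi> Bochner_Integration.integrable_add integrable_mult_right W1 i\<psi>2)
  also have "\<dots> = (1 / (32 * h)) * (\<integral>x. (W x - 1)\<^sup>2 \<partial>P \<theta>) + 8 * h * (\<integral>x. (\<psi> x)\<^sup>2 \<partial>P \<theta>)"
    by (subst Bochner_Integration.integral_add; (intro integrable_mult_right W1 i\<psi>2)?; simp only: integral_mult_right_zero)
  also have "\<dots> \<le> (1 / (32 * h)) * (4 * S * h\<^sup>2) + 8 * h * (S / 64)"
    using h by (intro add_mono mult_left_mono W1 E\<psi>2) auto
  also have "\<dots> = h * S / 4" using h by (simp add: power2_eq_square)
  finally show ?thesis unfolding E by (simp add: abs_minus_commute)
qed

text \<open>The mean is the best constant approximation in mean square, so \<open>m\<close> may be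
  replaced by the clipped true mean; as clipping is 1-Lipschitz, the distances to it are at most
  those of the unclipped record to its mean.\<close>

lemma variance_clip_le:
  fixes t m :: real
  assumes \<theta>: "\<theta> \<in> interior \<Phi>" and B: "0 \<le> B"
  defines "\<phi> \<equiv> \<lambda>x. clip (- B) B (x - t)"
  shows "integrable (P \<theta>) \<phi>" "integrable (P \<theta>) (\<lambda>x. (\<phi> x - m)\<^sup>2)"
    "m = (\<integral>x. \<phi> x \<partial>P \<theta>) \<Longrightarrow> (\<integral>x. (\<phi> x - m)\<^sup>2 \<partial>P \<theta>) \<le> log_partition'' \<mu> \<theta>"
proof -
  have [measurable]: "\<phi> \<in> borel_measurable borel" unfolding \<phi>_def by measurable
  interpret prob_space "P \<theta>" by (rule prob_space_P[OF interiorD[OF \<theta>]])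
  have pU: "prob UNIV = 1" using prob_space by simp
  have bd: "\<bar>\<phi> x\<bar> \<le> B" for x unfolding \<phi>_def using B by (rule abs_clip_le)
  show i: "integrable (P \<theta>) \<phi>" by (rule integrable_bounded_P[OF interiorD[OF \<theta>] _ bd]) simp
  have i2: "integrable (P \<theta>) (\<lambda>x. (\<phi> x - a)\<^sup>2)" for a
  proof (rule integrable_const_bound[of _ "(B + \<bar>a\<bar>)\<^sup>2"])
    have "\<bar>\<phi> x - a\<bar>\<^sup>2 \<le> (B + \<bar>a\<bar>)\<^sup>2" for x by (intro power_mono) (use bd[of x] in auto)
    then show "AE x in P \<theta>. norm ((\<phi> x - a)\<^sup>2) \<le> (B + \<bar>a\<bar>)\<^sup>2" by simp
  qed measurable
  then show "integrable (P \<theta>) (\<lambda>x. (\<phi> x - m)\<^sup>2)" .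
  assume m: "m = (\<integral>x. \<phi> x \<partial>P \<theta>)"
  define c where "c = clip (- B) B (log_partition' \<mu> \<theta> - t)"
  have eq: "(\<lambda>x. (\<phi> x - m)\<^sup>2) = (\<lambda>x. (\<phi> x - c)\<^sup>2 - (2 * (m - c) * \<phi> x - (m\<^sup>2 - c\<^sup>2)))"
    by (auto simp: power2_eq_square algebra_simps)
  have i3: "integrable (P \<theta>) (\<lambda>x. 2 * (m - c) * \<phi> x - (m\<^sup>2 - c\<^sup>2))" using i by simp
  have "(\<integral>x. (\<phi> x - m)\<^sup>2 \<partial>P \<theta>) = (\<integral>x. (\<phi> x - c)\<^sup>2 \<partial>P \<theta>) - (\<integral>x. 2 * (m - c) * \<phi> x - (m\<^sup>2 - c\<^sup>2) \<partial>P \<theta>)"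
    unfolding eq by (rule Bochner_Integration.integral_diff[OF i2 i3])
  also have "(\<integral>x. 2 * (m - c) * \<phi> x - (m\<^sup>2 - c\<^sup>2) \<partial>P \<theta>) = 2 * (m - c) * m - (m\<^sup>2 - c\<^sup>2)"
    using i pU by (simp add: m)
  also have "\<dots> = (m - c)\<^sup>2" by (simp add: power2_eq_square algebra_simps)
  finally have "(\<integral>x. (\<phi> x - m)\<^sup>2 \<partial>P \<theta>) \<le> (\<integral>x. (\<phi> x - c)\<^sup>2 \<partial>P \<theta>)" by simp
  also have "\<dots> \<le> (\<integral>x. (x - log_partition' \<mu> \<theta>)\<^sup>2 \<partial>P \<theta>)"
  proof (intro integral_mono i2 integrable_power_minus \<theta>)
    fix x
    have "\<bar>\<phi> x - c\<bar> \<le> \<bar>x - log_partition' \<mu> \<theta>\<bar>"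
      unfolding \<phi>_def c_def using clip_lipschitz[of "- B" B "x - t" "log_partition' \<mu> \<theta> - t"] by simp
    then show "(\<phi> x - c)\<^sup>2 \<le> (x - log_partition' \<mu> \<theta>)\<^sup>2" by (simp add: abs_le_square_iff)
  qed
  also have "\<dots> = log_partition'' \<mu> \<theta>" by (rule variance_P[OF \<theta>])
  finally show "(\<integral>x. (\<phi> x - m)\<^sup>2 \<partial>P \<theta>) \<le> log_partition'' \<mu> \<theta>" .
qed

text \<open>Ten standard deviations in Chebyshev's inequality.\<close>

lemma clip_average_deviation:
  assumes \<theta>: "\<theta> \<in> interior \<Phi>" and n: "0 < n" and B: "0 \<le> B"
  shows "measure (iid n (P \<theta>)) {X \<in> space (iid n (P \<theta>)). 10 * sqrt (log_partition'' \<mu> \<theta>) / sqrt n \<le>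
    \<bar>(\<Sum>j<n. clip (- B) B (X j - t)) / n - (\<integral>x. clip (- B) B (x - t) \<partial>P \<theta>)\<bar>} \<le> 1 / 100"
proof -
  let ?S = "log_partition'' \<mu> \<theta>" and ?g = "\<integral>x. clip (- B) B (x - t) \<partial>P \<theta>" and ?d = "10 * sqrt (log_partition'' \<mu> \<theta>) / sqrt n"
  have Spos: "0 < ?S" by (rule A''_pos[OF \<theta>])
  then have dpos: "0 < ?d" using n by simp
  note var = variance_clip_le[OF \<theta> B, where t=t]
  have "measure (iid n (P \<theta>)) {X \<in> space (iid n (P \<theta>)). ?d \<le> \<bar>(\<Sum>j\<in>{..<n}. clip (- B) B (X j - t)) / card {..<n} - ?g\<bar>}
    \<le> ?S / (card {..<n} * ?d\<^sup>2)"
    by (rule iid_average_deviation[OF prob_space_P[OF interiorD[OF \<theta>]] _ _ _ var(1) refl var(2) var(3)[OF refl] dpos]) (use n in auto)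
  also have "\<dots> = 1 / 100" using Spos n by (simp add: power_divide power_mult_distrib)
  finally show ?thesis by simp
qed

text \<open>Over a step \<open>h\<close> the unclipped mean moves by at least hS/2 and clipping
  costs at most hS/4, so an error of hS/4 in the clipped mean is tolerable. The value of
  \<open>h\<close> makes hS/4 equal to the sampling error \<open>10 * sqrt S / sqrt n\<close> plus
  five noise scales. The last hypothesis puts the clipping level high enough for
  \<open>G_increment\<close>, given that the variance used by \<open>alpha_tilde\<close> is at least
  S/2.\<close>

lemma nCLLRE_accuracy:
  assumes n: "0 < n" "0 < C" "0 < \<epsilon>" and S: "S = log_partition'' \<mu> \<theta>" and r: "0 \<le> r"
    and I: "\<And>x. x \<in> {\<theta> - r..\<theta> + r} \<Longrightarrow> x \<in> interior \<Phi> \<and> S / 2 \<le> log_partition'' \<mu> x \<and> log_partition'' \<mu> x \<le> 2 * S"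
    and t: "\<bar>t - log_partition' \<mu> \<theta>\<bar> \<le> S / 2 * r"
    and h: "h = (40 + 60 / C) / (sqrt S * sqrt n)" "2 * h \<le> r" and hS: "2 * S * h\<^sup>2 \<le> 1"
    and m4: "(\<integral>x. (x - t) ^ 4 \<partial>P \<theta>) \<le> K * S\<^sup>2" and B: "128 * C\<^sup>2 * K \<le> \<epsilon>\<^sup>2 * n"
  shows "19 / 20 \<le> measure (iid n (P \<theta>) \<bind> (\<lambda>X. nCLLRE \<mu> n C \<epsilon> X t)) {\<theta>'. \<bar>\<theta>' - \<theta>\<bar> \<le> h}"
proof -
  have \<theta>: "\<theta> \<in> interior \<Phi>" using I[of \<theta>] r by simp
  have Spos: "0 < S" unfolding S by (rule A''_pos[OF \<theta>])
  have hpos: "0 < h" unfolding h(1) using Spos n by (simp add: add_pos_pos)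
  have "t \<in> I" and inv: "A'inv t \<in> {\<theta> - r..\<theta> + r}"
    using near_mean_attained[of \<theta> r "S/2" t] I r t by auto
  define V where "V = log_partition'' \<mu> (A'inv t)"
  have V: "S / 2 \<le> V" "V \<le> 2 * S" unfolding V_def using I[OF inv] by auto
  define a where "a = atl n t"
  have a: "a = 1 / sqrt (n * V)" unfolding a_def atl_def using \<open>t \<in> I\<close> by (simp add: alpha_tilde_def alpha_def V_def)
  have Vpos: "0 < V" using V Spos by simp
  have apos: "0 < a" using n Vpos by (simp add: a)
  define b where "b = 2 / (n * C * a)"
  have bpos: "0 < b" using n apos by (simp add: b_def)
  \<comment> \<open>From V \<le> 2S the exact constant would be 2 sqrt 2; it is rounded up to
    3.\<close>
  have b: "b \<le> 3 * sqrt S / (C * sqrt n)"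
  proof (rule power2_le_imp_le)
    have "b\<^sup>2 = 4 * V / (n * C\<^sup>2)" using n Vpos by (simp add: b_def a power_divide power_mult_distrib power2_eq_square)
    also have "\<dots> \<le> 9 * S / (n * C\<^sup>2)" using V Spos n by (intro divide_right_mono) auto
    also have "\<dots> = (3 * sqrt S / (C * sqrt n))\<^sup>2" using Spos n by (simp add: power_divide power_mult_distrib mult.commute)
    finally show "b\<^sup>2 \<le> (3 * sqrt S / (C * sqrt n))\<^sup>2" .
  qed (use Spos n in simp)
  have B': "64 * K * S \<le> (\<epsilon> / (C * atl n t))\<^sup>2"
  proof -
    have "64 * K * S = 128 * C\<^sup>2 * K * (S / (2 * C\<^sup>2))" using n by simp
    also have "\<dots> \<le> \<epsilon>\<^sup>2 * n * (S / (2 * C\<^sup>2))" using B Spos by (intro mult_right_mono) auto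
    also have "\<dots> = \<epsilon>\<^sup>2 * n / C\<^sup>2 * (S / 2)" by simp
    also have "\<dots> \<le> \<epsilon>\<^sup>2 * n / C\<^sup>2 * V" using V by (intro mult_left_mono) auto
    also have "\<dots> = (\<epsilon> / (C * atl n t))\<^sup>2"
      using n Vpos unfolding a_def[symmetric] a by (simp add: power_divide power_mult_distrib)
    finally show ?thesis .
  qed
  have inc: "\<bar>(G n C \<epsilon> t (\<theta> + s) - G n C \<epsilon> t \<theta>) - (log_partition' \<mu> (\<theta> + s) - log_partition' \<mu> \<theta>)\<bar> \<le> h * S / 4"
    if "\<bar>s\<bar> = h" for s
    by (rule G_increment[OF n S hpos that _ hS m4 B']) (use I h(2) in auto)
  have up: "h * S / 4 \<le> G n C \<epsilon> t (\<theta> + h) - G n C \<epsilon> t \<theta>"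
  proof -
    have "S / 2 * (\<theta> + h - \<theta>) \<le> log_partition' \<mu> (\<theta> + h) - log_partition' \<mu> \<theta>"
      by (rule A'_increment) (use I h(2) hpos in auto)
    then have "h * S / 2 \<le> log_partition' \<mu> (\<theta> + h) - log_partition' \<mu> \<theta>" by (simp add: mult.commute)
    moreover have "\<bar>h\<bar> = h" using hpos by simp
    ultimately show ?thesis using inc[of h] by linarith
  qed
  have down: "h * S / 4 \<le> G n C \<epsilon> t \<theta> - G n C \<epsilon> t (\<theta> - h)"
  proof -
    have "S / 2 * (\<theta> - (\<theta> - h)) \<le> log_partition' \<mu> \<theta> - log_partition' \<mu> (\<theta> - h)"
      by (rule A'_increment) (use I h(2) hpos in auto)
    then have "h * S / 2 \<le> log_partition' \<mu> \<theta> - log_partition' \<mu> (\<theta> + - h)" by (simp add: mult.commute)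
    moreover have "\<bar>- h\<bar> = h" using hpos by simp
    moreover have "\<theta> - h = \<theta> + - h" by simp
    ultimately show ?thesis using inc[of "- h"] by (simp only:) linarith
  qed
  have hS4: "h * S / 4 = 10 * sqrt S / sqrt n + 5 * (3 * sqrt S / (C * sqrt n))"
  proof -
    have "S = sqrt S * sqrt S" using Spos by simp
    then have "h * S / 4 = (40 + 60 / C) / (sqrt S * sqrt n) * (sqrt S * sqrt S) / 4" unfolding h(1) by simp
    also have "\<dots> = (10 + 15 / C) * sqrt S / sqrt n"
    proof -
      have "(40 + 60 / C) / (u * v) * (u * u) / 4 = (10 + 15 / C) * u / v" if "0 < u" "0 < v" for u v
        using that n by (simp add: field_simps)
      note this[of "sqrt S" "sqrt n"]
      moreover have "0 < sqrt S" "0 < sqrt n" using Spos n(1) by simp_all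
      ultimately show ?thesis by blast
    qed
    finally show ?thesis using n by (simp add: field_simps)
  qed
  have \<Phi>h: "\<theta> - h \<in> \<Phi>" "\<theta> + h \<in> \<Phi>" using I h(2) hpos by (auto intro!: interiorD)
  have out: "\<bar>\<Theta> n C \<epsilon> t y - \<theta>\<bar> \<le> h" if "\<bar>y - G n C \<epsilon> t \<theta>\<bar> \<le> h * S / 4" for y
    by (rule \<Theta>_near[OF n \<Phi>h]) (use that up down hpos Spos mult_pos_pos[OF hpos Spos] in linarith)+
  interpret Pt: prob_space "P \<theta>" by (rule prob_space_P[OF interiorD[OF \<theta>]])
  have P: "prob_space (P \<theta>)" "sets (P \<theta>) = sets borel" by (simp_all add: Pt.prob_space_axioms)
  interpret X: prob_space "iid n (P \<theta>)" by (rule prob_space_iid[OF P(1)])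
  interpret L: prob_space "laplace b" by (rule prob_space_laplace[OF bpos])
  have B0: "0 \<le> \<epsilon> / (C * a)" using n apos by simp
  define g where "g = G n C \<epsilon> t \<theta>"
  let ?d = "10 * sqrt S / sqrt n"
  define D where "D = {X \<in> space (iid n (P \<theta>)). ?d \<le> \<bar>clipped_mean n C \<epsilon> t a X - g\<bar>}"
  have D: "X.prob D \<le> 1 / 100"
    using clip_average_deviation[OF \<theta> n(1) B0, of t]
    by (simp add: D_def clipped_mean_def g_def G_def S a_def)
  have mF: "(\<lambda>X. clipped_mean n C \<epsilon> t a X) \<in> borel_measurable (iid n (P \<theta>))"
    unfolding clipped_mean_def measurable_cong_sets[OF sets_iid[OF P(2)] refl]
    by (intro borel_measurable_times borel_measurable_const clip_average_measurable)
  have mD: "D \<in> X.events" unfolding D_def using mF by measurable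
  have good: "1 - 1/100 \<le> X.prob (space (iid n (P \<theta>)) - D)" using X.prob_compl[OF mD] D by simp
  have K: "31 / 32 \<le> measure (nCLLRE \<mu> n C \<epsilon> X t) {\<theta>'. \<bar>\<theta>' - \<theta>\<bar> \<le> h}"
    if X: "X \<in> space (iid n (P \<theta>)) - D" for X
  proof -
    have X': "\<bar>clipped_mean n C \<epsilon> t a X - g\<bar> < ?d" using X by (auto simp: D_def)
    have m\<Theta>: "(\<lambda>z. \<Theta> n C \<epsilon> t (clipped_mean n C \<epsilon> t a X + z)) \<in> borel_measurable borel"
    proof -
      have "\<Theta> n C \<epsilon> t \<in> borel_measurable borel"
        using measurable_compose[OF measurable_Pair1'[of t borel borel] \<Theta>_measurable[OF n]] by simp
      then show ?thesis
        by (rule measurable_compose[rotated]) (rule borel_measurable_add[OF borel_measurable_const measurable_ident_sets[OF refl]])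
    qed
    then have m\<Theta>': "(\<lambda>z. \<Theta> n C \<epsilon> t (clipped_mean n C \<epsilon> t a X + z)) \<in> borel_measurable (laplace b)"
      by (simp cong: measurable_cong_sets)
    have E: "{\<theta>'. \<bar>\<theta>' - \<theta>\<bar> \<le> h} \<in> sets borel" by measurable
    have "31 / 32 \<le> L.prob ((\<lambda>z. \<Theta> n C \<epsilon> t (clipped_mean n C \<epsilon> t a X + z)) -` {\<theta>'. \<bar>\<theta>' - \<theta>\<bar> \<le> h} \<inter> space (laplace b))"
    proof (rule laplace_concentrated[OF bpos])
      show "(\<lambda>z. \<Theta> n C \<epsilon> t (clipped_mean n C \<epsilon> t a X + z)) -` {\<theta>'. \<bar>\<theta>' - \<theta>\<bar> \<le> h} \<inter> space (laplace b) \<in> sets borel"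
        using measurable_sets[OF m\<Theta>' E] by simp
      fix z assume "\<bar>z\<bar> \<le> 5 * b"
      then have "\<bar>clipped_mean n C \<epsilon> t a X + z - G n C \<epsilon> t \<theta>\<bar> \<le> h * S / 4"
        using X' b unfolding hS4 g_def[symmetric] by linarith
      then show "z \<in> (\<lambda>z. \<Theta> n C \<epsilon> t (clipped_mean n C \<epsilon> t a X + z)) -` {\<theta>'. \<bar>\<theta>' - \<theta>\<bar> \<le> h} \<inter> space (laplace b)"
        using out by simp
    qed
    also have "\<dots> = measure (nCLLRE \<mu> n C \<epsilon> X t) {\<theta>'. \<bar>\<theta>' - \<theta>\<bar> \<le> h}"
      unfolding nCLLRE_in[OF n \<open>t \<in> I\<close>] a_def[symmetric] b_def[symmetric] by (rule measure_distr[OF m\<Theta>' E, symmetric])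
    finally show ?thesis .
  qed
  have K2: "(\<lambda>X. nCLLRE \<mu> n C \<epsilon> X t) \<in> datasets n \<rightarrow>\<^sub>M prob_algebra borel"
    using measurable_compose[OF measurable_Pair2'[of t borel "datasets n"] nCLLRE_measurable[OF n]] by simp
  have "space (iid n (P \<theta>)) - D \<in> X.events" using mD by simp
  then have sA: "space (iid n (P \<theta>)) - D \<in> sets (datasets n)" unfolding sets_iid[OF P(2)] .
  have E: "{\<theta>'. \<bar>\<theta>' - \<theta>\<bar> \<le> h} \<in> sets borel" by measurable
  have "(1 - 1/100) * (31/32) \<le> measure (iid n (P \<theta>) \<bind> (\<lambda>X. nCLLRE \<mu> n C \<epsilon> X t)) {\<theta>'. \<bar>\<theta>' - \<theta>\<bar> \<le> h}"
    by (rule measure_bind_ge[OF iid_in_prob_algebra[OF P] K2 E sA good _ K]) simp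
  then show ?thesis by simp
qed

end

section \<open>Private release of a majority vote\<close>

definition tally :: "nat \<Rightarrow> (nat \<Rightarrow> 'v) \<Rightarrow> 'v \<Rightarrow> real" where
  "tally G w v = real (card {g. g < G \<and> w g = v})"

text \<open>A strict majority is unique if it exists (\<open>majority_eqI\<close>), so the choice
  operator is determined; the default also serves as the answer "none".\<close>

definition majority :: "nat \<Rightarrow> 'v \<Rightarrow> (nat \<Rightarrow> 'v) \<Rightarrow> 'v" where
  "majority G v\<^sub>0 w = (if \<exists>v. G / 2 < tally G w v then SOME v. G / 2 < tally G w v else v\<^sub>0)"

text \<open>The extra 1 makes a positive margin survive the change of one ballot: if two
  neighbouring votes have different majorities, both margins are 0.\<close>

definition margin :: "nat \<Rightarrow> 'v \<Rightarrow> (nat \<Rightarrow> 'v) \<Rightarrow> real" where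
  "margin G v\<^sub>0 w = max 0 (tally G w (majority G v\<^sub>0 w) - G / 2 - 1)"

text \<open>A propose-test-release mechanism: the winner is revealed only if its noisy margin passes
  the threshold. It works on an infinite set of candidates, since only the margin of the winner is
  perturbed.\<close>

definition release :: "real \<Rightarrow> real \<Rightarrow> nat \<Rightarrow> 'v \<Rightarrow> (nat \<Rightarrow> 'v) \<Rightarrow> 'v measure" where
  "release b T G v\<^sub>0 w = distr (laplace b) (count_space UNIV)
     (\<lambda>z. if T < margin G v\<^sub>0 w + z then majority G v\<^sub>0 w else v\<^sub>0)"

lemma tally_disjoint: "v \<noteq> v' \<Longrightarrow> tally G w v + tally G w v' \<le> G"
proof -
  assume "v \<noteq> v'"
  then have "card {g. g < G \<and> w g = v} + card {g. g < G \<and> w g = v'} = card ({g. g < G \<and> w g = v} \<union> {g. g < G \<and> w g = v'})"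
    by (subst card_Un_disjoint) auto
  also have "\<dots> \<le> card {..<G}" by (intro card_mono) auto
  finally show ?thesis unfolding tally_def by simp
qed

lemma majority_eqI: "G / 2 < tally G w v \<Longrightarrow> majority G v\<^sub>0 w = v"
proof -
  assume v: "G / 2 < tally G w v"
  have "v' = v" if "G / 2 < tally G w v'" for v'
    using tally_disjoint[of v v' G w] v that by (cases "v = v'") auto
  then have "(SOME v. G / 2 < tally G w v) = v" using v by (intro some_equality)
  then show ?thesis using v by (auto simp: majority_def)
qed

lemma tally_neighbour:
  assumes "\<And>g. g < G \<Longrightarrow> g \<noteq> g\<^sub>0 \<Longrightarrow> w g = w' g" shows "tally G w v \<le> tally G w' v + 1"
proof -
  have "card {g. g < G \<and> w g = v} \<le> card (insert g\<^sub>0 {g. g < G \<and> w' g = v})"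
    using assms by (intro card_mono) auto
  also have "\<dots> \<le> Suc (card {g. g < G \<and> w' g = v})" by (rule card_insert_le_m1) simp_all
  finally show ?thesis unfolding tally_def by linarith
qed

lemma margin_neighbour:
  assumes w: "\<And>g. g < G \<Longrightarrow> g \<noteq> g\<^sub>0 \<Longrightarrow> w g = w' g"
  shows "majority G v\<^sub>0 w = majority G v\<^sub>0 w' \<Longrightarrow> margin G v\<^sub>0 w \<le> margin G v\<^sub>0 w' + 1"
    and "majority G v\<^sub>0 w \<noteq> majority G v\<^sub>0 w' \<Longrightarrow> margin G v\<^sub>0 w = 0"
proof -
  have tn: "tally G w v \<le> tally G w' v + 1" for v by (rule tally_neighbour[of G g\<^sub>0]) (rule w)
  show "margin G v\<^sub>0 w \<le> margin G v\<^sub>0 w' + 1" if "majority G v\<^sub>0 w = majority G v\<^sub>0 w'"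
    using tn[of "majority G v\<^sub>0 w'"] that unfolding margin_def by (auto simp: max_def)
  assume ne: "majority G v\<^sub>0 w \<noteq> majority G v\<^sub>0 w'"
  show "margin G v\<^sub>0 w = 0"
  proof (rule ccontr)
    assume "margin G v\<^sub>0 w \<noteq> 0"
    then have "G / 2 + 1 < tally G w (majority G v\<^sub>0 w)" by (auto simp: margin_def max_def split: if_splits)
    then have "G / 2 < tally G w' (majority G v\<^sub>0 w)" using tn[of "majority G v\<^sub>0 w"] by linarith
    then show False using majority_eqI ne by metis
  qed
qed

text \<open>With equal majorities the margins differ by at most 1, and this is the Laplace
  mechanism. With different ones both margins are 0, so the outputs can differ only if the noise
  exceeds \<open>T\<close>. That one-sided tail is \<open>exp (- T / b) / 2\<close>, which explains
  the factor 2 in the hypothesis.\<close>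

lemma release_close:
  assumes b: "0 < b" and T: "0 \<le> T" "exp (- T / b) \<le> 2 * \<delta>"
    and w: "\<And>g. g < G \<Longrightarrow> g \<noteq> g\<^sub>0 \<Longrightarrow> w g = w' g"
  shows "close (1 / b) \<delta> (release b T G v\<^sub>0 w) (release b T G v\<^sub>0 w')"
proof (cases "majority G v\<^sub>0 w = majority G v\<^sub>0 w'")
  case True
  have d: "0 \<le> \<delta>" using T exp_gt_zero[of "- T / b"] by linarith
  have w': "\<And>g. g < G \<Longrightarrow> g \<noteq> g\<^sub>0 \<Longrightarrow> w' g = w g" using w by simp
  have "margin G v\<^sub>0 w \<le> margin G v\<^sub>0 w' + 1" by (rule margin_neighbour(1)[of G g\<^sub>0]) (use w True in auto)
  moreover have "margin G v\<^sub>0 w' \<le> margin G v\<^sub>0 w + 1" by (rule margin_neighbour(1)[of G g\<^sub>0]) (use w' True in auto)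
  ultimately have "\<bar>margin G v\<^sub>0 w - margin G v\<^sub>0 w'\<bar> \<le> 1 / b * b" using b by simp
  then have "close (1 / b) 0 (release b T G v\<^sub>0 w) (release b T G v\<^sub>0 w')"
    unfolding release_def True by (intro laplace_mechanism[where \<phi>="\<lambda>y. if T < y then majority G v\<^sub>0 w' else v\<^sub>0"] b) measurable
  then show ?thesis by (rule close_mono) (use d in auto)
next
  case False
  have w': "\<And>g. g < G \<Longrightarrow> g \<noteq> g\<^sub>0 \<Longrightarrow> w' g = w g" using w by simp
  have m0: "margin G v\<^sub>0 w = 0" by (rule margin_neighbour(2)[of G g\<^sub>0]) (use w False in auto)
  have m0': "margin G v\<^sub>0 w' = 0" by (rule margin_neighbour(2)[of G g\<^sub>0]) (use w' False in auto)
  interpret L: prob_space "laplace b" by (rule prob_space_laplace[OF b])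
  have meas: "(\<lambda>z. if T < z then v else v\<^sub>0) \<in> laplace b \<rightarrow>\<^sub>M count_space UNIV" for v by measurable
  show ?thesis unfolding close_def
  proof
    fix E
    let ?pre = "\<lambda>v. (\<lambda>z. if T < z then v else v\<^sub>0) -` E \<inter> space (laplace b)"
    have ev: "?pre v \<in> L.events" for v using measurable_sets[OF meas, of E v] by simp
    have "measure (release b T G v\<^sub>0 w) E = L.prob (?pre (majority G v\<^sub>0 w))"
      unfolding release_def m0 m0' using meas by (subst measure_distr) auto
    \<comment> \<open>Noise of at most \<open>T\<close> makes both mechanisms return the
      default.\<close>
    also have "\<dots> \<le> L.prob (?pre (majority G v\<^sub>0 w') \<union> {T<..})"
      using ev by (intro L.finite_measure_mono) (auto split: if_splits)
    also have "\<dots> \<le> L.prob (?pre (majority G v\<^sub>0 w')) + L.prob {T<..}"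
      using ev by (intro measure_Un_le) auto
    also have "L.prob (?pre (majority G v\<^sub>0 w')) = measure (release b T G v\<^sub>0 w') E"
      unfolding release_def m0 m0' using meas by (subst measure_distr) auto
    also have "L.prob {T<..} \<le> \<delta>" using measure_laplace_greater(1)[OF b T(1)] T(2) by simp
    also have "measure (release b T G v\<^sub>0 w') E \<le> exp (1 / b) * measure (release b T G v\<^sub>0 w') E"
      using b by (simp add: mult_le_cancel_right1 measure_le_0_iff)
    finally show "measure (release b T G v\<^sub>0 w) E \<le> exp (1 / b) * measure (release b T G v\<^sub>0 w') E + \<delta>" by simp
  qed
qed

text \<open>A share of 4/5 exceeds one half by 3/10 of the ballots; the margin so obtained has to
  beat the threshold and five noise scales.\<close>

lemma release_accurate:
  assumes b: "0 < b" and G: "0 < G" and v: "4 * G / 5 \<le> tally G w v" and T: "T + 5 * b < 3 * G / 10 - 1"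
  shows "31 / 32 \<le> measure (release b T G v\<^sub>0 w) {v}"
proof -
  have mj: "majority G v\<^sub>0 w = v" using v G by (intro majority_eqI) simp
  have mg: "3 * G / 10 - 1 \<le> margin G v\<^sub>0 w" unfolding margin_def mj using v by simp
  have meas: "(\<lambda>z. if T < margin G v\<^sub>0 w + z then v else v\<^sub>0) \<in> laplace b \<rightarrow>\<^sub>M count_space UNIV" by measurable
  have "31 / 32 \<le> measure (laplace b) ((\<lambda>z. if T < margin G v\<^sub>0 w + z then v else v\<^sub>0) -` {v} \<inter> space (laplace b))"
    by (rule laplace_concentrated[OF b])
       (use measurable_sets[OF meas, of "{v}"] mg T in \<open>auto simp: abs_le_iff\<close>)
  then show ?thesis unfolding release_def mj using meas by (simp add: measure_distr)
qed

lemma release_measurable: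
  fixes w :: "'a \<Rightarrow> nat \<Rightarrow> 'v::countable"
  assumes b: "0 < b" and w[measurable]: "\<And>g. (\<lambda>x. w x g) \<in> M \<rightarrow>\<^sub>M count_space UNIV"
  shows "(\<lambda>x. release b T G v\<^sub>0 (w x)) \<in> M \<rightarrow>\<^sub>M prob_algebra (count_space UNIV)"
proof -
  have t: "tally G (w x) v = (\<Sum>g<G. if w x g = v then 1 else 0)" for x v
    unfolding tally_def by (simp add: sum.If_cases Int_def)
  have [measurable]: "(\<lambda>x. tally G (w x) v) \<in> borel_measurable M" for v
    unfolding t by measurable
  have [measurable]: "(\<lambda>x. majority G v\<^sub>0 (w x)) \<in> M \<rightarrow>\<^sub>M count_space UNIV"
  proof (subst measurable_count_space_eq2_countable, intro conjI ballI)
    fix v :: 'v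
    \<comment> \<open>Uniqueness eliminates the choice operator and leaves countably many conditions
      on tallies.\<close>
    have "majority G v\<^sub>0 (w x) = v \<longleftrightarrow> (G / 2 < tally G (w x) v \<or> (v = v\<^sub>0 \<and> (\<forall>v'. \<not> G / 2 < tally G (w x) v')))" for x
    proof (cases "\<exists>v. G / 2 < tally G (w x) v")
      case True
      then obtain v1 where v1: "G / 2 < tally G (w x) v1" by blast
      then have mj: "majority G v\<^sub>0 (w x) = v1" by (rule majority_eqI)
      then have "G / 2 < tally G (w x) v \<longleftrightarrow> v = v1" using majority_eqI[of G "w x" v v\<^sub>0] v1 by metis
      then show ?thesis using mj v1 by blast
    qed (auto simp: majority_def)
    then have "(\<lambda>x. majority G v\<^sub>0 (w x)) -` {v} \<inter> space M =
      {x\<in>space M. G / 2 < tally G (w x) v \<or> (v = v\<^sub>0 \<and> (\<forall>v'. \<not> G / 2 < tally G (w x) v'))}" by auto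
    also have "\<dots> \<in> sets M" by measurable
    finally show "(\<lambda>x. majority G v\<^sub>0 (w x)) -` {v} \<inter> space M \<in> sets M" .
  qed auto
  have [measurable]: "(\<lambda>x. tally G (w x) (majority G v\<^sub>0 (w x))) \<in> borel_measurable M"
    by (rule measurable_compose_countable[where f="\<lambda>v x. tally G (w x) v"]) measurable
  have [measurable]: "(\<lambda>x. margin G v\<^sub>0 (w x)) \<in> borel_measurable M"
    unfolding margin_def by measurable
  have [measurable]: "laplace b \<in> space (prob_algebra borel)" using b by (simp add: space_prob_algebra prob_space_laplace)
  show ?thesis unfolding release_def by measurable
qed

section \<open>Clipped averages with Laplace noise\<close>

definition clip_release :: "nat \<Rightarrow> real \<Rightarrow> real \<Rightarrow> real \<Rightarrow> (nat \<Rightarrow> real) \<Rightarrow> real measure" where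
  "clip_release n \<epsilon> c B X = distr (laplace (2 * B / (n * \<epsilon>))) borel
     (\<lambda>z. c + (\<Sum>i<n. clip (- B) B (X i - c)) / n + z)"

lemma clip_release_close:
  assumes n: "0 < n" "0 < \<epsilon>" "0 < B" and nb: "neighbours n X X'"
  shows "close \<epsilon> 0 (clip_release n \<epsilon> c B X) (clip_release n \<epsilon> c B X')"
proof -
  let ?f = "\<lambda>X. c + (\<Sum>i<n. clip (- B) B (X i - c)) / n"
  have "\<bar>?f X - ?f X'\<bar> = \<bar>(\<Sum>i<n. clip (- B) B (X i - c)) - (\<Sum>i<n. clip (- B) B (X' i - c))\<bar> / n"
    by (simp add: abs_divide flip: diff_divide_distrib)
  also have "\<dots> \<le> 2 * B / n"
    by (intro divide_right_mono neighbours_sum_diff[OF nb, of "\<lambda>x. clip (- B) B (x - c)"] abs_clip_le) (use n in auto)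
  also have "\<dots> = \<epsilon> * (2 * B / (n * \<epsilon>))" using n by simp
  finally show ?thesis unfolding clip_release_def
    using n by (intro laplace_mechanism[where \<phi>="\<lambda>y. y"]) auto
qed

lemma clip_release_measurable:
  assumes n: "0 < n" "0 < \<epsilon>" "0 < B"
  shows "clip_release n \<epsilon> c B \<in> datasets n \<rightarrow>\<^sub>M prob_algebra borel"
proof -
  have [measurable]: "laplace (2 * B / (n * \<epsilon>)) \<in> space (prob_algebra borel)"
    using n by (simp add: space_prob_algebra prob_space_laplace)
  note clip_average_measurable[measurable]
  show ?thesis unfolding clip_release_def by measurable
qed

text \<open>The bias is at most the mean of \<open>(x - c)\<^sup>2 / B\<close>, and the second
  moment about \<open>c\<close> is the variance plus the squared offset of the centre.\<close>

lemma (in exp_family) clip_bias: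
  assumes \<theta>: "\<theta> \<in> interior \<Phi>" and B: "0 < B"
  shows "\<bar>c + (\<integral>x. clip (- B) B (x - c) \<partial>P \<theta>) - log_partition' \<mu> \<theta>\<bar> \<le>
    (log_partition'' \<mu> \<theta> + (log_partition' \<mu> \<theta> - c)\<^sup>2) / B"
proof -
  interpret prob_space "P \<theta>" by (rule prob_space_P[OF interiorD[OF \<theta>]])
  have pU: "prob UNIV = 1" using prob_space by simp
  let ?t = "log_partition' \<mu> \<theta>"
  have i1: "integrable (P \<theta>) (\<lambda>x. x)" using integrable_power[OF \<theta>, of 1] by simp
  have i2: "integrable (P \<theta>) (\<lambda>x. clip (- B) B (x - c))" using variance_clip_le(1)[OF \<theta>, of B c] B by simp
  have ic: "integrable (P \<theta>) (\<lambda>x. (x - c)\<^sup>2)" by (rule integrable_power_minus[OF \<theta>])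
  have eq: "(\<lambda>x. (x - c)\<^sup>2) = (\<lambda>x. (x - ?t)\<^sup>2 + (2 * (?t - c) * x - (?t\<^sup>2 - c\<^sup>2)))"
    by (auto simp: power2_eq_square algebra_simps)
  have "(\<integral>x. (x - c)\<^sup>2 \<partial>P \<theta>) = (\<integral>x. (x - ?t)\<^sup>2 \<partial>P \<theta>) + (\<integral>x. 2 * (?t - c) * x - (?t\<^sup>2 - c\<^sup>2) \<partial>P \<theta>)"
    unfolding eq by (rule Bochner_Integration.integral_add[OF integrable_power_minus[OF \<theta>]]) (use i1 in simp)
  also have "(\<integral>x. 2 * (?t - c) * x - (?t\<^sup>2 - c\<^sup>2) \<partial>P \<theta>) = (?t - c)\<^sup>2"
    using i1 pU by (simp add: mean_P[OF \<theta>] power2_eq_square algebra_simps)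
  finally have E2: "(\<integral>x. (x - c)\<^sup>2 \<partial>P \<theta>) = log_partition'' \<mu> \<theta> + (?t - c)\<^sup>2" by (simp add: variance_P[OF \<theta>])
  have "c + (\<integral>x. clip (- B) B (x - c) \<partial>P \<theta>) - ?t = - (\<integral>x. x - c - clip (- B) B (x - c) \<partial>P \<theta>)"
    using i1 i2 pU by (simp add: mean_P[OF \<theta>])
  then have "\<bar>c + (\<integral>x. clip (- B) B (x - c) \<partial>P \<theta>) - ?t\<bar> = \<bar>\<integral>x. x - c - clip (- B) B (x - c) \<partial>P \<theta>\<bar>" by simp
  also have "\<dots> \<le> (\<integral>x. \<bar>x - c - clip (- B) B (x - c)\<bar> \<partial>P \<theta>)" by (rule integral_abs_bound)
  also have "\<dots> \<le> (\<integral>x. (x - c)\<^sup>2 / B \<partial>P \<theta>)"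
    by (intro integral_mono abs_minus_clip_le B integrable_abs Bochner_Integration.integrable_diff i1 i2 integrable_const integrable_divide ic)
  also have "\<dots> = (log_partition'' \<mu> \<theta> + (?t - c)\<^sup>2) / B" using E2 by (simp only: integral_divide_zero)
  finally show ?thesis .
qed

text \<open>The error budget \<open>e\<close> consists of bias, sampling deviation and five noise
  scales. The sample is fixed here; only the noise is random.\<close>

lemma (in exp_family) clip_release_accurate:
  assumes \<theta>: "\<theta> \<in> interior \<Phi>" and n: "0 < n" "0 < \<epsilon>" "0 < B"
    and X: "\<bar>(\<Sum>i<n. clip (- B) B (X i - c)) / n - (\<integral>x. clip (- B) B (x - c) \<partial>P \<theta>)\<bar> < d"
    and e: "(log_partition'' \<mu> \<theta> + (log_partition' \<mu> \<theta> - c)\<^sup>2) / B + d + 5 * (2 * B / (n * \<epsilon>)) \<le> e"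
  shows "31 / 32 \<le> measure (clip_release n \<epsilon> c B X) {t. \<bar>t - log_partition' \<mu> \<theta>\<bar> \<le> e}"
proof -
  let ?b = "2 * B / (n * \<epsilon>)" and ?f = "\<lambda>z. c + (\<Sum>i<n. clip (- B) B (X i - c)) / n + z"
  have b: "0 < ?b" using n by simp
  have m: "?f \<in> borel_measurable (laplace ?b)" by measurable
  have E: "{t. \<bar>t - log_partition' \<mu> \<theta>\<bar> \<le> e} \<in> sets borel" by measurable
  have "31 / 32 \<le> measure (laplace ?b) (?f -` {t. \<bar>t - log_partition' \<mu> \<theta>\<bar> \<le> e} \<inter> space (laplace ?b))"
  proof (rule laplace_concentrated[OF b])
    show "?f -` {t. \<bar>t - log_partition' \<mu> \<theta>\<bar> \<le> e} \<inter> space (laplace ?b) \<in> sets borel"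
      using measurable_sets[OF m E] by simp
    fix z assume "\<bar>z\<bar> \<le> 5 * ?b"
    then have "\<bar>?f z - log_partition' \<mu> \<theta>\<bar> \<le> e" using X e clip_bias[OF \<theta> n(3), of c] by linarith
    then show "z \<in> ?f -` {t. \<bar>t - log_partition' \<mu> \<theta>\<bar> \<le> e} \<inter> space (laplace ?b)" by simp
  qed
  then show ?thesis unfolding clip_release_def using m E by (simp add: measure_distr)
qed

section \<open>Randomly shifted grids\<close>

text \<open>The floors differ exactly if an integer lies in the shifted half-open interval. Modulo 1
  the K shifted intervals, each of length at most 1/K, are disjoint, so at most one of them meets an
  integer.\<close>

lemma floor_shift_bad:
  fixes a b :: real
  assumes K: "0 < K" and ab: "a \<le> b" "b - a \<le> 1 / real K"
  shows "card {u. u < K \<and> \<lfloor>a + real u / K\<rfloor> \<noteq> \<lfloor>b + real u / K\<rfloor>} \<le> 1" (is "card ?S \<le> 1")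
proof -
  have "u = u'" if u: "u < K" "\<lfloor>a + real u / K\<rfloor> \<noteq> \<lfloor>b + real u / K\<rfloor>"
    and u': "u' < K" "\<lfloor>a + real u' / K\<rfloor> \<noteq> \<lfloor>b + real u' / K\<rfloor>" and le: "u \<le> u'" for u u'
  proof (rule ccontr)
    assume "u \<noteq> u'"
    then have lt: "real u + 1 \<le> real u'" using le by linarith
    have step: "(real u + 1) / K \<le> real u' / K" using lt K by (intro divide_right_mono) auto
    have top: "(real u' + 1) / K \<le> 1" using u'(1) K by simp
    have bot: "0 \<le> real u / K" by simp
    let ?p = "\<lfloor>b + real u / K\<rfloor>" and ?p' = "\<lfloor>b + real u' / K\<rfloor>"
    have "\<lfloor>a + real u / K\<rfloor> < ?p" "\<lfloor>a + real u' / K\<rfloor> < ?p'"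
      using u u' ab floor_mono[of "a + real u / K" "b + real u / K"] floor_mono[of "a + real u' / K" "b + real u' / K"] by linarith+
    then have "a + real u / K < ?p" "a + real u' / K < ?p'" by linarith+
    moreover have "?p \<le> b + real u / K" "?p' \<le> b + real u' / K" by linarith+
    moreover have "real u / K + 1 / K \<le> real u' / K" "real u' / K + 1 / K \<le> 1"
      using step top by (simp_all add: add_divide_distrib)
    \<comment> \<open>Two bad shifts would give integers crossed in disjoint intervals that together
      span less than one unit: p < p' < p + 1.\<close>
    ultimately have "real_of_int ?p < real_of_int ?p'" "real_of_int ?p' < real_of_int ?p + 1"
      using ab bot by linarith+
    moreover have False if "real_of_int p < real_of_int p'" "real_of_int p' < real_of_int p + 1" for p p' :: int
    proof -
      have "p < p'" using that(1) by simp
      moreover have "p' < p + 1" using that(2) by (simp only: of_int_less_iff[symmetric, where 'a=real] of_int_add of_int_1)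
      ultimately show False by simp
    qed
    ultimately show False by blast
  qed
  note le_case = this
  have "u = u'" if "u \<in> {u. u < K \<and> \<lfloor>a + real u / K\<rfloor> \<noteq> \<lfloor>b + real u / K\<rfloor>}"
    "u' \<in> {u. u < K \<and> \<lfloor>a + real u / K\<rfloor> \<noteq> \<lfloor>b + real u / K\<rfloor>}" for u u'
    using that le_case[of u u'] le_case[of u' u] nat_le_linear[of u u'] by blast
  then have "\<forall>u\<in>?S. \<forall>u'\<in>?S. u = u'" by (intro ballI)
  moreover have "finite ?S" by simp
  ultimately show ?thesis unfolding One_nat_def using card_le_Suc0_iff_eq by blast
qed

lemma floor_shift_eq:
  assumes "\<lfloor>a + s\<rfloor> = \<lfloor>b + s\<rfloor>" "a \<le> x" "x \<le> b" shows "\<lfloor>x + s\<rfloor> = \<lfloor>a + (s::real)\<rfloor>"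
  using assms floor_mono[of "a + s" "x + s"] floor_mono[of "x + s" "b + s"] by simp

section \<open>A private mean estimator for unknown location and scale\<close>

definition block_mean :: "nat \<Rightarrow> nat \<Rightarrow> (nat \<Rightarrow> real) \<Rightarrow> real" where
  "block_mean m g X = (\<Sum>i\<in>{g * m..<(g + 1) * m}. X i) / m"

definition block_var :: "nat \<Rightarrow> nat \<Rightarrow> (nat \<Rightarrow> real) \<Rightarrow> real" where
  "block_var m g X = (\<Sum>i\<in>{g * m..<(g + 1) * m}. (X i - block_mean m g X)\<^sup>2) / m"

text \<open>The exponential bounds the standard deviation of every variance in logarithmic cell
  \<open>j\<close>, whatever the shift. The factor 2K makes the location cell at least K standard
  deviations wide, so block means, which spread over one of them, fill at most 1/K of it.\<close>

definition grid_scale :: "nat \<Rightarrow> int \<Rightarrow> real" where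
  "grid_scale K j = 2 * K * exp (K * ln 3 * (j + 1) / 2)"

text \<open>The logarithmic cells have length \<open>K * ln 3\<close> because the variances of good
  blocks lie between S/2 and 3S/2: their logarithms spread over ln 3, again 1/K of a cell.\<close>

definition grid_cell :: "nat \<Rightarrow> nat \<Rightarrow> real \<Rightarrow> real \<Rightarrow> int \<times> int" where
  "grid_cell K u q y = (let j = \<lfloor>ln q / (K * ln 3) + real u / K\<rfloor> in (j, \<lfloor>y / grid_scale K j + real u / K\<rfloor>))"

definition block_vote :: "nat \<Rightarrow> nat \<Rightarrow> nat \<Rightarrow> (nat \<Rightarrow> real) \<Rightarrow> nat \<Rightarrow> int \<times> int" where
  "block_vote K m u X g = grid_cell K u (block_var m g X) (block_mean m g X)"

text \<open>The left end of the location cell, obtained by solving the expression under the floor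
  for \<open>y\<close>.\<close>

definition cell_corner :: "nat \<Rightarrow> nat \<Rightarrow> int \<times> int \<Rightarrow> real" where
  "cell_corner K u v = grid_scale K (fst v) * (snd v - real u / K)"

text \<open>With noise scale 1/\<epsilon> and this threshold the tail in
  \<open>release_close\<close> is \<delta>/2. \<open>H\<close> is the clipping radius in units of
  the cell width: increasing it reduces the bias and raises the noise.\<close>

definition shifted_estimator ::
    "nat \<Rightarrow> real \<Rightarrow> real \<Rightarrow> nat \<Rightarrow> nat \<Rightarrow> real \<Rightarrow> nat \<Rightarrow> (nat \<Rightarrow> real) \<Rightarrow> real measure" where
  "shifted_estimator n \<epsilon> \<delta> K m H u X =
     release (1 / \<epsilon>) (ln (1 / \<delta>) / \<epsilon>) (n div m) (0, 0) (block_vote K m u X) \<bind>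
       (\<lambda>v. clip_release n \<epsilon> (cell_corner K u v) (H * grid_scale K (fst v)) X)"

text \<open>The random shift \<open>u\<close> of the grid makes it unlikely that the distribution straddles a cell boundary.\<close>

definition mean_estimator ::
    "nat \<Rightarrow> real \<Rightarrow> real \<Rightarrow> nat \<Rightarrow> nat \<Rightarrow> real \<Rightarrow> (nat \<Rightarrow> real) \<Rightarrow> real measure" where
  "mean_estimator n \<epsilon> \<delta> K m H X =
     measure_pmf (pmf_of_set {..<K}) \<bind> (\<lambda>u. shifted_estimator n \<epsilon> \<delta> K m H u X)"

lemma grid_scale_pos: "0 < K \<Longrightarrow> 0 < grid_scale K j"
  by (simp add: grid_scale_def)

lemma block_subset:
  fixes g m n :: nat
  assumes "g < n div m" shows "{g * m..<(g + 1) * m} \<subseteq> {..<n}"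
proof -
  have "g + 1 \<le> n div m" using Suc_leI[OF assms] by simp
  then have "(g + 1) * m \<le> n div m * m" by (rule mult_le_mono1)
  also have "\<dots> \<le> n" by simp
  finally show ?thesis by auto
qed

lemma block_mean_measurable: "g < n div m \<Longrightarrow> block_mean m g \<in> borel_measurable (datasets n)"
  unfolding block_mean_def[abs_def] using block_subset[of g n m]
  by (intro borel_measurable_divide borel_measurable_sum borel_measurable_const datasets_component) auto

lemma block_var_measurable: "g < n div m \<Longrightarrow> block_var m g \<in> borel_measurable (datasets n)"
  unfolding block_var_def[abs_def] using block_subset[of g n m]
  by (intro borel_measurable_divide borel_measurable_sum borel_measurable_const borel_measurable_power
      borel_measurable_diff block_mean_measurable datasets_component) auto

lemma grid_cell_measurable:
  assumes [measurable]: "q \<in> borel_measurable M" "y \<in> borel_measurable M"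
  shows "(\<lambda>x. grid_cell K u (q x) (y x)) \<in> M \<rightarrow>\<^sub>M count_space UNIV"
proof -
  let ?j = "\<lambda>x. \<lfloor>ln (q x) / (K * ln 3) + real u / K\<rfloor>"
  have [measurable]: "?j \<in> M \<rightarrow>\<^sub>M count_space UNIV" by measurable
  have "(\<lambda>x. (?j x, \<lfloor>y x / grid_scale K (?j x) + real u / K\<rfloor>)) \<in> M \<rightarrow>\<^sub>M count_space UNIV"
    by (rule measurable_compose_countable[where g="?j" and f="\<lambda>j x. (j, \<lfloor>y x / grid_scale K j + real u / K\<rfloor>)"]) measurable
  then show ?thesis by (simp add: grid_cell_def Let_def)
qed

text \<open>Blocks from number \<open>n div m\<close> on would read coordinates outside the data
  set; by \<open>release_cong\<close> their votes may be replaced by a constant.\<close>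

lemma restricted_vote_measurable:
  "(\<lambda>X. (if g < n div m then block_vote K m u X g else (0, 0))) \<in> datasets n \<rightarrow>\<^sub>M count_space UNIV"
  unfolding block_vote_def
  by (cases "g < n div m") (auto intro!: grid_cell_measurable block_mean_measurable block_var_measurable)

lemma release_cong:
  assumes "\<And>g. g < G \<Longrightarrow> w g = w' g" shows "release b T G v\<^sub>0 w = release b T G v\<^sub>0 w'"
proof -
  have t: "tally G w = tally G w'" unfolding tally_def using assms by (intro ext arg_cong[where f=real] arg_cong[where f=card]) auto
  then have mj: "majority G v\<^sub>0 w = majority G v\<^sub>0 w'" by (simp add: majority_def)
  show ?thesis unfolding release_def margin_def t mj ..
qed

lemma block_release_measurable:
  assumes "0 < b"
  shows "(\<lambda>X. release b T (n div m) (0, 0) (block_vote K m u X)) \<in> datasets n \<rightarrow>\<^sub>M prob_algebra (count_space UNIV)"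
proof -
  have "release b T (n div m) (0, 0) (block_vote K m u X) =
     release b T (n div m) (0, 0) (\<lambda>g. if g < n div m then block_vote K m u X g else (0, 0))" for X
    by (rule release_cong) simp
  then show ?thesis using release_measurable[OF assms restricted_vote_measurable] by simp
qed

text \<open>Record \<open>i\<close> can only lie in block \<open>i div m\<close>, so a change of one
  record changes at most one ballot; a leftover record at the end changes none.\<close>

lemma block_vote_neighbour:
  assumes nb: "neighbours n X X'"
  obtains g\<^sub>0 where "\<And>g. g < n div m \<Longrightarrow> g \<noteq> g\<^sub>0 \<Longrightarrow> block_vote K m u X g = block_vote K m u X' g"
proof -
  obtain i where i: "i < n" "\<And>j. j < n \<Longrightarrow> j \<noteq> i \<Longrightarrow> X j = X' j" using nb by (auto simp: neighbours_def)
  show ?thesis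
  proof
    fix g assume g: "g < n div m" "g \<noteq> i div m"
    have "i \<notin> {g * m..<(g + 1) * m}"
    proof
      assume "i \<in> {g * m..<(g + 1) * m}"
      then have "i div m = g" by (intro div_nat_eqI) (auto simp: mult.commute)
      then show False using g by simp
    qed
    then have eq: "X j = X' j" if "j \<in> {g * m..<(g + 1) * m}" for j
      using i(2)[of j] that block_subset[OF g(1)] by auto
    have "(\<Sum>i\<in>{g * m..<(g + 1) * m}. X i) = (\<Sum>i\<in>{g * m..<(g + 1) * m}. X' i)"
      by (intro sum.cong refl eq)
    then have bm: "block_mean m g X = block_mean m g X'" unfolding block_mean_def by (rule arg_cong)
    have "(\<Sum>i\<in>{g * m..<(g + 1) * m}. (X i - block_mean m g X')\<^sup>2) = (\<Sum>i\<in>{g * m..<(g + 1) * m}. (X' i - block_mean m g X')\<^sup>2)"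
      by (intro sum.cong refl) (simp only: eq)
    then have "block_var m g X = block_var m g X'" unfolding block_var_def bm by (rule arg_cong)
    with bm show "block_vote K m u X g = block_vote K m u X' g" by (simp add: block_vote_def)
  qed
qed

section \<open>Measurability and privacy of the mean estimator\<close>

context
  fixes n K m :: nat and \<epsilon> \<delta> H :: real
  assumes pos: "0 < n" "0 < K" "0 < \<epsilon>" "0 < \<delta>" "\<delta> \<le> 1" "0 < H"
begin

lemma second_stage_measurable:
  "(\<lambda>v. clip_release n \<epsilon> (cell_corner K u v) (H * grid_scale K (fst v)) X) \<in> count_space UNIV \<rightarrow>\<^sub>M prob_algebra borel"
  if "X \<in> space (datasets n)"
  using measurable_space[OF clip_release_measurable that] pos grid_scale_pos[OF pos(2)] by auto

lemma shifted_estimator_measurable: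
  "shifted_estimator n \<epsilon> \<delta> K m H u \<in> datasets n \<rightarrow>\<^sub>M prob_algebra borel"
proof -
  have k: "(\<lambda>(X, v). clip_release n \<epsilon> (cell_corner K u v) (H * grid_scale K (fst v)) X) \<in> datasets n \<Otimes>\<^sub>M count_space UNIV \<rightarrow>\<^sub>M prob_algebra borel"
    unfolding case_prod_beta'
    by (rule measurable_compose_countable[where g=snd and f="\<lambda>v p. clip_release n \<epsilon> (cell_corner K u v) (H * grid_scale K (fst v)) (fst p)"])
       (use pos grid_scale_pos[OF pos(2)] in \<open>auto intro!: measurable_compose[OF measurable_fst clip_release_measurable]\<close>)
  show ?thesis unfolding shifted_estimator_def[abs_def]
    by (rule measurable_bind_prob_space2[OF block_release_measurable k]) (use pos in simp)
qed

lemma shifts_in_prob_algebra: "measure_pmf (pmf_of_set {..<K}) \<in> space (prob_algebra (count_space UNIV))"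
  by (simp add: space_prob_algebra measure_pmf.prob_space_axioms)

lemma shifted_estimator_kernel:
  "X \<in> space (datasets n) \<Longrightarrow> (\<lambda>u. shifted_estimator n \<epsilon> \<delta> K m H u X) \<in> count_space UNIV \<rightarrow>\<^sub>M prob_algebra borel"
  using measurable_space[OF shifted_estimator_measurable] by auto

lemma mean_estimator_measurable:
  "mean_estimator n \<epsilon> \<delta> K m H \<in> datasets n \<rightarrow>\<^sub>M prob_algebra borel"
proof -
  have "(\<lambda>(X, u). shifted_estimator n \<epsilon> \<delta> K m H u X) \<in> datasets n \<Otimes>\<^sub>M count_space UNIV \<rightarrow>\<^sub>M prob_algebra borel"
    unfolding case_prod_beta'
    by (rule measurable_compose_countable[where g=snd and f="\<lambda>u p. shifted_estimator n \<epsilon> \<delta> K m H u (fst p)"])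
       (auto intro!: measurable_compose[OF measurable_fst shifted_estimator_measurable])
  then show ?thesis unfolding mean_estimator_def[abs_def]
    by (rule measurable_bind_prob_space2[rotated]) (use shifts_in_prob_algebra in simp)
qed

text \<open>The shift does not depend on the data and is free. The release of the cell costs
  (\<epsilon>, \<delta>), and the clipped average, for each possible cell, costs (\<epsilon>,
  0).\<close>

lemma mean_estimator_private: "DP n borel (2 * \<epsilon>) \<delta> (mean_estimator n \<epsilon> \<delta> K m H)"
proof (rule DP_I[OF mean_estimator_measurable])
  fix X X' assume nb: "neighbours n X X'"
  then have X: "X \<in> space (datasets n)" "X' \<in> space (datasets n)" by (auto simp: neighbours_def)
  have "close (\<epsilon> + \<epsilon>) (\<delta> + 0) (shifted_estimator n \<epsilon> \<delta> K m H u X) (shifted_estimator n \<epsilon> \<delta> K m H u X')" for u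
    unfolding shifted_estimator_def
  proof (rule close_bind[OF _ _ second_stage_measurable second_stage_measurable])
    obtain g\<^sub>0 where g: "\<And>g. g < n div m \<Longrightarrow> g \<noteq> g\<^sub>0 \<Longrightarrow> block_vote K m u X g = block_vote K m u X' g"
      using block_vote_neighbour[OF nb] by metis
    have "close (1 / (1 / \<epsilon>)) \<delta> (release (1 / \<epsilon>) (ln (1 / \<delta>) / \<epsilon>) (n div m) (0, 0) (block_vote K m u X))
       (release (1 / \<epsilon>) (ln (1 / \<delta>) / \<epsilon>) (n div m) (0, 0) (block_vote K m u X'))"
    proof (rule release_close[OF _ _ _ g])
      show "0 \<le> ln (1 / \<delta>) / \<epsilon>" using pos by (intro divide_nonneg_pos ln_ge_zero) auto
    qed (use pos in \<open>auto simp: exp_minus ln_div\<close>)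
    then show "close \<epsilon> \<delta> (release (1 / \<epsilon>) (ln (1 / \<delta>) / \<epsilon>) (n div m) (0, 0) (block_vote K m u X))
       (release (1 / \<epsilon>) (ln (1 / \<delta>) / \<epsilon>) (n div m) (0, 0) (block_vote K m u X'))" by simp
    show "close \<epsilon> 0 (clip_release n \<epsilon> (cell_corner K u v) (H * grid_scale K (fst v)) X) (clip_release n \<epsilon> (cell_corner K u v) (H * grid_scale K (fst v)) X')" for v
      by (rule clip_release_close[OF _ _ _ nb]) (use pos grid_scale_pos[OF pos(2)] in auto)
  qed (use X pos measurable_space[OF block_release_measurable] in auto)
  then have "close (0 + (\<epsilon> + \<epsilon>)) (0 + (\<delta> + 0)) (mean_estimator n \<epsilon> \<delta> K m H X) (mean_estimator n \<epsilon> \<delta> K m H X')"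
    unfolding mean_estimator_def
    by (intro close_bind[OF shifts_in_prob_algebra shifts_in_prob_algebra shifted_estimator_kernel shifted_estimator_kernel] X close_refl)
       (use pos in auto)
  then show "close (2 * \<epsilon>) \<delta> (mean_estimator n \<epsilon> \<delta> K m H X) (mean_estimator n \<epsilon> \<delta> K m H X')" by simp
qed

lemma measure_mean_estimator:
  assumes Q: "prob_space Q" "sets Q = sets borel" and E: "E \<in> sets borel"
  shows "measure (iid n Q \<bind> mean_estimator n \<epsilon> \<delta> K m H) E =
    (\<Sum>u<K. measure (iid n Q \<bind> shifted_estimator n \<epsilon> \<delta> K m H u) E) / K"
proof -
  have iid: "iid n Q \<in> space (prob_algebra (datasets n))" using Q by (rule iid_in_prob_algebra)
  note b = measure_bind_prob[OF iid shifted_estimator_measurable E]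
  have sp: "space (iid n Q) = space (datasets n)" using sets_iid[OF Q(2)] by (rule sets_eq_imp_space_eq)
  have "measure (iid n Q \<bind> mean_estimator n \<epsilon> \<delta> K m H) E = (\<integral>X. measure (mean_estimator n \<epsilon> \<delta> K m H X) E \<partial>iid n Q)"
    by (rule measure_bind_prob(1)[OF iid mean_estimator_measurable E])
  also have "\<dots> = (\<integral>X. (\<Sum>u<K. measure (shifted_estimator n \<epsilon> \<delta> K m H u X) E) / K \<partial>iid n Q)"
  proof (rule Bochner_Integration.integral_cong[OF refl])
    fix X assume "X \<in> space (iid n Q)"
    then have X: "X \<in> space (datasets n)" by (simp add: sp)
    have "measure (mean_estimator n \<epsilon> \<delta> K m H X) E = (\<integral>u. measure (shifted_estimator n \<epsilon> \<delta> K m H u X) E \<partial>measure_pmf (pmf_of_set {..<K}))"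
      unfolding mean_estimator_def by (rule measure_bind_prob(1)[OF shifts_in_prob_algebra shifted_estimator_kernel[OF X] E])
    also have "\<dots> = (\<Sum>u<K. measure (shifted_estimator n \<epsilon> \<delta> K m H u X) E) / K"
      using pos(2) by (subst integral_pmf_of_set) (auto simp: lessThan_empty_iff)
    finally show "measure (mean_estimator n \<epsilon> \<delta> K m H X) E = (\<Sum>u<K. measure (shifted_estimator n \<epsilon> \<delta> K m H u X) E) / K" .
  qed
  also have "\<dots> = (\<Sum>u<K. \<integral>X. measure (shifted_estimator n \<epsilon> \<delta> K m H u X) E \<partial>iid n Q) / K"
    unfolding integral_divide_zero by (subst Bochner_Integration.integral_sum) (use b(3) in auto)
  also have "\<dots> = (\<Sum>u<K. measure (iid n Q \<bind> shifted_estimator n \<epsilon> \<delta> K m H u) E) / K"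
    by (simp add: b(1))
  finally show ?thesis .
qed

end

section \<open>Size and position of the winning cell\<close>

lemma exp_half_ln: "0 < x \<Longrightarrow> exp (ln x / 2) = sqrt x"
  by (rule real_sqrt_unique[symmetric]) (simp_all add: power2_eq_square flip: exp_add)

text \<open>The lower bound keeps the location uncertainty small against the cell; the upper bound
  limits bias and noise of the second stage. The price is \<open>3 ^ K\<close>: the top of cell
  \<open>j\<close> may lie two logarithmic cells above \<open>a\<close>, and two cells of length
  \<open>K * ln 3\<close> in the variance are a factor \<open>3 ^ K\<close> in the standard
  deviation.\<close>

lemma grid_scale_bounds:
  assumes K: "0 < K" and S: "0 < S" and a: "a = ln (S / 2) / (K * ln 3)"
  shows "\<lfloor>a\<rfloor> \<le> j \<Longrightarrow> real K * sqrt S \<le> grid_scale K j"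
    and "j \<le> \<lfloor>a\<rfloor> + 1 \<Longrightarrow> grid_scale K j \<le> 2 * real K * 3 ^ K * sqrt S"
proof -
  have l3: "0 < K * ln (3::real)" using K by simp
  have aK: "K * ln 3 * a = ln (S / 2)" using l3 K by (simp add: a)
  have sS: "sqrt (S / 2) \<le> sqrt S" "sqrt S \<le> 2 * sqrt (S / 2)"
  proof -
    show "sqrt (S / 2) \<le> sqrt S" using S by simp
    have "sqrt S \<le> sqrt (4 * (S / 2))" using S by simp
    also have "\<dots> = 2 * sqrt (S / 2)" by (subst real_sqrt_mult) simp
    finally show "sqrt S \<le> 2 * sqrt (S / 2)" .
  qed
  show "real K * sqrt S \<le> grid_scale K j" if "\<lfloor>a\<rfloor> \<le> j"
  proof -
    have "a \<le> j + 1" using that by linarith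
    then have "K * ln 3 * a \<le> K * ln 3 * (j + 1)" using l3 by (intro mult_left_mono) auto
    then have "sqrt (S / 2) \<le> exp (K * ln 3 * (j + 1) / 2)" using S by (simp add: aK flip: exp_half_ln)
    then have "K * (2 * sqrt (S / 2)) \<le> grid_scale K j" using K by (simp add: grid_scale_def)
    then show ?thesis using sS(2) K by (meson dual_order.trans mult_left_mono of_nat_0_le_iff)
  qed
  show "grid_scale K j \<le> 2 * real K * 3 ^ K * sqrt S" if "j \<le> \<lfloor>a\<rfloor> + 1"
  proof -
    have "j + 1 \<le> a + 2" using that by linarith
    then have "K * ln 3 * (j + 1) \<le> K * ln 3 * (a + 2)" using l3 by (intro mult_left_mono) auto
    then have "exp (K * ln 3 * (j + 1) / 2) \<le> exp (ln (S / 2) / 2 + K * ln 3)" using aK by (simp add: distrib_left)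
    also have "\<dots> = sqrt (S / 2) * 3 ^ K" using S by (simp add: exp_add exp_half_ln exp_of_nat_mult)
    also have "\<dots> \<le> sqrt S * 3 ^ K" by (intro mult_right_mono sS) simp
    finally have "2 * real K * exp (K * ln 3 * (j + 1) / 2) \<le> 2 * real K * (sqrt S * 3 ^ K)" by (rule mult_left_mono) simp
    then have "grid_scale K j \<le> 2 * real K * (sqrt S * 3 ^ K)" by (simp add: grid_scale_def)
    then show ?thesis by (simp add: mult_ac)
  qed
qed

text \<open>At most three shifts are bad: one for the logarithm of the variance, and one for the mean at each of the
  two possible scales.\<close>

lemma good_shifts:
  assumes K: "0 < K" and S: "0 < S"
  obtains Bad :: "nat set" and v :: "nat \<Rightarrow> int \<times> int" where "finite Bad" "card Bad \<le> 3"
    "\<And>u q y. u < K \<Longrightarrow> u \<notin> Bad \<Longrightarrow> S / 2 \<le> q \<Longrightarrow> q \<le> 3 * S / 2 \<Longrightarrow> \<bar>y - t\<bar> \<le> sqrt S / 2 \<Longrightarrow> grid_cell K u q y = v u"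
    "\<And>u. u < K \<Longrightarrow> u \<notin> Bad \<Longrightarrow> real K * sqrt S \<le> grid_scale K (fst (v u))"
    "\<And>u. u < K \<Longrightarrow> u \<notin> Bad \<Longrightarrow> grid_scale K (fst (v u)) \<le> 2 * real K * 3 ^ K * sqrt S"
    "\<And>u. u < K \<Longrightarrow> u \<notin> Bad \<Longrightarrow> \<bar>t - cell_corner K u (v u)\<bar> \<le> 2 * grid_scale K (fst (v u))"
proof -
  define a where "a = ln (S / 2) / (K * ln 3)"
  define b where "b = ln (3 * S / 2) / (K * ln 3)"
  define lo where "lo j = (t - sqrt S / 2) / grid_scale K j" for j
  define hi where "hi j = (t + sqrt S / 2) / grid_scale K j" for j
  define B0 where "B0 = {u. u < K \<and> \<lfloor>a + real u / K\<rfloor> \<noteq> \<lfloor>b + real u / K\<rfloor>}"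
  define B1 where "B1 j = {u. u < K \<and> \<lfloor>lo j + real u / K\<rfloor> \<noteq> \<lfloor>hi j + real u / K\<rfloor>}" for j
  have l3: "0 < K * ln (3::real)" using K by simp
  note sc = grid_scale_bounds[OF K S a_def]
  have sp: "0 < grid_scale K j" for j using grid_scale_pos[OF K] .
  \<comment> \<open>The end points differ by the factor 3, so in units of cells the interval has
    length exactly 1/K.\<close>
  have "ln (3 * S / 2) = ln 3 + ln (S / 2)" using S ln_mult[of 3 "S / 2"] by simp
  then have ba: "b - a = 1 / K" using l3 K by (simp add: a_def b_def add_divide_distrib)
  have c0: "card B0 \<le> 1" unfolding B0_def
  proof (rule floor_shift_bad[OF K])
    have "0 \<le> 1 / real K" by simp
    then show "a \<le> b" using ba by linarith
  qed (use ba in simp)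
  have c1: "card (B1 j) \<le> 1" if "\<lfloor>a\<rfloor> \<le> j" for j
  proof -
    have "hi j - lo j = sqrt S / grid_scale K j" by (simp add: hi_def lo_def flip: diff_divide_distrib)
    also have "\<dots> \<le> 1 / K" using sc(1)[OF that] sp[of j] K by (simp add: field_simps)
    finally have "hi j - lo j \<le> 1 / K" .
    moreover have "lo j \<le> hi j" unfolding lo_def hi_def using sp[of j] S by (intro divide_right_mono) auto
    ultimately show ?thesis unfolding B1_def using floor_shift_bad[OF K] by blast
  qed
  define Bad where "Bad = B0 \<union> (B1 \<lfloor>a\<rfloor> \<union> B1 (\<lfloor>a\<rfloor> + 1))"
  define j where "j u = \<lfloor>a + real u / K\<rfloor>" for u
  define v where "v u = (j u, \<lfloor>lo (j u) + real u / K\<rfloor>)" for u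
  have jr: "\<lfloor>a\<rfloor> \<le> j u" "j u \<le> \<lfloor>a\<rfloor> + 1" "j u = \<lfloor>a\<rfloor> \<or> j u = \<lfloor>a\<rfloor> + 1" if "u < K" for u
  proof -
    have "0 \<le> real u / K" "real u / K < 1" using that by auto
    then show "\<lfloor>a\<rfloor> \<le> j u" "j u \<le> \<lfloor>a\<rfloor> + 1" unfolding j_def by linarith+
    then show "j u = \<lfloor>a\<rfloor> \<or> j u = \<lfloor>a\<rfloor> + 1" by linarith
  qed
  have fin: "finite Bad" by (simp add: Bad_def B0_def B1_def)
  have crd: "card Bad \<le> 3"
  proof -
    have "card Bad \<le> card B0 + (card (B1 \<lfloor>a\<rfloor>) + card (B1 (\<lfloor>a\<rfloor> + 1)))"
      unfolding Bad_def by (meson card_Un_le add_left_mono order_trans)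
    also have "\<dots> \<le> 1 + (1 + 1)" by (intro add_mono c0 c1) auto
    finally show "card Bad \<le> 3" by simp
  qed
  have main: "(\<forall>q y. S / 2 \<le> q \<longrightarrow> q \<le> 3 * S / 2 \<longrightarrow> \<bar>y - t\<bar> \<le> sqrt S / 2 \<longrightarrow> grid_cell K u q y = v u) \<and>
      real K * sqrt S \<le> grid_scale K (fst (v u)) \<and> grid_scale K (fst (v u)) \<le> 2 * real K * 3 ^ K * sqrt S \<and>
      \<bar>t - cell_corner K u (v u)\<bar> \<le> 2 * grid_scale K (fst (v u))" if u: "u < K" "u \<notin> Bad" for u
  proof (intro conjI allI impI)
    have e0: "\<lfloor>a + real u / K\<rfloor> = \<lfloor>b + real u / K\<rfloor>" using u by (auto simp: Bad_def B0_def)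
    have e1: "\<lfloor>lo (j u) + real u / K\<rfloor> = \<lfloor>hi (j u) + real u / K\<rfloor>" using u jr(3)[OF u(1)] by (auto simp: Bad_def B1_def)
    show s1: "real K * sqrt S \<le> grid_scale K (fst (v u))" "grid_scale K (fst (v u)) \<le> 2 * real K * 3 ^ K * sqrt S"
      using sc jr[OF u(1)] by (auto simp: v_def)
    show "grid_cell K u q y = v u" if q: "S / 2 \<le> q" "q \<le> 3 * S / 2" and y: "\<bar>y - t\<bar> \<le> sqrt S / 2" for q y
    proof -
      have "a \<le> ln q / (K * ln 3)" "ln q / (K * ln 3) \<le> b"
        unfolding a_def b_def using q S l3 by (auto intro!: divide_right_mono)
      then have J: "\<lfloor>ln q / (K * ln 3) + real u / K\<rfloor> = j u" unfolding j_def by (rule floor_shift_eq[OF e0])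
      have "lo (j u) \<le> y / grid_scale K (j u)" "y / grid_scale K (j u) \<le> hi (j u)"
        unfolding lo_def hi_def using y less_imp_le[OF sp[of "j u"]] by (intro divide_right_mono; linarith)+
      then have "\<lfloor>y / grid_scale K (j u) + real u / K\<rfloor> = \<lfloor>lo (j u) + real u / K\<rfloor>" by (rule floor_shift_eq[OF e1])
      then show ?thesis unfolding grid_cell_def Let_def J v_def by simp
    qed
    let ?s = "grid_scale K (j u)"
    have c: "cell_corner K u (v u) = ?s * (\<lfloor>lo (j u) + real u / K\<rfloor> - real u / K)" by (simp add: cell_corner_def v_def)
    \<comment> \<open>The corner lies at most one cell below \<open>t - sqrt S / 2\<close>, and
      \<open>sqrt S / 2\<close> is itself less than a cell.\<close>
    have "\<lfloor>lo (j u) + real u / K\<rfloor> - real u / K \<le> lo (j u)" "lo (j u) - 1 \<le> \<lfloor>lo (j u) + real u / K\<rfloor> - real u / K" by linarith+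
    then have "cell_corner K u (v u) \<le> ?s * lo (j u)" "?s * (lo (j u) - 1) \<le> cell_corner K u (v u)"
      unfolding c using sp[of "j u"] by (intro mult_left_mono; simp)+
    moreover have "?s * lo (j u) = t - sqrt S / 2" using sp[of "j u"] by (simp add: lo_def)
    moreover have "sqrt S \<le> ?s"
    proof -
      have "1 * sqrt S \<le> real K * sqrt S" using K S by (intro mult_right_mono) auto
      then show ?thesis using s1(1) by (simp add: v_def)
    qed
    ultimately have bounds: "cell_corner K u (v u) \<le> ?s * lo (j u)" "?s * (lo (j u) - 1) \<le> cell_corner K u (v u)"
      "?s * lo (j u) = t - sqrt S / 2" "sqrt S \<le> ?s" by blast+
    show "\<bar>t - cell_corner K u (v u)\<bar> \<le> 2 * grid_scale K (fst (v u))"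
    proof -
      have "fst (v u) = j u" by (simp add: v_def)
      moreover have "0 < sqrt S" using S by simp
      moreover have "?s * (lo (j u) - 1) = ?s * lo (j u) - ?s" by (simp add: right_diff_distrib)
      ultimately show ?thesis using bounds by (simp only:)
    qed
  qed
  show ?thesis by (rule that[OF fin crd]) (use main in blast)+
qed

text \<open>Steiner's identity exchanges the random block mean for a fixed centre, after which the
  sum consists of independent terms and Chebyshev's inequality applies.\<close>

lemma block_var_eq:
  assumes m: "0 < m"
  shows "block_var m g X = (\<Sum>i\<in>{g * m..<(g + 1) * m}. (X i - t)\<^sup>2) / m - (block_mean m g X - t)\<^sup>2"
proof -
  let ?J = "{g * m..<(g + 1) * m}" and ?b = "block_mean m g X"
  have card: "card ?J = m" by simp
  have sumb: "(\<Sum>i\<in>?J. X i) = m * ?b" using m by (simp add: block_mean_def)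
  have "(\<Sum>i\<in>?J. (X i - ?b)\<^sup>2) = (\<Sum>i\<in>?J. (X i - t)\<^sup>2 - (2 * (?b - t) * X i - (?b\<^sup>2 - t\<^sup>2)))"
    by (intro sum.cong refl) (simp add: power2_eq_square algebra_simps)
  also have "\<dots> = (\<Sum>i\<in>?J. (X i - t)\<^sup>2) - (2 * (?b - t) * (\<Sum>i\<in>?J. X i) - (\<Sum>i\<in>?J. ?b\<^sup>2 - t\<^sup>2))"
    by (simp only: sum_subtractf sum_distrib_left)
  also have "\<dots> = (\<Sum>i\<in>?J. (X i - t)\<^sup>2) - m * (?b - t)\<^sup>2"
    unfolding sumb sum_constant card by (simp add: power2_eq_square algebra_simps)
  finally show ?thesis unfolding block_var_def using m by (simp add: diff_divide_distrib)
qed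

section \<open>Accuracy of the private mean estimator\<close>

context exp_family
begin

text \<open>Outside this event the second moment about the true mean is within S/4 of S, and
  Steiner's correction is at most S/4. So the block variance lies between S/2 and 3S/2, the range
  that \<open>good_shifts\<close> expects.\<close>

definition bad_block :: "real \<Rightarrow> nat \<Rightarrow> nat \<Rightarrow> (nat \<Rightarrow> real) \<Rightarrow> bool" where
  "bad_block \<theta> m g X \<longleftrightarrow>
     log_partition'' \<mu> \<theta> / 4 \<le> \<bar>(\<Sum>i\<in>{g * m..<(g + 1) * m}. (X i - log_partition' \<mu> \<theta>)\<^sup>2) / card {g * m..<(g + 1) * m} - log_partition'' \<mu> \<theta>\<bar> \<or>
     sqrt (log_partition'' \<mu> \<theta>) / 2 \<le> \<bar>(\<Sum>i\<in>{g * m..<(g + 1) * m}. X i) / card {g * m..<(g + 1) * m} - log_partition' \<mu> \<theta>\<bar>"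

lemma good_block:
  assumes m: "0 < m" and \<theta>: "\<theta> \<in> interior \<Phi>" and good: "\<not> bad_block \<theta> m g X"
  defines "S \<equiv> log_partition'' \<mu> \<theta>"
  shows "S / 2 \<le> block_var m g X" "block_var m g X \<le> 3 * S / 2" "\<bar>block_mean m g X - log_partition' \<mu> \<theta>\<bar> \<le> sqrt S / 2"
proof -
  have Spos: "0 < S" unfolding S_def by (rule A''_pos[OF \<theta>])
  define Q where "Q = (\<Sum>i\<in>{g * m..<(g + 1) * m}. (X i - log_partition' \<mu> \<theta>)\<^sup>2) / m"
  have Q: "\<bar>Q - S\<bar> < S / 4" using good by (simp add: bad_block_def Q_def S_def)
  have b: "\<bar>block_mean m g X - log_partition' \<mu> \<theta>\<bar> < sqrt S / 2" using good by (simp add: bad_block_def block_mean_def S_def)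
  then show "\<bar>block_mean m g X - log_partition' \<mu> \<theta>\<bar> \<le> sqrt S / 2" by simp
  have "\<bar>block_mean m g X - log_partition' \<mu> \<theta>\<bar>\<^sup>2 \<le> (sqrt S / 2)\<^sup>2" using b by (intro power_mono) auto
  then have "(block_mean m g X - log_partition' \<mu> \<theta>)\<^sup>2 \<le> S / 4" using Spos by (simp add: power_divide)
  moreover have "0 \<le> (block_mean m g X - log_partition' \<mu> \<theta>)\<^sup>2" by simp
  ultimately show "S / 2 \<le> block_var m g X" "block_var m g X \<le> 3 * S / 2"
    using Q block_var_eq[OF m, of g X "log_partition' \<mu> \<theta>"] Spos unfolding Q_def[symmetric] by linarith+
qed

text \<open>All parts come from the variance of the squared deviation, which is the fourth central
  moment minus the squared variance. The first one yields \<zeta> \<ge> 1 later; the others feed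
  Chebyshev's inequality for block second moments.\<close>

lemma fourth_moment_ge:
  assumes \<theta>: "\<theta> \<in> interior \<Phi>"
  shows "(log_partition'' \<mu> \<theta>)\<^sup>2 \<le> (\<integral>x. (x - log_partition' \<mu> \<theta>) ^ 4 \<partial>P \<theta>)"
    and "integrable (P \<theta>) (\<lambda>x. ((x - log_partition' \<mu> \<theta>)\<^sup>2 - log_partition'' \<mu> \<theta>)\<^sup>2)"
    and "(\<integral>x. ((x - log_partition' \<mu> \<theta>)\<^sup>2 - log_partition'' \<mu> \<theta>)\<^sup>2 \<partial>P \<theta>) \<le> (\<integral>x. (x - log_partition' \<mu> \<theta>) ^ 4 \<partial>P \<theta>)"
proof -
  let ?t = "log_partition' \<mu> \<theta>" and ?S = "log_partition'' \<mu> \<theta>"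
  interpret prob_space "P \<theta>" by (rule prob_space_P[OF interiorD[OF \<theta>]])
  have pU: "prob UNIV = 1" using prob_space by simp
  have i4: "integrable (P \<theta>) (\<lambda>x. (x - ?t) ^ 4)" and i2: "integrable (P \<theta>) (\<lambda>x. (x - ?t)\<^sup>2)"
    by (rule integrable_power_minus[OF \<theta>])+
  have eq: "(\<lambda>x. ((x - ?t)\<^sup>2 - ?S)\<^sup>2) = (\<lambda>x. (x - ?t) ^ 4 - (2 * ?S * (x - ?t)\<^sup>2 - ?S\<^sup>2))"
  proof
    have "(y\<^sup>2 - s)\<^sup>2 = y ^ 4 - (2 * s * y\<^sup>2 - s\<^sup>2)" for y s :: real by (simp add: power2_diff)
    then show "((x - ?t)\<^sup>2 - ?S)\<^sup>2 = (x - ?t) ^ 4 - (2 * ?S * (x - ?t)\<^sup>2 - ?S\<^sup>2)" for x .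
  qed
  have i: "integrable (P \<theta>) (\<lambda>x. 2 * ?S * (x - ?t)\<^sup>2 - ?S\<^sup>2)"
    by (intro Bochner_Integration.integrable_diff integrable_mult_right i2 integrable_const)
  show "integrable (P \<theta>) (\<lambda>x. ((x - ?t)\<^sup>2 - ?S)\<^sup>2)" unfolding eq by (rule Bochner_Integration.integrable_diff[OF i4 i])
  have "(\<integral>x. 2 * ?S * (x - ?t)\<^sup>2 - ?S\<^sup>2 \<partial>P \<theta>) = 2 * ?S * ?S - ?S\<^sup>2"
    using i2 pU by (subst Bochner_Integration.integral_diff) (simp_all add: variance_P[OF \<theta>])
  then have E: "(\<integral>x. ((x - ?t)\<^sup>2 - ?S)\<^sup>2 \<partial>P \<theta>) = (\<integral>x. (x - ?t) ^ 4 \<partial>P \<theta>) - ?S\<^sup>2"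
    unfolding eq using Bochner_Integration.integral_diff[OF i4 i] by (simp add: power2_eq_square)
  then show "(\<integral>x. ((x - ?t)\<^sup>2 - ?S)\<^sup>2 \<partial>P \<theta>) \<le> (\<integral>x. (x - ?t) ^ 4 \<partial>P \<theta>)" by simp
  have "0 \<le> (\<integral>x. ((x - ?t)\<^sup>2 - ?S)\<^sup>2 \<partial>P \<theta>)" by (intro integral_nonneg_AE) auto
  then show "?S\<^sup>2 \<le> (\<integral>x. (x - ?t) ^ 4 \<partial>P \<theta>)" using E by simp
qed

lemma bad_block_measurable:
  assumes "g < n div m"
  shows "{X \<in> space (iid n (P \<theta>)). bad_block \<theta> m g X} \<in> sets (iid n (P \<theta>))"
proof -
  have m: "(\<lambda>X. (X i - a)) \<in> borel_measurable (iid n (P \<theta>))" if "i \<in> {g * m..<(g + 1) * m}" for i a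
    using datasets_component[of i n] block_subset[OF assms] that
    by (intro borel_measurable_diff borel_measurable_const) (auto simp: measurable_cong_sets[OF sets_iid[OF sets_P] refl])
  have [measurable]: "(\<lambda>X. \<Sum>i\<in>{g * m..<(g + 1) * m}. (X i - log_partition' \<mu> \<theta>)\<^sup>2) \<in> borel_measurable (iid n (P \<theta>))"
    by (intro borel_measurable_sum borel_measurable_power m)
  have [measurable]: "(\<lambda>X. \<Sum>i\<in>{g * m..<(g + 1) * m}. X i) \<in> borel_measurable (iid n (P \<theta>))"
    using m[of _ 0] by (intro borel_measurable_sum) simp
  show ?thesis unfolding bad_block_def by measurable
qed

text \<open>Chebyshev's inequality gives 16\<zeta>/m for the second moment and 4/m for the mean. As
  \<zeta> \<ge> 1 the sum is at most 20\<zeta>/m, and m \<ge> 2000\<zeta> makes this 1/100.\<close>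

lemma bad_block_prob:
  assumes \<theta>: "\<theta> \<in> interior \<Phi>" and g: "g < n div m"
    and m4: "(\<integral>x. (x - log_partition' \<mu> \<theta>) ^ 4 \<partial>P \<theta>) \<le> \<zeta> * (log_partition'' \<mu> \<theta>)\<^sup>2" and m: "0 < m" "2000 * \<zeta> \<le> m"
  shows "measure (iid n (P \<theta>)) {X \<in> space (iid n (P \<theta>)). bad_block \<theta> m g X} \<le> 1 / 100"
proof -
  let ?t = "log_partition' \<mu> \<theta>" and ?S = "log_partition'' \<mu> \<theta>" and ?J = "{g * m..<(g + 1) * m}"
  have P: "prob_space (P \<theta>)" "sets (P \<theta>) = sets borel" by (simp_all add: prob_space_P interiorD \<theta>)
  interpret X: prob_space "iid n (P \<theta>)" by (rule prob_space_iid[OF P(1)])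
  have Spos: "0 < ?S" by (rule A''_pos[OF \<theta>])
  have J: "?J \<subseteq> {..<n}" "?J \<noteq> {}" using block_subset[OF g] m by auto
  have card: "card ?J = m" by simp
  have \<zeta>: "1 \<le> \<zeta>" using order_trans[OF fourth_moment_ge(1)[OF \<theta>] m4] Spos by simp
  have i: "integrable (P \<theta>) (\<lambda>x. (x - ?t)\<^sup>2)" "integrable (P \<theta>) (\<lambda>x. x)"
    using integrable_power_minus[OF \<theta>] integrable_power[OF \<theta>, of 1] by simp_all
  let ?A = "{X \<in> space (iid n (P \<theta>)). ?S / 4 \<le> \<bar>(\<Sum>i\<in>?J. (X i - ?t)\<^sup>2) / card ?J - ?S\<bar>}"
  let ?B = "{X \<in> space (iid n (P \<theta>)). sqrt ?S / 2 \<le> \<bar>(\<Sum>i\<in>?J. X i) / card ?J - ?t\<bar>}"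
  have "X.prob ?A \<le> (\<zeta> * ?S\<^sup>2) / (card ?J * (?S / 4)\<^sup>2)"
    by (rule iid_average_deviation[OF P J i(1) variance_P[OF \<theta>] fourth_moment_ge(2)[OF \<theta>] order_trans[OF fourth_moment_ge(3)[OF \<theta>] m4]])
       (use Spos in simp)
  also have "\<dots> = 16 * \<zeta> / m" using Spos m by (simp add: card power_divide)
  finally have A: "X.prob ?A \<le> 16 * \<zeta> / m" .
  have "X.prob ?B \<le> ?S / (card ?J * (sqrt ?S / 2)\<^sup>2)"
    by (rule iid_average_deviation[OF P J i(2) mean_P[OF \<theta>] i(1) eq_refl[OF variance_P[OF \<theta>]]]) (use Spos in simp)
  also have "\<dots> = 4 / m" using Spos m by (simp add: card power_divide)
  finally have B: "X.prob ?B \<le> 4 / m" .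
  have ev: "{X \<in> space (iid n (P \<theta>)). bad_block \<theta> m g X} \<subseteq> ?A \<union> ?B" by (auto simp: bad_block_def)
  have comp: "(\<lambda>X. X i - a) \<in> borel_measurable (iid n (P \<theta>))" if "i \<in> ?J" for i a
    using datasets_component[of i n] J(1) that
    by (intro borel_measurable_diff borel_measurable_const) (auto simp: measurable_cong_sets[OF sets_iid[OF sets_P] refl])
  have [measurable]: "(\<lambda>X. \<Sum>i\<in>?J. (X i - ?t)\<^sup>2) \<in> borel_measurable (iid n (P \<theta>))"
    by (intro borel_measurable_sum borel_measurable_power comp)
  have [measurable]: "(\<lambda>X. \<Sum>i\<in>?J. X i) \<in> borel_measurable (iid n (P \<theta>))"
    using comp[of _ 0] by (intro borel_measurable_sum) simp
  have sets: "?A \<in> X.events" "?B \<in> X.events" by measurable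
  have "X.prob {X \<in> space (iid n (P \<theta>)). bad_block \<theta> m g X} \<le> X.prob (?A \<union> ?B)"
    using sets by (intro X.finite_measure_mono[OF ev]) auto
  also have "\<dots> \<le> X.prob ?A + X.prob ?B" using sets by (rule measure_Un_le)
  also have "\<dots> \<le> 16 * \<zeta> / m + 4 / m" using A B by simp
  also have "\<dots> = (16 * \<zeta> + 4) / m" by (simp add: add_divide_distrib)
  also have "\<dots> \<le> 20 * \<zeta> / m" using \<zeta> by (intro divide_right_mono) auto
  also have "\<dots> \<le> 1 / 100" using m \<zeta> by (simp add: field_simps)
  finally show ?thesis .
qed

text \<open>Markov's inequality for the number of bad blocks: an expected share of 1/100 against the
  share 1/5.\<close>

lemma many_bad_blocks_prob:
  assumes \<theta>: "\<theta> \<in> interior \<Phi>" and G: "0 < n div m"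
    and m4: "(\<integral>x. (x - log_partition' \<mu> \<theta>) ^ 4 \<partial>P \<theta>) \<le> \<zeta> * (log_partition'' \<mu> \<theta>)\<^sup>2" and m: "0 < m" "2000 * \<zeta> \<le> m"
  shows "{X \<in> space (iid n (P \<theta>)). real (n div m) / 5 \<le> card {g. g < n div m \<and> bad_block \<theta> m g X}} \<in> sets (iid n (P \<theta>))"
    and "measure (iid n (P \<theta>)) {X \<in> space (iid n (P \<theta>)). real (n div m) / 5 \<le> card {g. g < n div m \<and> bad_block \<theta> m g X}} \<le> 1 / 20"
proof -
  let ?G = "n div m" and ?M = "iid n (P \<theta>)"
  interpret X: prob_space ?M by (rule prob_space_iid[OF prob_space_P[OF interiorD[OF \<theta>]]])
  define D where "D g = {X \<in> space ?M. bad_block \<theta> m g X}" for g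
  have D: "D g \<in> X.events" if "g < ?G" for g unfolding D_def by (rule bad_block_measurable[OF that])
  have pD: "X.prob (D g) \<le> 1 / 100" if "g < ?G" for g unfolding D_def by (rule bad_block_prob[OF \<theta> that m4 m])
  have c: "real (card {g. g < ?G \<and> bad_block \<theta> m g X}) = (\<Sum>g<?G. indicator (D g) X)" if "X \<in> space ?M" for X
  proof -
    have "(\<Sum>g<?G. indicator (D g) X) = (\<Sum>g<?G. if bad_block \<theta> m g X then 1 else (0::real))"
      using that by (intro sum.cong) (auto simp: D_def indicator_def)
    also have "\<dots> = card {g. g < ?G \<and> bad_block \<theta> m g X}" by (simp add: sum.If_cases Int_def)
    finally show ?thesis by simp
  qed
  have eq: "{X \<in> space ?M. real ?G / 5 \<le> card {g. g < ?G \<and> bad_block \<theta> m g X}} = {X \<in> space ?M. real ?G / 5 \<le> (\<Sum>g<?G. indicator (D g) X)}"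
    using c by auto
  have iD: "integrable ?M (indicator (D g) :: _ \<Rightarrow> real)" if "g < ?G" for g
    using D[OF that] X.emeasure_finite[of "D g"] by (intro integrable_real_indicator) (auto simp: less_top[symmetric])
  have i: "integrable ?M (\<lambda>X. \<Sum>g<?G. indicator (D g) X :: real)" using iD by (intro Bochner_Integration.integrable_sum) auto
  then have "(\<lambda>X. \<Sum>g<?G. indicator (D g) X :: real) \<in> borel_measurable ?M" by (rule borel_measurable_integrable)
  then show "{X \<in> space ?M. real ?G / 5 \<le> card {g. g < ?G \<and> bad_block \<theta> m g X}} \<in> sets ?M" unfolding eq by measurable
  have "X.prob {X \<in> space ?M. real ?G / 5 \<le> (\<Sum>g<?G. indicator (D g) X)} \<le> (\<integral>X. (\<Sum>g<?G. indicator (D g) X) \<partial>?M) / (real ?G / 5)"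
    by (rule integral_Markov_inequality_measure[OF i, where A="{}"]) (use G in \<open>auto intro!: sum_nonneg\<close>)
  also have "(\<integral>X. (\<Sum>g<?G. indicator (D g) X) \<partial>?M) = (\<Sum>g<?G. X.prob (D g))"
    using iD D by (subst Bochner_Integration.integral_sum) (auto intro!: sum.cong)
  also have "(\<Sum>g<?G. X.prob (D g)) / (real ?G / 5) \<le> (\<Sum>g<?G. 1 / 100) / (real ?G / 5)"
    by (intro divide_right_mono sum_mono pD) auto
  also have "\<dots> = 1 / 20" using G by simp
  finally show "X.prob {X \<in> space ?M. real ?G / 5 \<le> card {g. g < ?G \<and> bad_block \<theta> m g X}} \<le> 1 / 20" unfolding eq .
qed

text \<open>The sample is good with probability 1 - 1/20 - 1/100 = 47/50, and each of the two
  Laplace draws is small with probability 31/32; the product exceeds 22/25.\<close>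

lemma shifted_estimator_accurate:
  fixes K m n u :: nat and \<zeta> H e \<epsilon> \<delta> :: real
  assumes \<theta>: "\<theta> \<in> interior \<Phi>" and pos: "0 < n" "0 < K" "0 < \<epsilon>" "0 < \<delta>" "\<delta> \<le> 1" "0 < H"
    and m4: "(\<integral>x. (x - log_partition' \<mu> \<theta>) ^ 4 \<partial>P \<theta>) \<le> \<zeta> * (log_partition'' \<mu> \<theta>)\<^sup>2" and m: "0 < m" "2000 * \<zeta> \<le> m"
    and T: "ln (1 / \<delta>) / \<epsilon> + 5 * (1 / \<epsilon>) < 3 * real (n div m) / 10 - 1" and G: "0 < n div m"
    and cell: "\<And>q y. log_partition'' \<mu> \<theta> / 2 \<le> q \<Longrightarrow> q \<le> 3 * log_partition'' \<mu> \<theta> / 2 \<Longrightarrow>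
        \<bar>y - log_partition' \<mu> \<theta>\<bar> \<le> sqrt (log_partition'' \<mu> \<theta>) / 2 \<Longrightarrow> grid_cell K u q y = v"
    and e: "(log_partition'' \<mu> \<theta> + (log_partition' \<mu> \<theta> - cell_corner K u v)\<^sup>2) / (H * grid_scale K (fst v))
      + 10 * sqrt (log_partition'' \<mu> \<theta>) / sqrt n + 5 * (2 * (H * grid_scale K (fst v)) / (n * \<epsilon>)) \<le> e"
  shows "22 / 25 \<le> measure (iid n (P \<theta>) \<bind> shifted_estimator n \<epsilon> \<delta> K m H u) {t. \<bar>t - log_partition' \<mu> \<theta>\<bar> \<le> e}"
proof -
  let ?G = "n div m" and ?M = "iid n (P \<theta>)" and ?t = "log_partition' \<mu> \<theta>" and ?S = "log_partition'' \<mu> \<theta>"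
  have P: "prob_space (P \<theta>)" "sets (P \<theta>) = sets borel" by (simp_all add: prob_space_P interiorD \<theta>)
  interpret X: prob_space ?M by (rule prob_space_iid[OF P(1)])
  let ?c = "cell_corner K u v" and ?B = "H * grid_scale K (fst v)"
  have Bpos: "0 < ?B" using pos grid_scale_pos[OF pos(2)] by simp
  let ?E = "{t. \<bar>t - ?t\<bar> \<le> e}"
  have E: "?E \<in> sets borel" by measurable
  define D1 where "D1 = {X \<in> space ?M. real ?G / 5 \<le> card {g. g < ?G \<and> bad_block \<theta> m g X}}"
  \<comment> \<open>Centre and radius are those of the target cell \<open>v\<close>, which is fixed
    in advance. Chebyshev's inequality therefore applies although both stages read the same
    sample.\<close>
  define D2 where "D2 = {X \<in> space ?M. 10 * sqrt ?S / sqrt n \<le>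
    \<bar>(\<Sum>j<n. clip (- ?B) ?B (X j - ?c)) / n - (\<integral>x. clip (- ?B) ?B (x - ?c) \<partial>P \<theta>)\<bar>}"
  have D1: "D1 \<in> X.events" "X.prob D1 \<le> 1 / 20" unfolding D1_def by (rule many_bad_blocks_prob[OF \<theta> G m4 m])+
  have D2p: "X.prob D2 \<le> 1 / 100" unfolding D2_def by (rule clip_average_deviation[OF \<theta> pos(1)]) (use Bpos in simp)
  have "(\<lambda>X. \<Sum>j<n. clip (- ?B) ?B (X j - ?c)) \<in> borel_measurable ?M"
    unfolding measurable_cong_sets[OF sets_iid[OF P(2)] refl] by (rule clip_average_measurable)
  then have D2: "D2 \<in> X.events" unfolding D2_def by measurable
  have "X.prob (D1 \<union> D2) \<le> 1 / 20 + 1 / 100"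
    using measure_Un_le[OF D1(1) D2] D1(2) D2p by linarith
  then have good: "47 / 50 \<le> X.prob (space ?M - (D1 \<union> D2))" using X.prob_compl[of "D1 \<union> D2"] D1 D2 by simp
  have "space ?M - (D1 \<union> D2) \<in> X.events" using D1 D2 by auto
  then have sA: "space ?M - (D1 \<union> D2) \<in> sets (datasets n)" unfolding sets_iid[OF P(2)] .
  have out: "31 / 32 * (31 / 32) \<le> measure (shifted_estimator n \<epsilon> \<delta> K m H u X) ?E" if X: "X \<in> space ?M - (D1 \<union> D2)" for X
  proof -
    have Xs: "X \<in> space (datasets n)" using X sets_eq_imp_space_eq[OF sets_iid[OF P(2), of n]] by auto
    have few: "real (card {g. g < ?G \<and> bad_block \<theta> m g X}) < real ?G / 5" using X by (auto simp: D1_def)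
    have vote: "block_vote K m u X g = v" if "g < ?G" "\<not> bad_block \<theta> m g X" for g
      unfolding block_vote_def by (rule cell) (use good_block[OF m(1) \<theta> that(2)] in auto)
    have "{..<?G} \<subseteq> {g. g < ?G \<and> block_vote K m u X g = v} \<union> {g. g < ?G \<and> bad_block \<theta> m g X}" using vote by auto
    then have "card {..<?G} \<le> card ({g. g < ?G \<and> block_vote K m u X g = v} \<union> {g. g < ?G \<and> bad_block \<theta> m g X})"
      by (intro card_mono) auto
    also have "\<dots> \<le> card {g. g < ?G \<and> block_vote K m u X g = v} + card {g. g < ?G \<and> bad_block \<theta> m g X}" by (rule card_Un_le)
    finally have "4 * real ?G / 5 \<le> tally ?G (block_vote K m u X) v" unfolding tally_def using few by simp
    then have r: "31 / 32 \<le> measure (release (1 / \<epsilon>) (ln (1 / \<delta>) / \<epsilon>) ?G (0, 0) (block_vote K m u X)) {v}"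
      using pos G T by (intro release_accurate) auto
    have cl: "31 / 32 \<le> measure (clip_release n \<epsilon> ?c ?B X) ?E"
      by (rule clip_release_accurate[OF \<theta> pos(1,3) Bpos _ e]) (use X in \<open>auto simp: D2_def\<close>)
    show ?thesis unfolding shifted_estimator_def
      by (rule measure_bind_ge[OF _ second_stage_measurable[OF pos Xs] E _ r])
         (use measurable_space[OF block_release_measurable Xs] pos cl in auto)
  qed
  have "47 / 50 * (31 / 32 * (31 / 32)) \<le> measure (?M \<bind> shifted_estimator n \<epsilon> \<delta> K m H u) ?E"
    by (rule measure_bind_ge[OF iid_in_prob_algebra[OF P] shifted_estimator_measurable[OF pos] E sA good _ out]) simp
  then show ?thesis by simp
qed

text \<open>Bias, sampling error and noise receive a third of \<open>\<eta> * sqrt S\<close> each;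
  they are controlled by the choice of \<open>H\<close>, by the lower bound on \<open>sqrt n\<close>
  and by the one on \<open>n * \<epsilon>\<close>. The bias is at most five cell widths divided by
  \<open>H\<close>, which together with the upper bound on the width gives the constant 30.\<close>

lemma mean_estimator_accurate:
  fixes K m n :: nat and \<eta> \<theta> \<zeta> H \<epsilon> \<delta> :: real
  defines "S \<equiv> log_partition'' \<mu> \<theta>"
  assumes \<theta>: "\<theta> \<in> interior \<Phi>" and pos: "0 < n" "60 \<le> K" "0 < \<epsilon>" "0 < \<delta>" "\<delta> \<le> 1" "0 < \<eta>"
    and H: "H = 30 * real K * 3 ^ K / \<eta>"
    and m4: "(\<integral>x. (x - log_partition' \<mu> \<theta>) ^ 4 \<partial>P \<theta>) \<le> \<zeta> * S\<^sup>2" and m: "0 < m" "2000 * \<zeta> \<le> m"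
    and T: "ln (1 / \<delta>) / \<epsilon> + 5 * (1 / \<epsilon>) < 3 * real (n div m) / 10 - 1" and G: "0 < n div m"
    and n1: "30 \<le> \<eta> * sqrt n" and n2: "60 * H * K * 3 ^ K \<le> \<eta> * (n * \<epsilon>)"
  shows "4 / 5 \<le> measure (iid n (P \<theta>) \<bind> mean_estimator n \<epsilon> \<delta> K m H) {t. \<bar>t - log_partition' \<mu> \<theta>\<bar> \<le> \<eta> * sqrt S}"
proof -
  let ?t = "log_partition' \<mu> \<theta>" and ?E = "{t. \<bar>t - log_partition' \<mu> \<theta>\<bar> \<le> \<eta> * sqrt S}"
  have P: "prob_space (P \<theta>)" "sets (P \<theta>) = sets borel" by (simp_all add: prob_space_P interiorD \<theta>)
  have Spos: "0 < S" unfolding S_def by (rule A''_pos[OF \<theta>])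
  have K: "0 < K" using pos by simp
  have Hpos: "0 < H" unfolding H using K pos by simp
  note pos' = pos(1) K pos(3-5) Hpos
  have E: "?E \<in> sets borel" by measurable
  define p where "p u = measure (iid n (P \<theta>) \<bind> shifted_estimator n \<epsilon> \<delta> K m H u) ?E" for u
  obtain Bad v where Bad: "finite Bad" "card Bad \<le> 3"
    and cell: "\<And>u q y. u < K \<Longrightarrow> u \<notin> Bad \<Longrightarrow> S / 2 \<le> q \<Longrightarrow> q \<le> 3 * S / 2 \<Longrightarrow> \<bar>y - ?t\<bar> \<le> sqrt S / 2 \<Longrightarrow> grid_cell K u q y = v u"
    and lo: "\<And>u. u < K \<Longrightarrow> u \<notin> Bad \<Longrightarrow> real K * sqrt S \<le> grid_scale K (fst (v u))"
    and hi: "\<And>u. u < K \<Longrightarrow> u \<notin> Bad \<Longrightarrow> grid_scale K (fst (v u)) \<le> 2 * real K * 3 ^ K * sqrt S"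
    and ctr: "\<And>u. u < K \<Longrightarrow> u \<notin> Bad \<Longrightarrow> \<bar>?t - cell_corner K u (v u)\<bar> \<le> 2 * grid_scale K (fst (v u))"
    by (rule good_shifts[OF K Spos]) blast
  have pu: "22 / 25 \<le> p u" if u: "u < K" "u \<notin> Bad" for u
    unfolding p_def
  proof (rule shifted_estimator_accurate[OF \<theta> pos' m4[unfolded S_def] m T G])
    show "grid_cell K u q y = v u" if "log_partition'' \<mu> \<theta> / 2 \<le> q" "q \<le> 3 * log_partition'' \<mu> \<theta> / 2"
        "\<bar>y - ?t\<bar> \<le> sqrt (log_partition'' \<mu> \<theta>) / 2" for q y
      using cell[OF u] that unfolding S_def by blast
    let ?s = "grid_scale K (fst (v u))" and ?c = "cell_corner K u (v u)"
    have s: "0 < ?s" by (rule grid_scale_pos[OF K])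
    have "1 * sqrt S \<le> real K * sqrt S" using K Spos by (intro mult_right_mono) auto
    then have "sqrt S \<le> ?s" using lo[OF u] by simp
    then have "(sqrt S)\<^sup>2 \<le> ?s\<^sup>2" using Spos by (intro power_mono) auto
    then have S2: "S \<le> ?s\<^sup>2" using Spos by simp
    have "\<bar>?t - ?c\<bar>\<^sup>2 \<le> (2 * ?s)\<^sup>2" using ctr[OF u] by (intro power_mono) auto
    then have "S + (?t - ?c)\<^sup>2 \<le> 5 * ?s\<^sup>2" using S2 by (simp add: power_mult_distrib)
    then have "(S + (?t - ?c)\<^sup>2) / (H * ?s) \<le> 5 * ?s\<^sup>2 / (H * ?s)" using Hpos s by (intro divide_right_mono) auto
    also have "\<dots> = 5 * ?s / H" using s by (simp add: power2_eq_square)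
    also have "\<dots> \<le> 5 * (2 * real K * 3 ^ K * sqrt S) / H" using hi[OF u] Hpos by (intro divide_right_mono mult_left_mono) auto
    also have "\<dots> = \<eta> * sqrt S / 3" unfolding H using K pos by (simp add: field_simps)
    finally have 1: "(S + (?t - ?c)\<^sup>2) / (H * ?s) \<le> \<eta> * sqrt S / 3" .
    have "30 * sqrt S \<le> \<eta> * sqrt n * sqrt S" using n1 Spos by (intro mult_right_mono) auto
    then have 2: "10 * sqrt S / sqrt n \<le> \<eta> * sqrt S / 3" using pos(1) by (simp add: field_simps)
    have "5 * (2 * (H * ?s) / (n * \<epsilon>)) = 10 * H * ?s / (n * \<epsilon>)" by simp
    also have "\<dots> \<le> 10 * H * (2 * real K * 3 ^ K * sqrt S) / (n * \<epsilon>)" using hi[OF u] Hpos pos by (intro divide_right_mono mult_left_mono) auto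
    also have "\<dots> = (60 * H * K * 3 ^ K) * sqrt S / (3 * (n * \<epsilon>))" using pos by (simp add: field_simps)
    also have "\<dots> \<le> (\<eta> * (n * \<epsilon>)) * sqrt S / (3 * (n * \<epsilon>))" using n2 Spos pos by (intro divide_right_mono mult_right_mono) auto
    also have "\<dots> = \<eta> * sqrt S / 3" using pos by simp
    finally have 3: "5 * (2 * (H * ?s) / (n * \<epsilon>)) \<le> \<eta> * sqrt S / 3" .
    show "(log_partition'' \<mu> \<theta> + (?t - ?c)\<^sup>2) / (H * ?s) + 10 * sqrt (log_partition'' \<mu> \<theta>) / sqrt n + 5 * (2 * (H * ?s) / (n * \<epsilon>)) \<le> \<eta> * sqrt S"
      using 1 2 3 unfolding S_def[symmetric] by linarith
  qed
  have p0: "0 \<le> p u" for u by (simp add: p_def)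
  have "card ({..<K} - Bad) * (22 / 25) \<le> (\<Sum>u\<in>{..<K} - Bad. p u)"
    using sum_mono[of "{..<K} - Bad" "\<lambda>_. 22 / 25" p] pu by auto
  also have "\<dots> \<le> (\<Sum>u<K. p u)" by (intro sum_mono2) (use p0 in auto)
  finally have s: "card ({..<K} - Bad) * (22 / 25) \<le> (\<Sum>u<K. p u)" .
  have "card {..<K} - card Bad \<le> card ({..<K} - Bad)" by (rule diff_card_le_card_Diff[OF Bad(1)])
  then have "real K - 3 \<le> card ({..<K} - Bad)" using Bad(2) by simp
  then have "(real K - 3) * (22 / 25) \<le> card ({..<K} - Bad) * (22 / 25)" by (rule mult_right_mono) simp
  then have "(real K - 3) * (22 / 25) \<le> (\<Sum>u<K. p u)" using s by (rule order_trans)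
  \<comment> \<open>K is taken large enough that three useless shifts do not bring the average
    success below 4/5.\<close>
  moreover have "real K * (4 / 5) \<le> (real K - 3) * (22 / 25)" using pos(2) by simp
  ultimately have "real K * (4 / 5) \<le> (\<Sum>u<K. p u)" by linarith
  then have "4 / 5 \<le> (\<Sum>u<K. p u) / K" using K by (simp add: field_simps)
  then show ?thesis unfolding measure_mean_estimator[OF pos' P E] p_def .
qed

end

section \<open>Choice of the constants and the final bound\<close>

lemma DP_return: "0 \<le> \<epsilon> \<Longrightarrow> 0 \<le> \<delta> \<Longrightarrow> DP n borel \<epsilon> \<delta> (\<lambda>_. return borel (0::real))"
  by (rule DP_I) (auto simp: space_prob_algebra prob_space_return intro: close_refl)

text \<open>The kurtosis hypothesis concerns the true mean, whereas \<open>nCLLRE\<close> clips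
  around the estimate \<open>t\<close>.\<close>

lemma (in exp_family) shifted_fourth_moment_le:
  assumes \<theta>: "\<theta> \<in> interior \<Phi>"
  shows "(\<integral>x. (x - t) ^ 4 \<partial>P \<theta>) \<le> 8 * (\<integral>x. (x - t') ^ 4 \<partial>P \<theta>) + 8 * (t' - t) ^ 4"
proof -
  interpret prob_space "P \<theta>" by (rule prob_space_P[OF interiorD[OF \<theta>]])
  have pU: "prob UNIV = 1" using prob_space by simp
  note i = integrable_power_minus[OF \<theta>, where k=4]
  have "(\<integral>x. (x - t) ^ 4 \<partial>P \<theta>) \<le> (\<integral>x. 8 * (x - t') ^ 4 + 8 * (t' - t) ^ 4 \<partial>P \<theta>)"
  proof (intro integral_mono i Bochner_Integration.integrable_add integrable_mult_right integrable_const)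
    show "(x - t) ^ 4 \<le> 8 * (x - t') ^ 4 + 8 * (t' - t) ^ 4" for x
      using power4_add_le[of "x - t'" "t' - t"] by simp
  qed
  also have "\<dots> = (\<integral>x. 8 * (x - t') ^ 4 \<partial>P \<theta>) + (\<integral>x. 8 * (t' - t) ^ 4 \<partial>P \<theta>)"
    by (intro Bochner_Integration.integral_add integrable_mult_right i integrable_const)
  also have "\<dots> = 8 * (\<integral>x. (x - t') ^ 4 \<partial>P \<theta>) + 8 * (t' - t) ^ 4"
    using pU by simp
  finally show ?thesis .
qed

text \<open>Each summand of \<open>k\<close> and of the bound on n pays for one requirement. In
  \<open>k\<close>: \<open>200 * m\<close> for the noise of the vote, the term with \<open>H\<close>
  for the noise of the clipped average, the term with \<open>K4\<close> for the clipping level in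
  \<open>nCLLRE\<close>. In the bound on n: \<open>14 * m\<close> for enough blocks,
  \<open>(30 / \<eta>)\<^sup>2\<close> for the sampling error of the estimator,
  \<open>(4 * C * R)\<^sup>2\<close> and \<open>C\<^sup>2\<close> to keep both radii
  \<open>h\<close> and \<open>h'\<close> within the region controlled by \<open>kappa\<close>, and
  \<open>2 * R\<^sup>2\<close> for the chi-square bound.\<close>

lemma (in exp_family) A_low_risk:
  fixes n m :: nat and C \<zeta> :: real
  defines "\<eta> \<equiv> 1 / (4 * C)" and "R \<equiv> 40 + 60 / C" and "K4 \<equiv> 8 * \<zeta> + 8 * (1 / (4 * C)) ^ 4"
  defines "H \<equiv> 30 * real 60 * 3 ^ 60 / \<eta>"
  assumes \<theta>: "\<theta> \<in> interior \<Phi>" and n: "0 < n" and C: "0 < C" and \<epsilon>: "0 < \<epsilon>" and \<delta>: "0 < \<delta>" "\<delta> \<le> 1"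
    and m4: "fourth_central_moment (P \<theta>) / (log_partition'' \<mu> \<theta>)\<^sup>2 \<le> \<zeta>"
    and kap: "ereal (1 / C * (1 / sqrt (log_partition'' \<mu> \<theta>))) \<le> kappa \<mu> \<theta>"
    and m: "0 < m" "2000 * \<zeta> \<le> m" "m \<le> 2000 * \<zeta> + 1"
    and k: "1 + 200 * m + 240 * H * real 60 * 3 ^ 60 / \<eta> + 512 * C\<^sup>2 * K4 \<le> k" "k / sqrt n \<le> \<epsilon>"
    and N: "14 * m + (30 / \<eta>)\<^sup>2 + (4 * C * R)\<^sup>2 + 2 * R\<^sup>2 + C\<^sup>2 \<le> n"
    and L: "80040 * \<zeta>\<^sup>2 * ln (1 / \<delta>) / \<epsilon> \<le> n"
  shows "risk \<mu> n \<theta> (A_low \<mu> n C \<epsilon> (mean_estimator n (\<epsilon> / 4) \<delta> 60 m H)) \<le> ereal (4 * R) * modulus \<mu> n \<epsilon> \<theta>"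
proof -
  let ?t = "log_partition' \<mu> \<theta>"
  define S where "S = log_partition'' \<mu> \<theta>"
  have Spos: "0 < S" unfolding S_def by (rule A''_pos[OF \<theta>])
  have sS: "0 < sqrt S" "sqrt S * sqrt S = S" using Spos by auto
  have sn: "0 < sqrt n" "1 \<le> sqrt n" "sqrt n * sqrt n = n" using n by auto
  have \<eta>: "0 < \<eta>" and R: "0 < R" using C by (simp_all add: \<eta>_def R_def add_pos_pos)
  have H: "0 < H" using \<eta> by (simp add: H_def)
  have P: "prob_space (P \<theta>)" "sets (P \<theta>) = sets borel" by (simp_all add: prob_space_P interiorD \<theta>)
  have m4': "(\<integral>x. (x - ?t) ^ 4 \<partial>P \<theta>) \<le> \<zeta> * S\<^sup>2"
    using m4 Spos by (simp add: fourth_central_moment_def mean_P[OF \<theta>] S_def divide_le_eq)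
  have \<zeta>: "1 \<le> \<zeta>" using order_trans[OF fourth_moment_ge(1)[OF \<theta>] m4'[unfolded S_def]] Spos by (simp add: S_def)
  have K4: "0 \<le> K4" using \<zeta> by (simp add: K4_def)
  have nn: "0 \<le> 240 * H * real 60 * 3 ^ 60 / \<eta>" "0 \<le> 512 * C\<^sup>2 * K4" using H \<eta> K4 by simp_all
  have k1: "1 \<le> k" "200 * m \<le> k" "240 * H * real 60 * 3 ^ 60 / \<eta> \<le> k" "512 * C\<^sup>2 * K4 \<le> k" using k(1) nn by linarith+
  have sq: "0 \<le> (30 / \<eta>)\<^sup>2" "0 \<le> (4 * C * R)\<^sup>2" "0 \<le> 2 * R\<^sup>2" "0 \<le> C\<^sup>2" by simp_all
  have N1: "14 * m \<le> n" "(30 / \<eta>)\<^sup>2 \<le> n" "(4 * C * R)\<^sup>2 \<le> n" "2 * R\<^sup>2 \<le> n" "C\<^sup>2 \<le> n" using N sq by linarith+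
  have rt: "x \<le> sqrt n" if "x\<^sup>2 \<le> n" "0 \<le> x" for x :: real using that by (simp add: real_le_rsqrt)
  have N2: "30 / \<eta> \<le> sqrt n" "4 * C * R \<le> sqrt n" "C \<le> sqrt n"
    using rt N1 \<eta> C R by simp_all
  have k\<epsilon>: "k \<le> \<epsilon> * sqrt n" using k(2) sn by (simp add: field_simps)
  have n\<epsilon>: "k \<le> n * \<epsilon>"
  proof -
    have "k * 1 \<le> \<epsilon> * sqrt n * sqrt n" using k\<epsilon> sn k1 \<epsilon> by (intro mult_mono) auto
    then show ?thesis using sn by (simp add: mult_ac)
  qed
  \<comment> \<open>Half of the guaranteed radius, to be strictly inside; \<open>S / 2 * r\<close>
    then equals the accuracy \<open>\<eta> * sqrt S\<close> of the initial estimate.\<close>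
  define r where "r = 1 / (2 * C * sqrt S)"
  have r: "0 < r" "r < 1 / C * (1 / sqrt S)" using C sS by (simp_all add: r_def field_simps)
  have I: "s \<in> interior \<Phi> \<and> S / 2 \<le> log_partition'' \<mu> s \<and> log_partition'' \<mu> s \<le> 2 * S" if "s \<in> {\<theta> - r..\<theta> + r}" for s
    using kappaD[OF kap _ that] r(2) by (simp add: S_def)
  define h where "h = R / (sqrt S * sqrt n)"
  \<comment> \<open>The largest shift that \<open>modulus_ge\<close> allows for the variance bound
    2S. The ratio of \<open>h\<close> to it is \<open>4 * R\<close>, free of n and S, and becomes
    the constant of the theorem.\<close>
  define h' where "h' = 1 / (4 * sqrt S * sqrt n)"
  have hr: "2 * h \<le> r"
  proof -
    have "2 * R * (2 * C) \<le> sqrt n" using N2(2) by (simp add: mult_ac)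
    then show ?thesis unfolding h_def r_def using C sS sn by (simp add: field_simps)
  qed
  have hS: "2 * S * h\<^sup>2 \<le> 1"
    unfolding h_def using N1 Spos n by (simp add: power_divide power_mult_distrib field_simps)
  have h'r: "2 * h' \<le> r" unfolding h'_def r_def using N2 C sS sn by (simp add: field_simps)
  have nh': "real n * (2 * S * h'\<^sup>2) \<le> 1 / 8"
    unfolding h'_def using Spos n by (simp add: power_divide power_mult_distrib field_simps)
  have h'0: "0 \<le> h'" using sS sn by (simp add: h'_def)
  have mod: "ereal h' \<le> modulus \<mu> n \<epsilon> \<theta>"
    by (rule modulus_ge[OF h'0 _ nh']) (use I h'r r in auto)
  have T: "ln (1 / \<delta>) / (\<epsilon> / 4) + 5 * (1 / (\<epsilon> / 4)) < 3 * real (n div m) / 10 - 1" and G: "0 < n div m"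
  proof -
    have "m \<le> n" using N1 by linarith
    then show "0 < n div m" using m(1) by (simp add: div_greater_zero_iff)
    have "real n / m < real (n div m) + 1"
    proof -
      have "n < (n div m + 1) * m" using m(1) by (metis Suc_eq_plus1 dividend_less_div_times mult.commute mult_Suc add.commute)
      then have "real n < (real (n div m) + 1) * m" by (metis of_nat_1 of_nat_add of_nat_less_iff of_nat_mult)
      then show ?thesis using m(1) by (simp add: divide_less_eq)
    qed
    moreover have "4 * (ln (1 / \<delta>) / \<epsilon>) \<le> real n / m / 10"
    proof -
      \<comment> \<open>The block size is linear in \<zeta>; \<zeta> \<ge> 1 brings it to the
        quadratic form of the hypothesis on n.\<close>
      have "m \<le> 2001 * \<zeta>\<^sup>2"
      proof -
        have "\<zeta> * 1 \<le> \<zeta> * \<zeta>" using \<zeta> by (intro mult_left_mono) auto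
        then show ?thesis using m(3) \<zeta> unfolding power2_eq_square by linarith
      qed
      moreover have "0 \<le> ln (1 / \<delta>) / \<epsilon>" using \<delta> \<epsilon> by (intro divide_nonneg_pos ln_ge_zero) auto
      ultimately have "40 * m * (ln (1 / \<delta>) / \<epsilon>) \<le> 40 * (2001 * \<zeta>\<^sup>2) * (ln (1 / \<delta>) / \<epsilon>)"
        by (intro mult_right_mono mult_left_mono) auto
      also have "\<dots> \<le> n" using L by simp
      finally show ?thesis using m(1) by (simp add: pos_le_divide_eq mult_ac)
    qed
    moreover have "20 / \<epsilon> \<le> real n / m / 10"
    proof -
      have "200 * m \<le> n * \<epsilon>" using k1 n\<epsilon> by linarith
      then show ?thesis using m(1) \<epsilon> by (simp add: field_simps)
    qed
    moreover have "14 / 10 \<le> real n / m / 10" using N1 m(1) by (simp add: field_simps)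
    \<comment> \<open>The right side exceeds 3x/10 - 13/10. Two tenths of x = n/m pay for the
      threshold and the noise, the third one, being at least 14/10, for the constant.\<close>
    moreover have "4 * l + d < 3 * g / 10 - 1" if "x < g + 1" "4 * l \<le> x / 10" "d \<le> x / 10" "14 / 10 \<le> x / 10"
      for x g l d :: real using that by linarith
    ultimately have "4 * (ln (1 / \<delta>) / \<epsilon>) + 20 / \<epsilon> < 3 * real (n div m) / 10 - 1" by blast
    then show "ln (1 / \<delta>) / (\<epsilon> / 4) + 5 * (1 / (\<epsilon> / 4)) < 3 * real (n div m) / 10 - 1" by (simp add: mult_ac)
  qed
  have \<epsilon>4: "0 < \<epsilon> / 4" and \<epsilon>2: "0 < \<epsilon> / 2" using \<epsilon> by simp_all
  have n1: "30 \<le> \<eta> * sqrt n" using N2(1) \<eta> by (simp add: field_simps)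
  have n2: "60 * H * real 60 * 3 ^ 60 \<le> \<eta> * (n * (\<epsilon> / 4))"
  proof -
    have "240 * H * real 60 * 3 ^ 60 / \<eta> \<le> n * \<epsilon>" using k1(3) n\<epsilon> by (rule order_trans)
    then show ?thesis using \<eta> by (simp add: field_simps)
  qed
  have est: "4 / 5 \<le> measure (iid n (P \<theta>) \<bind> mean_estimator n (\<epsilon> / 4) \<delta> 60 m H) {t. \<bar>t - ?t\<bar> \<le> \<eta> * sqrt S}"
    using mean_estimator_accurate[OF \<theta> n order_refl \<epsilon>4 \<delta> \<eta> H_def[THEN meta_eq_to_obj_eq] m4'[unfolded S_def] m(1,2) T G n1 n2]
    by (simp add: S_def)
  have acc: "19 / 20 \<le> measure (iid n (P \<theta>) \<bind> (\<lambda>X. nCLLRE \<mu> n C (\<epsilon> / 2) X t)) {\<theta>'. \<bar>\<theta>' - \<theta>\<bar> \<le> h}"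
    if "t \<in> {t. \<bar>t - ?t\<bar> \<le> \<eta> * sqrt S}" for t
  proof (rule nCLLRE_accuracy[OF n C \<epsilon>2 S_def less_imp_le[OF r(1)] I])
    have t: "\<bar>t - ?t\<bar> \<le> \<eta> * sqrt S" using that by simp
    also have "\<eta> * sqrt S = S / 2 * r"
    proof -
      have "S / 2 * r = sqrt S * sqrt S / 2 * r" using sS by simp
      also have "\<dots> = \<eta> * sqrt S" using C sS(1) unfolding r_def \<eta>_def by (simp del: real_sqrt_mult_self)
      finally show ?thesis by simp
    qed
    finally show "\<bar>t - ?t\<bar> \<le> S / 2 * r" .
    show "h = (40 + 60 / C) / (sqrt S * sqrt n)" by (simp add: h_def R_def)
    show "2 * h \<le> r" "2 * S * h\<^sup>2 \<le> 1" by fact+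
    have "\<bar>?t - t\<bar> ^ 4 \<le> (\<eta> * sqrt S) ^ 4" using t by (intro power_mono) (auto simp: abs_minus_commute)
    also have "\<dots> = \<eta> ^ 4 * S\<^sup>2"
    proof -
      have "sqrt S ^ 4 = ((sqrt S)\<^sup>2)\<^sup>2" by simp
      also have "\<dots> = S\<^sup>2" using Spos by (simp only: real_sqrt_pow2 less_imp_le)
      finally show ?thesis by (simp add: power_mult_distrib)
    qed
    finally have "(?t - t) ^ 4 \<le> \<eta> ^ 4 * S\<^sup>2" by simp
    then show "(\<integral>x. (x - t) ^ 4 \<partial>P \<theta>) \<le> K4 * S\<^sup>2"
      using shifted_fourth_moment_le[OF \<theta>, of t ?t] m4' unfolding K4_def \<eta>_def by (simp add: distrib_right)
    have "512 * C\<^sup>2 * K4 \<le> k * 1" using k1 by simp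
    \<comment> \<open>Here the summand 1 of \<open>k\<close> enters: the clipping condition is
      quadratic in \<open>\<epsilon> * sqrt n\<close>, and k \<ge> 1 allows passing to the
      square.\<close>
    also have "\<dots> \<le> k * k" using k1 by (intro mult_left_mono) auto
    also have "\<dots> \<le> (\<epsilon> * sqrt n) * (\<epsilon> * sqrt n)" using k\<epsilon> k1 by (intro mult_mono) auto
    also have "\<dots> = \<epsilon>\<^sup>2 * n" using sn(3) by (simp add: power2_eq_square)
    finally show "128 * C\<^sup>2 * K4 \<le> (\<epsilon> / 2)\<^sup>2 * n" by (simp add: power_divide)
  qed
  have E: "{t. \<bar>t - ?t\<bar> \<le> \<eta> * sqrt S} \<in> sets borel" "{\<theta>'. \<bar>\<theta>' - \<theta>\<bar> \<le> h} \<in> sets borel" by measurable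
  have K60: "(0::nat) < 60" by simp
  have "4 / 5 * (19 / 20) \<le> measure (iid (2 * n) (P \<theta>) \<bind> A_low \<mu> n C \<epsilon> (mean_estimator n (\<epsilon> / 4) \<delta> 60 m H)) {\<theta>'. \<bar>\<theta>' - \<theta>\<bar> \<le> h}"
    by (rule A_low_measure_ge[OF base n C \<epsilon> mean_estimator_measurable[OF n K60 \<epsilon>4 \<delta> H] P E _ est _ acc]) simp_all
  then have "3 / 4 \<le> measure (iid (2 * n) (P \<theta>) \<bind> A_low \<mu> n C \<epsilon> (mean_estimator n (\<epsilon> / 4) \<delta> 60 m H)) {\<theta>'. \<bar>\<theta>' - \<theta>\<bar> \<le> h}"
    by simp
  then have "risk \<mu> n \<theta> (A_low \<mu> n C \<epsilon> (mean_estimator n (\<epsilon> / 4) \<delta> 60 m H)) \<le> ereal h"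
    unfolding risk_def by (intro Inf_lower) blast
  also have "ereal h = ereal (4 * R) * ereal h'" by (simp add: h_def h'_def)
  also have "\<dots> \<le> ereal (4 * R) * modulus \<mu> n \<epsilon> \<theta>" using mod R by (intro ereal_mult_left_mono) auto
  finally show ?thesis .
qed

theorem proposition4p15:
  shows "(\<forall>(\<mu> :: real measure) (n :: nat) (\<epsilon> :: real) (\<delta> :: real) (C :: real)
        (M :: (nat \<Rightarrow> real) \<Rightarrow> real measure).
       base_measure \<mu> \<and> n \<ge> 1 \<and> \<epsilon> > 0 \<and> \<delta> \<in> {0..1} \<and> C > 0 \<and> DP n borel (\<epsilon> / 2) \<delta> M
       \<longrightarrow> DP (2 * n) borel \<epsilon> \<delta> (A_low \<mu> n C \<epsilon> M)) \<and>
     (\<exists>c::real. c > 0 \<and>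
       (\<forall>(\<zeta> :: real) (C :: real) (\<epsilon> :: nat \<Rightarrow> real) (\<delta> :: nat \<Rightarrow> real).
          \<zeta> > 0 \<and> C > 0 \<and> (\<forall>n. \<epsilon> n > 0) \<and> (\<forall>n. \<delta> n \<in> {0..1}) \<longrightarrow>
          (\<exists>(M :: nat \<Rightarrow> (nat \<Rightarrow> real) \<Rightarrow> real measure) (N :: nat) (k :: real) (C' :: real) (D :: real).
             (\<forall>n. DP n borel (\<epsilon> n / 2) (\<delta> n) (M n)) \<and> k \<ge> 0 \<and> C' > 0 \<and> D > 0 \<and>
             (\<forall>(\<mu> :: real measure) (\<theta>\<^sub>0 :: real) (n :: nat).
                base_measure \<mu> \<and>
                \<theta>\<^sub>0 \<in> interior (param_space \<mu>) \<and>
                \<epsilon> n \<ge> k / sqrt (real n) \<and>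
                fourth_central_moment (expfam \<mu> \<theta>\<^sub>0) / (log_partition'' \<mu> \<theta>\<^sub>0)\<^sup>2 \<le> \<zeta> \<and>
                kappa \<mu> \<theta>\<^sub>0 \<ge> ereal (1 / C * (1 / sqrt (log_partition'' \<mu> \<theta>\<^sub>0))) \<and>
                ereal (real n) \<ge> Max {ereal (real N),
                   ereal (c * \<zeta>\<^sup>2) * ln_recip (\<delta> n) / ereal (\<epsilon> n),
                   ereal (2 * ln (1 / (D * log_partition'' \<mu> \<theta>\<^sub>0)\<^sup>2) / (D * log_partition'' \<mu> \<theta>\<^sub>0)\<^sup>2)}
                \<longrightarrow> risk \<mu> n \<theta>\<^sub>0 (A_low \<mu> n C (\<epsilon> n) (M n))
                      \<le> ereal C' * modulus \<mu> n (\<epsilon> n) \<theta>\<^sub>0))))"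
proof (intro conjI exI[of _ "80040::real"] allI impI)
  show "DP (2 * n) borel \<epsilon> \<delta> (A_low \<mu> n C \<epsilon> M)"
    if "base_measure \<mu> \<and> n \<ge> 1 \<and> \<epsilon> > 0 \<and> \<delta> \<in> {0..1} \<and> C > 0 \<and> DP n borel (\<epsilon> / 2) \<delta> M" for \<mu> n \<epsilon> \<delta> C M
    using that by (auto intro!: A_low_private)
next
  (* 80040 = 40 * 2001, where 2001 * \<zeta>\<^sup>2 bounds the block size m. *)
  fix \<zeta> C :: real and \<epsilon> \<delta> :: "nat \<Rightarrow> real"
  assume "\<zeta> > 0 \<and> C > 0 \<and> (\<forall>n. \<epsilon> n > 0) \<and> (\<forall>n. \<delta> n \<in> {0..1})"
  then have \<zeta>: "0 < \<zeta>" and C: "0 < C" and \<epsilon>: "\<And>n. 0 < \<epsilon> n" and \<delta>: "\<And>n. 0 \<le> \<delta> n" "\<And>n. \<delta> n \<le> 1" by auto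
  define \<eta> where "\<eta> = 1 / (4 * C)"
  define R where "R = 40 + 60 / C"
  define K4 where "K4 = 8 * \<zeta> + 8 * (1 / (4 * C)) ^ 4"
  define H where "H = 30 * real 60 * 3 ^ 60 / \<eta>"
  define m where "m = nat \<lceil>2000 * \<zeta>\<rceil>"
  define k where "k = 1 + 200 * m + 240 * H * real 60 * 3 ^ 60 / \<eta> + 512 * C\<^sup>2 * K4"
  define N where "N = nat \<lceil>1 + (14 * m + (30 / \<eta>)\<^sup>2 + (4 * C * R)\<^sup>2 + 2 * R\<^sup>2 + C\<^sup>2)\<rceil>"
  \<comment> \<open>For \<delta> = 0 the condition on n cannot hold, and n = 0 is excluded by the
    summand 1 in \<open>N\<close>. In these cases only privacy is asked for, and a constant output
    provides it.\<close>
  define M where "M n = (if n = 0 \<or> \<delta> n = 0 then (\<lambda>_. return borel 0) else mean_estimator n (\<epsilon> n / 4) (\<delta> n) 60 m H)" for n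
  have m: "0 < m" "2000 * \<zeta> \<le> m" "m \<le> 2000 * \<zeta> + 1" using \<zeta> unfolding m_def by (simp, linarith+)
  have \<eta>: "0 < \<eta>" and R: "0 < R" using C by (simp_all add: \<eta>_def R_def add_pos_pos)
  have H: "0 < H" using \<eta> by (simp add: H_def)
  have k: "0 \<le> k" using H \<eta> \<zeta> C unfolding k_def K4_def by (intro add_nonneg_nonneg) auto
  have Nle: "1 + (14 * m + (30 / \<eta>)\<^sup>2 + (4 * C * R)\<^sup>2 + 2 * R\<^sup>2 + C\<^sup>2) \<le> N" unfolding N_def by (rule real_nat_ceiling_ge)
  have priv: "DP n borel (\<epsilon> n / 2) (\<delta> n) (M n)" for n
  proof (cases "n = 0 \<or> \<delta> n = 0")
    case True
    then show ?thesis using DP_return[of "\<epsilon> n / 2" "\<delta> n" n] \<epsilon>[of n] \<delta>(1)[of n] by (simp add: M_def less_imp_le)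
  next
    case False
    then have "0 < n" "0 < \<delta> n" using \<delta>(1)[of n] by auto
    then show ?thesis using mean_estimator_private[of n 60 "\<epsilon> n / 4" "\<delta> n" H m] \<epsilon>[of n] \<delta>(2)[of n] H False by (simp add: M_def)
  qed
  show "\<exists>(M :: nat \<Rightarrow> (nat \<Rightarrow> real) \<Rightarrow> real measure) (N :: nat) (k :: real) (C' :: real) (D :: real).
           (\<forall>n. DP n borel (\<epsilon> n / 2) (\<delta> n) (M n)) \<and> k \<ge> 0 \<and> C' > 0 \<and> D > 0 \<and>
           (\<forall>(\<mu> :: real measure) (\<theta>\<^sub>0 :: real) (n :: nat).
              base_measure \<mu> \<and>
              \<theta>\<^sub>0 \<in> interior (param_space \<mu>) \<and>
              \<epsilon> n \<ge> k / sqrt (real n) \<and>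
              fourth_central_moment (expfam \<mu> \<theta>\<^sub>0) / (log_partition'' \<mu> \<theta>\<^sub>0)\<^sup>2 \<le> \<zeta> \<and>
              kappa \<mu> \<theta>\<^sub>0 \<ge> ereal (1 / C * (1 / sqrt (log_partition'' \<mu> \<theta>\<^sub>0))) \<and>
              ereal (real n) \<ge> Max {ereal (real N),
                 ereal (80040 * \<zeta>\<^sup>2) * ln_recip (\<delta> n) / ereal (\<epsilon> n),
                 ereal (2 * ln (1 / (D * log_partition'' \<mu> \<theta>\<^sub>0)\<^sup>2) / (D * log_partition'' \<mu> \<theta>\<^sub>0)\<^sup>2)}
              \<longrightarrow> risk \<mu> n \<theta>\<^sub>0 (A_low \<mu> n C (\<epsilon> n) (M n))
                    \<le> ereal C' * modulus \<mu> n (\<epsilon> n) \<theta>\<^sub>0)"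
  proof (rule exI[of _ M], rule exI[of _ N], rule exI[of _ k], rule exI[of _ "4 * R"], rule exI[of _ 1],
      intro conjI allI impI priv k)
    fix \<mu> :: "real measure" and \<theta> :: real and n :: nat
    assume hyp: "base_measure \<mu> \<and> \<theta> \<in> interior (param_space \<mu>) \<and> \<epsilon> n \<ge> k / sqrt (real n) \<and>
              fourth_central_moment (expfam \<mu> \<theta>) / (log_partition'' \<mu> \<theta>)\<^sup>2 \<le> \<zeta> \<and>
              kappa \<mu> \<theta> \<ge> ereal (1 / C * (1 / sqrt (log_partition'' \<mu> \<theta>))) \<and>
              ereal (real n) \<ge> Max {ereal (real N),
                 ereal (80040 * \<zeta>\<^sup>2) * ln_recip (\<delta> n) / ereal (\<epsilon> n),
                 ereal (2 * ln (1 / (1 * log_partition'' \<mu> \<theta>)\<^sup>2) / (1 * log_partition'' \<mu> \<theta>)\<^sup>2)}"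
    then interpret exp_family \<mu> by unfold_locales simp
    have mx: "ereal (real N) \<le> ereal (real n)" "ereal (80040 * \<zeta>\<^sup>2) * ln_recip (\<delta> n) / ereal (\<epsilon> n) \<le> ereal (real n)"
    proof -
      have "a \<le> x \<and> b \<le> x" if "Max {a, b, c} \<le> x" for a b c x :: ereal using that by simp
      from this[OF hyp[THEN conjunct2, THEN conjunct2, THEN conjunct2, THEN conjunct2, THEN conjunct2]]
      show "ereal (real N) \<le> ereal (real n)" "ereal (80040 * \<zeta>\<^sup>2) * ln_recip (\<delta> n) / ereal (\<epsilon> n) \<le> ereal (real n)"
        by blast+
    qed
    have Nn: "1 + (14 * m + (30 / \<eta>)\<^sup>2 + (4 * C * R)\<^sup>2 + 2 * R\<^sup>2 + C\<^sup>2) \<le> n" using mx(1) Nle by simp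
    have n: "0 < n"
    proof (rule ccontr)
      assume "\<not> 0 < n"
      then have "1 + (14 * real m + (30 / \<eta>)\<^sup>2 + (4 * C * R)\<^sup>2 + 2 * R\<^sup>2 + C\<^sup>2) \<le> 0" using Nn by simp
      moreover have "0 \<le> 14 * real m + (30 / \<eta>)\<^sup>2 + (4 * C * R)\<^sup>2 + 2 * R\<^sup>2 + C\<^sup>2" by (intro add_nonneg_nonneg) auto
      ultimately show False by linarith
    qed
    have \<delta>n: "\<delta> n \<noteq> 0"
    proof
      assume "\<delta> n = 0"
      then have "ereal (80040 * \<zeta>\<^sup>2) * ln_recip (\<delta> n) / ereal (\<epsilon> n) = \<infinity>" using \<zeta> \<epsilon>[of n] by (simp add: ln_recip_def)
      then show False using mx(2) by simp
    qed
    then have \<delta>': "0 < \<delta> n" using \<delta>(1)[of n] by simp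
    have L: "80040 * \<zeta>\<^sup>2 * ln (1 / \<delta> n) / \<epsilon> n \<le> n" using mx(2) \<delta>n \<epsilon>[of n] by (simp add: ln_recip_def)
    have Mn: "M n = mean_estimator n (\<epsilon> n / 4) (\<delta> n) 60 m H" using n \<delta>n by (simp add: M_def)
    show "risk \<mu> n \<theta> (A_low \<mu> n C (\<epsilon> n) (M n)) \<le> ereal (4 * R) * modulus \<mu> n (\<epsilon> n) \<theta>"
      unfolding Mn H_def \<eta>_def R_def
      by (rule A_low_risk[OF _ n C \<epsilon> \<delta>' \<delta>(2) _ _ m])
         (use hyp L Nn in \<open>auto simp: k_def K4_def H_def \<eta>_def R_def\<close>)
  qed (use R in auto)
qed simp

end
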